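(* For every positive integer $n$, the $\mathfrak{sp}(4)$ clasp $f_n$ of weight $(n,0)$ satisfies, with $Q=f_{n-1}\otimes\mathrm{id}_1\in\mathrm{Hom}(1^n,1^n)$, $$f_n=Q+\frac{[2n][n+1][n-1]}{[2n+2][n][n]}\;Q\circ(\mathrm{id}_{1^{n-2}}\otimes U)\circ Q+\frac{[n-1]}{[n][2]}\;Q\circ(\mathrm{id}_{1^{n-2}}\otimes X)\circ Q,$$ where $U$ and $X$ are the cup-cap web and the tetravalent vertex on two type 1 strands (the last two terms are absent for $n=1$).
   Context: Ground field $K=\mathbb{C}(q^{1/2})$; $[n]=\frac{q^{n/2}-q^{-n/2}}{q^{1/2}-q^{-1/2}}$. Webs. An $\mathfrak{sp}(4)$ web in a rectangle is an unoriented planar graph (possibly with closed loops without vertices), up to isotopy, with edges of two types, type 1 (single) and type 2 (double), whose interior vertices are trivalent with two type 1 edges and one type 2 edge, and whose univalent vertices lie on the bottom and top sides. For words $s,t$ in the letters $1,2$, $\mathrm{Hom}(s,t)$ is the $K$-vector space spanned by webs whose bottom (top) endpoints have types $s$ (resp. $t$), left to right, modulo the local relations: a type 1 loop equals $-\frac{[6][2]}{[3]}$; a type 2 loop equals $\frac{[6][5]}{[3][2]}$; a type 2 edge ending at a vertex whose two type 1 half-edges form a loop bounding an empty disc equals $0$; a bigon of two type 1 edges with two type 2 legs equals $-[2]^2$ times a type 2 strand; a triangle of type 1 edges with three type 2 legs equals $0$; and, for four type 1 boundary points (top-left, top-right, bottom-left, bottom-right), $$I-J=U-V,$$ where $I$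 joins the two top points at one vertex and the two bottom points at another vertex, connected by a vertical type 2 edge; $J$ joins the two left points at one vertex and the two right points at another, connected by a horizontal type 2 edge; $U$ joins the top two points by an arc and the bottom two points by an arc; $V$ consists of two vertical strands. Composition stacks diagrams (the left factor on top), $\otimes$ is juxtaposition. The tetravalent vertex (crossing of two type 1 strands) is by definition $X=J-V$ $(=I-U)$. Clasps. The weight of a word with $a$ letters $1$ and $b$ letters $2$ is $(a,b)$, meaning $a\lambda_1+b\lambda_2$ (fundamental weights of $\mathfrak{sp}(4)$, $\dim V_{\lambda_1}=4$, $\dim V_{\lambda_2}=5$). The partial order is generated by $(a,b)\succ(a-2,b+1)$ and $(a,b)\succ(a+2,b-2)$. The clasp of a word $s$ is the unique nonzero idempotent $P_s\in\mathrm{Hom}(s,s)$ such that $w\circ P_s=0$ for $w\in\mathrm{Hom}(s,t)$ and $P_s\circ w'=0$ for $w'\in\mathrm{Hom}(t,s)$ whenever the weight of $t$ is strictly less than that of $s$. Here $f_n=P_{1^n}$ ($f_0$ empty). *)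

theory Defs
  imports "HOL-Library.Poly_Mapping" "HOL-Library.Multiset"
    "HOL-Computational_Algebra.Polynomial" "HOL-Computational_Algebra.Fraction_Field"
begin

section \<open>The ground field\<close>

text \<open>The field of rational functions over the complex numbers in one
  indeterminate \<open>q_half\<close>, which plays the role of the square root of \<open>q\<close>.\<close>

type_synonym K = "complex poly fract"

definition q_half :: K where "q_half = Fract [:0, 1:] 1"

definition qint :: "nat \<Rightarrow> K" where
  "qint n = (q_half ^ n - inverse q_half ^ n) / (q_half - inverse q_half)"


section \<open>Web diagrams\<close>

text \<open>A planar graph in a rectangle is drawn in general position with respect to the
  height function: it is cut by horizontal lines into layers, each of which consists of
  vertical strands and a single piece. A piece is a local minimum (\<open>Cup\<close>) or a local
  maximum (\<open>Cap\<close>) of an edge, or a trivalent vertex. A vertex may have any position: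
  \<open>Vertex xs ys\<close> has legs of types \<open>xs\<close> leaving downwards and
  \<open>ys\<close> leaving upwards, both from left to right.\<close>

datatype strand = T1 | T2

type_synonym word = "strand list"

datatype piece = Cup strand | Cap strand | Vertex word word

primrec piece_bot :: "piece \<Rightarrow> word" where
  "piece_bot (Cup a) = []"
| "piece_bot (Cap a) = [a, a]"
| "piece_bot (Vertex xs ys) = xs"

primrec piece_top :: "piece \<Rightarrow> word" where
  "piece_top (Cup a) = [a, a]"
| "piece_top (Cap a) = []"
| "piece_top (Vertex xs ys) = ys"

text \<open>Three legs can be arranged around a vertex in only one cyclic order, so
  admissibility of a vertex only depends on the multiset of its legs.\<close>

primrec valid_piece :: "piece \<Rightarrow> bool" where
  "valid_piece (Cup a) \<longleftrightarrow> True"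
| "valid_piece (Cap a) \<longleftrightarrow> True"
| "valid_piece (Vertex xs ys) \<longleftrightarrow> mset (xs @ ys) = {#T1, T1, T2#}"

text \<open>The layer \<open>(l, p, r)\<close> is the piece \<open>p\<close> with vertical strands \<open>l\<close> to its left and
  \<open>r\<close> to its right.\<close>

type_synonym layer = "word \<times> piece \<times> word"

text \<open>\<open>layers s ls t\<close>: the layers \<open>ls\<close>, listed from bottom to top, fit together to a
  drawing with bottom boundary \<open>s\<close> and top boundary \<open>t\<close>.\<close>

fun layers :: "word \<Rightarrow> layer list \<Rightarrow> word \<Rightarrow> bool" where
  "layers s [] t \<longleftrightarrow> s = t"
| "layers s ((l, p, r) # ls) t \<longleftrightarrow>
     valid_piece p \<and> s = l @ piece_bot p @ r \<and> layers (l @ piece_top p @ r) ls t"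

fun pad :: "word \<Rightarrow> word \<Rightarrow> layer \<Rightarrow> layer" where
  "pad a b (l, p, r) = (a @ l, p, r @ b)"

lemma layers_append:
  "layers s ls t \<Longrightarrow> layers t ls' u \<Longrightarrow> layers s (ls @ ls') u"
  by (induction s ls t rule: layers.induct) auto

lemma layers_pad:
  "layers s ls t \<Longrightarrow> layers (a @ s @ b) (map (pad a b) ls) (a @ t @ b)"
  by (induction s ls t rule: layers.induct) auto

typedef diagram = "{(s, ls, t). layers s ls t}"
  by (rule exI[of _ "([], [], [])"]) simp

setup_lifting type_definition_diagram

lift_definition dbot :: "diagram \<Rightarrow> word" is fst .

lift_definition dtop :: "diagram \<Rightarrow> word" is "\<lambda>(s, ls, t). t" .

lift_definition did :: "word \<Rightarrow> diagram" is "\<lambda>s. (s, [], s)"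
  by simp

text \<open>Only meaningful for valid pieces.\<close>

lift_definition dpiece :: "piece \<Rightarrow> diagram" is
  "\<lambda>p. if valid_piece p then (piece_bot p, [([], p, [])], piece_top p) else ([], [], [])"
  by auto

text \<open>Stacking, left factor on top; only meaningful if the boundaries match.\<close>

lift_definition dcomp :: "diagram \<Rightarrow> diagram \<Rightarrow> diagram" is
  "\<lambda>(s', ls', t') (s, ls, t). if t = s' then (s, ls @ ls', t') else (s', ls', t')"
  by (auto intro: layers_append split: if_splits)

text \<open>Juxtaposition; the layers of the right factor are placed below those of the left one.\<close>

lift_definition dtens :: "diagram \<Rightarrow> diagram \<Rightarrow> diagram" is
  "\<lambda>(s, ls, t) (s', ls', t').
     (s @ s', map (pad s []) ls' @ map (pad [] t') ls, t @ t')"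
proof -
  fix x y :: "word \<times> layer list \<times> word"
  obtain s ls t where x: "x = (s, ls, t)" by (cases x)
  obtain s' ls' t' where y: "y = (s', ls', t')" by (cases y)
  assume "x \<in> {(s, ls, t). layers s ls t}" "y \<in> {(s, ls, t). layers s ls t}"
  then have "layers (s @ s') (map (pad s []) ls') (s @ t')"
    and "layers (s @ t') (map (pad [] t') ls) (t @ t')"
    using layers_pad[of s' ls' t' s "[]"] layers_pad[of s ls t "[]" t'] x y by auto
  then show "(case x of (s, ls, t) \<Rightarrow> \<lambda>(s', ls', t').
      (s @ s', map (pad s []) ls' @ map (pad [] t') ls, t @ t')) y
      \<in> {(s, ls, t). layers s ls t}"
    using x y by (auto intro: layers_append)
qed

lemma dbot_dtop_simps [simp]:
  "dbot (did s) = s" "dtop (did s) = s"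
  "valid_piece p \<Longrightarrow> dbot (dpiece p) = piece_bot p"
  "valid_piece p \<Longrightarrow> dtop (dpiece p) = piece_top p"
  "dbot d = dtop e \<Longrightarrow> dbot (dcomp d e) = dbot e"
  "dtop (dcomp d e) = dtop d"
  "dbot (dtens d e) = dbot d @ dbot e"
  "dtop (dtens d e) = dtop d @ dtop e"
  by (transfer; auto)+

lemma dcomp_mismatch: "dbot d \<noteq> dtop e \<Longrightarrow> dcomp d e = d"
  by transfer auto


section \<open>Webs: diagrams up to planar isotopy\<close>

text \<open>Two drawings in general position are isotopic relative to the boundary iff they are
  related by exchanging the heights of pieces lying side by side (\<open>interchange\<close>),
  straightening an edge (\<open>snake\<close>), and turning a vertex, where its outermost leg on one
  side passes from pointing downwards to pointing upwards (\<open>turn\<close>).\<close>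

inductive isotopic :: "diagram \<Rightarrow> diagram \<Rightarrow> bool" where
  refl: "isotopic d d"
| sym: "isotopic d e \<Longrightarrow> isotopic e d"
| trans: "isotopic d e \<Longrightarrow> isotopic e f \<Longrightarrow> isotopic d f"
| comp: "isotopic d d' \<Longrightarrow> isotopic e e' \<Longrightarrow> dbot d = dtop e \<Longrightarrow>
    isotopic (dcomp d e) (dcomp d' e')"
| tens: "isotopic d d' \<Longrightarrow> isotopic e e' \<Longrightarrow> isotopic (dtens d e) (dtens d' e')"
| interchange:
    "isotopic (dtens d e) (dcomp (dtens (did (dtop d)) e) (dtens d (did (dbot e))))"
| snake_right:
    "isotopic (dcomp (dtens (dpiece (Cap a)) (did [a])) (dtens (did [a]) (dpiece (Cup a))))
       (did [a])"
| snake_left: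
    "isotopic (dcomp (dtens (did [a]) (dpiece (Cap a))) (dtens (dpiece (Cup a)) (did [a])))
       (did [a])"
| turn_right: "valid_piece (Vertex (xs @ [a]) ys) \<Longrightarrow>
    isotopic (dcomp (dtens (dpiece (Vertex (xs @ [a]) ys)) (did [a]))
                    (dtens (did xs) (dpiece (Cup a))))
      (dpiece (Vertex xs (ys @ [a])))"
| turn_left: "valid_piece (Vertex (a # xs) ys) \<Longrightarrow>
    isotopic (dcomp (dtens (did [a]) (dpiece (Vertex (a # xs) ys)))
                    (dtens (dpiece (Cup a)) (did xs)))
      (dpiece (Vertex xs (a # ys)))"

lemma isotopic_boundary: "isotopic d e \<Longrightarrow> dbot d = dbot e \<and> dtop d = dtop e"
  by (induction rule: isotopic.induct) auto

quotient_type web = diagram / isotopic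
  by (intro equivpI reflpI sympI transpI) (blast intro: isotopic.intros)+

lift_definition wbot :: "web \<Rightarrow> word" is dbot
  by (simp add: isotopic_boundary)

lift_definition wtop :: "web \<Rightarrow> word" is dtop
  by (simp add: isotopic_boundary)

lift_definition wid :: "word \<Rightarrow> web" is did .

lift_definition wpiece :: "piece \<Rightarrow> web" is dpiece .

lift_definition wcomp :: "web \<Rightarrow> web \<Rightarrow> web" is dcomp
proof -
  fix d d' e e'
  assume h: "isotopic d d'" "isotopic e e'"
  show "isotopic (dcomp d e) (dcomp d' e')"
  proof (cases "dbot d = dtop e")
    case True
    with h show ?thesis by (blast intro: isotopic.comp)
  next
    case False
    with h show ?thesis by (simp add: dcomp_mismatch isotopic_boundary)
  qed
qed

lift_definition wtens :: "web \<Rightarrow> web \<Rightarrow> web" is dtens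
  by (rule isotopic.tens)

lemma wbot_wtop_simps [simp]:
  "wbot (wid s) = s" "wtop (wid s) = s"
  "valid_piece p \<Longrightarrow> wbot (wpiece p) = piece_bot p"
  "valid_piece p \<Longrightarrow> wtop (wpiece p) = piece_top p"
  "wbot x = wtop y \<Longrightarrow> wbot (wcomp x y) = wbot y"
  "wtop (wcomp x y) = wtop x"
  "wbot (wtens x y) = wbot x @ wbot y"
  "wtop (wtens x y) = wtop x @ wtop y"
  by (transfer; simp)+


section \<open>Formal linear combinations of webs\<close>

type_synonym lincomb = "web \<Rightarrow>\<^sub>0 K"

definition lscale :: "K \<Rightarrow> lincomb \<Rightarrow> lincomb" where
  "lscale c f = Poly_Mapping.map ((*) c) f"

abbreviation keys :: "lincomb \<Rightarrow> web set" where "keys \<equiv> Poly_Mapping.keys"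

abbreviation coeff_of :: "lincomb \<Rightarrow> web \<Rightarrow> K" where "coeff_of \<equiv> Poly_Mapping.lookup"

abbreviation lin :: "web \<Rightarrow> lincomb" where "lin x \<equiv> Poly_Mapping.single x 1"

lemma lookup_lscale [simp]: "coeff_of (lscale c f) x = c * coeff_of f x"
  by (simp add: lscale_def map.rep_eq when_def)

interpretation lincomb: vector_space lscale
  by unfold_locales (auto intro!: poly_mapping_eqI simp: lookup_add algebra_simps)

text \<open>The bilinear extension of a map given on pairs of webs.\<close>

definition bilin :: "(web \<Rightarrow> web \<Rightarrow> lincomb) \<Rightarrow> lincomb \<Rightarrow> lincomb \<Rightarrow> lincomb" where
  "bilin h f g = (\<Sum>x\<in>keys f. \<Sum>y\<in>keys g. lscale (coeff_of f x * coeff_of g y) (h x y))"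

lemma bilin_superset:
  assumes "finite A" "keys f \<subseteq> A" "finite B" "keys g \<subseteq> B"
  shows "bilin h f g = (\<Sum>x\<in>A. \<Sum>y\<in>B. lscale (coeff_of f x * coeff_of g y) (h x y))"
proof -
  have "bilin h f g
      = (\<Sum>x\<in>keys f. \<Sum>y\<in>B. lscale (coeff_of f x * coeff_of g y) (h x y))"
    unfolding bilin_def using assms
    by (intro sum.cong refl sum.mono_neutral_left) (auto simp: in_keys_iff)
  also have "\<dots> = (\<Sum>x\<in>A. \<Sum>y\<in>B. lscale (coeff_of f x * coeff_of g y) (h x y))"
    using assms by (intro sum.mono_neutral_left) (auto simp: in_keys_iff)
  finally show ?thesis .
qed

lemma bilin_add_left: "bilin h (f + f') g = bilin h f g + bilin h f' g"
proof -
  let ?A = "keys f \<union> keys f'"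
  have "finite ?A" "keys f \<subseteq> ?A" "keys f' \<subseteq> ?A" "keys (f + f') \<subseteq> ?A"
    by (auto dest: subsetD[OF keys_add])
  then show ?thesis
    by (simp add: bilin_superset[of ?A _ "keys g"] lookup_add distrib_right
        lincomb.scale_left_distrib sum.distrib)
qed

lemma bilin_add_right: "bilin h f (g + g') = bilin h f g + bilin h f g'"
proof -
  let ?A = "keys g \<union> keys g'"
  have "finite ?A" "keys g \<subseteq> ?A" "keys g' \<subseteq> ?A" "keys (g + g') \<subseteq> ?A"
    by (auto dest: subsetD[OF keys_add])
  then show ?thesis
    by (simp add: bilin_superset[of "keys f" _ ?A] lookup_add distrib_left
        lincomb.scale_left_distrib sum.distrib)
qed

lemma bilin_diff_left: "bilin h (f - f') g = bilin h f g - bilin h f' g"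
  using bilin_add_left[of h "f - f'" f' g] by (simp add: algebra_simps)

lemma bilin_diff_right: "bilin h f (g - g') = bilin h f g - bilin h f g'"
  using bilin_add_right[of h f "g - g'" g'] by (simp add: algebra_simps)

text \<open>Linear combinations may mix webs with different boundaries; the composite of webs
  whose boundaries do not match is zero.\<close>

definition lcomp :: "lincomb \<Rightarrow> lincomb \<Rightarrow> lincomb" where
  "lcomp = bilin (\<lambda>x y. if wbot x = wtop y then lin (wcomp x y) else 0)"

definition ltens :: "lincomb \<Rightarrow> lincomb \<Rightarrow> lincomb" where
  "ltens = bilin (\<lambda>x y. lin (wtens x y))"


section \<open>The local relations\<close>

definition loop_web :: "strand \<Rightarrow> web" where
  "loop_web a = wcomp (wpiece (Cap a)) (wpiece (Cup a))"

definition lollipop_web :: web where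
  "lollipop_web = wcomp (wpiece (Cap T1)) (wpiece (Vertex [T2] [T1, T1]))"

definition bigon_web :: web where
  "bigon_web = wcomp (wpiece (Vertex [T1, T1] [T2])) (wpiece (Vertex [T2] [T1, T1]))"

definition triangle_web :: web where
  "triangle_web =
     wcomp (wtens (wid [T2]) (wtens (wpiece (Cap T1)) (wid [T2])))
       (wcomp (wtens (wpiece (Vertex [T1] [T2, T1])) (wpiece (Vertex [T1] [T1, T2])))
         (wpiece (Vertex [T2] [T1, T1])))"

definition I_web :: web where
  "I_web = wcomp (wpiece (Vertex [T2] [T1, T1])) (wpiece (Vertex [T1, T1] [T2]))"

definition J_web :: web where
  "J_web = wcomp (wtens (wid [T1]) (wpiece (Vertex [T2, T1] [T1])))
                 (wtens (wpiece (Vertex [T1] [T1, T2])) (wid [T1]))"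

definition U_web :: web where
  "U_web = wcomp (wpiece (Cup T1)) (wpiece (Cap T1))"

definition V_web :: web where
  "V_web = wid [T1, T1]"

definition local_relations :: "lincomb set" where
  "local_relations =
    {lin (loop_web T1) - lscale (- (qint 6 * qint 2 / qint 3)) (lin (wid [])),
     lin (loop_web T2) - lscale (qint 6 * qint 5 / (qint 3 * qint 2)) (lin (wid [])),
     lin lollipop_web,
     lin bigon_web - lscale (- (qint 2 ^ 2)) (lin (wid [T2])),
     lin triangle_web,
     lin I_web - lin J_web - (lin U_web - lin V_web)}"

text \<open>Applying a relation inside a disc of a larger web amounts to composing and
  juxtaposing it with other webs, so the combinations that are to vanish form the
  tensor ideal generated by the local relations.\<close>

inductive_set null_comb :: "lincomb set" where
  relation: "f \<in> local_relations \<Longrightarrow> f \<in> null_comb"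
| zero: "0 \<in> null_comb"
| add: "f \<in> null_comb \<Longrightarrow> g \<in> null_comb \<Longrightarrow> f + g \<in> null_comb"
| scale: "f \<in> null_comb \<Longrightarrow> lscale c f \<in> null_comb"
| comp_left: "f \<in> null_comb \<Longrightarrow> lcomp g f \<in> null_comb"
| comp_right: "f \<in> null_comb \<Longrightarrow> lcomp f g \<in> null_comb"
| tens_left: "f \<in> null_comb \<Longrightarrow> ltens g f \<in> null_comb"
| tens_right: "f \<in> null_comb \<Longrightarrow> ltens f g \<in> null_comb"

lemma null_uminus: "f \<in> null_comb \<Longrightarrow> - f \<in> null_comb"
  using null_comb.scale[of f "-1"] by simp

definition equiv_mod :: "lincomb \<Rightarrow> lincomb \<Rightarrow> bool" where
  "equiv_mod f g \<longleftrightarrow> f - g \<in> null_comb"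

lemma equiv_mod_sym: "equiv_mod f g \<Longrightarrow> equiv_mod g f"
  using null_uminus[of "f - g"] by (simp add: equiv_mod_def)

lemma equiv_mod_trans: "equiv_mod f g \<Longrightarrow> equiv_mod g h \<Longrightarrow> equiv_mod f h"
  using null_comb.add[of "f - g" "g - h"] by (simp add: equiv_mod_def)


section \<open>The category of webs\<close>

text \<open>The relations are homogeneous for the boundary words, so the type \<open>spider\<close> is the
  direct sum of the spaces \<open>Hom s t\<close> below over all pairs of words.\<close>

quotient_type spider = lincomb / equiv_mod
proof (intro equivpI reflpI sympI transpI)
  show "equiv_mod f f" for f by (simp add: equiv_mod_def null_comb.zero)
qed (blast intro: equiv_mod_sym equiv_mod_trans)+

instantiation spider :: ab_group_add
begin

lift_definition zero_spider :: spider is 0 .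

lift_definition plus_spider :: "spider \<Rightarrow> spider \<Rightarrow> spider" is "(+)"
  using null_comb.add by (fastforce simp: equiv_mod_def add_diff_add)

lift_definition uminus_spider :: "spider \<Rightarrow> spider" is uminus
  using null_uminus by (fastforce simp: equiv_mod_def)

definition minus_spider :: "spider \<Rightarrow> spider \<Rightarrow> spider" where
  "minus_spider f g = f + - g"

instance
  by standard (simp_all add: minus_spider_def,
      (transfer; simp add: equiv_mod_def null_comb.zero algebra_simps)+)

end

lift_definition sp_scale :: "K \<Rightarrow> spider \<Rightarrow> spider" (infixr \<open>*\<^sub>w\<close> 75) is lscale
  using null_comb.scale by (fastforce simp: equiv_mod_def lincomb.scale_right_diff_distrib[symmetric])

interpretation spider: vector_space sp_scale
  by unfold_locales (transfer; simp add: equiv_mod_def null_comb.zero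
      lincomb.scale_left_distrib lincomb.scale_right_distrib)+

lift_definition sp_comp :: "spider \<Rightarrow> spider \<Rightarrow> spider" (infixr \<open>\<circ>\<^sub>w\<close> 70) is lcomp
proof -
  fix f f' g g'
  assume "equiv_mod f f'" "equiv_mod g g'"
  then have "lcomp (f - f') g + lcomp f' (g - g') \<in> null_comb"
    by (auto simp: equiv_mod_def intro: null_comb.intros)
  then show "equiv_mod (lcomp f g) (lcomp f' g')"
    by (simp add: equiv_mod_def lcomp_def bilin_diff_left bilin_diff_right)
qed

lift_definition sp_tens :: "spider \<Rightarrow> spider \<Rightarrow> spider" (infixr \<open>\<otimes>\<^sub>w\<close> 72) is ltens
proof -
  fix f f' g g'
  assume "equiv_mod f f'" "equiv_mod g g'"
  then have "ltens (f - f') g + ltens f' (g - g') \<in> null_comb"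
    by (auto simp: equiv_mod_def intro: null_comb.intros)
  then show "equiv_mod (ltens f g) (ltens f' g')"
    by (simp add: equiv_mod_def ltens_def bilin_diff_left bilin_diff_right)
qed

lift_definition of_web :: "web \<Rightarrow> spider" is "\<lambda>x. lin x" .

definition Hom :: "word \<Rightarrow> word \<Rightarrow> spider set" where
  "Hom s t = spider.span {of_web x | x. wbot x = s \<and> wtop x = t}"

definition ident :: "word \<Rightarrow> spider" where "ident s = of_web (wid s)"

definition U :: spider where "U = of_web U_web"

definition X :: spider where "X = of_web J_web - of_web V_web"


section \<open>Clasps\<close>

definition weight :: "word \<Rightarrow> int \<times> int" where
  "weight s = (int (count_list s T1), int (count_list s T2))"

text \<open>\<open>weight_less m n\<close> means that \<open>m\<close> is strictly below \<open>n\<close>. The generating steps are the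
  subtractions of a simple root and are taken in the whole weight lattice: a chain between
  dominant weights may have to leave the dominant chamber, e.g. \<open>(2, 0)\<close> is above
  \<open>(0, 1)\<close>, which is above \<open>(2, -1)\<close>, which is above \<open>(0, 0)\<close>.\<close>

inductive weight_less :: "int \<times> int \<Rightarrow> int \<times> int \<Rightarrow> bool" where
  step1: "weight_less (a - 2, b + 1) (a, b)"
| step2: "weight_less (a + 2, b - 2) (a, b)"
| trans: "weight_less l m \<Longrightarrow> weight_less m n \<Longrightarrow> weight_less l n"

definition is_clasp :: "word \<Rightarrow> spider \<Rightarrow> bool" where
  "is_clasp s P \<longleftrightarrow> P \<in> Hom s s \<and> P \<noteq> 0 \<and> P \<circ>\<^sub>w P = P \<and>
     (\<forall>t. weight_less (weight t) (weight s) \<longrightarrow>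
        (\<forall>w\<in>Hom s t. w \<circ>\<^sub>w P = 0) \<and> (\<forall>w\<in>Hom t s. P \<circ>\<^sub>w w = 0))"

definition clasp :: "word \<Rightarrow> spider" where
  "clasp s = (THE P. is_clasp s P)"

definition single_clasp :: "nat \<Rightarrow> spider" where
  "single_clasp n = clasp (replicate n T1)"

end

theory Submission
  imports Defs
begin

text \<open>The stated recursion defines idempotents that annihilate cups, caps and crossings; this is an induction using only the
  relations among cup, cap and crossing. A double strand is a direct summand of two
  single ones up to the nonzero scalar \<open>- [2]\<^sup>2\<close>, so every web factors through single
  strands, and there a web with fewer outputs than inputs lies in the left ideal generated by caps and
  crossings. Hence the recursion elements are annihilated by everything of lower weight. That they do not
  vanish follows from the representation of the webs on tensor powers of the 4- and
  5-dimensional representations: the highest weight vector is killed by every cap and crossing but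
  fixed by the identity, so the identity is not in the ideal.\<close>

section \<open>The category of webs\<close>

text \<open>The crossing \<open>X\<close> does not satisfy the braid relation, so strands cannot be
  pulled past each other with it. The combination \<open>v + v^-1 U + X/[2]\<close>, where v =
  q^(1/2), repairs this: it is invertible, a quarter turn inverts it, and cups, caps and crossings
  slide through a strand drawn with it. It obeys the Kauffman skein relation with parameter v -
  v^-1, and removing a curl costs -v^-5. This is what puts webs with few outputs into the ideal.
  Modulo caps and crossings next to the inputs the braiding is v times the identity, so through
  strands may be taken uncrossed, and the rest is a system of arcs at the outputs. Each arc
  contributes two further outputs, so with fewer outputs than inputs nothing survives, and with
  equally many only multiples of the identity do. The triangle relation enters as a formula for
  alternating products of three crossings on three strands. Both the braid relation and the
  recursion depend on it; the induction step of the latter expands only the inner one of two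
  projectors and leaves four scalar identities in v and v^n. The upside-down half of the argument
  comes from the opposite category.\<close>

lemma dcomp_assoc:
  assumes "dbot d = dtop e" "dbot e = dtop f"
  shows "dcomp (dcomp d e) f = dcomp d (dcomp e f)"
  using assms by transfer auto

lemma dcomp_did: "dbot d = s \<Longrightarrow> dcomp d (did s) = d" "dtop d = s \<Longrightarrow> dcomp (did s) d = d"
  by (transfer; auto)+

lemma pad_Nil: "pad [] [] = id"
  by (auto simp: fun_eq_iff)

lemma pad_pad: "pad a b \<circ> pad a' b' = pad (a @ a') (b' @ b)"
  by (auto simp: fun_eq_iff)

lemma dtens_assoc: "dtens (dtens d e) f = dtens d (dtens e f)"
  by transfer (auto simp: pad_pad)

lemma dtens_did_Nil: "dtens (did []) d = d" "dtens d (did []) = d"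
  by (transfer; auto simp: pad_Nil)+

lemma dtens_did: "dtens (did s) (did t) = did (s @ t)"
  by transfer auto

lemma dtens_did_dcomp:
  assumes "dbot d = dtop e"
  shows "dtens (did s) (dcomp d e) = dcomp (dtens (did s) d) (dtens (did s) e)"
    and "dtens (dcomp d e) (did s) = dcomp (dtens d (did s)) (dtens e (did s))"
  using assms by (transfer; auto)+

lemma dtens_split: "dtens d e = dcomp (dtens d (did (dtop e))) (dtens (did (dbot d)) e)"
  by transfer auto

text \<open>Both sides stack the same pieces, but \<open>e\<close> and \<open>d'\<close>, which lie
  side by side, occur at opposite heights. Hence equality holds only up to isotopy, by a single
  \<open>interchange\<close>.\<close>

lemma dtens_dcomp:
  assumes "dbot d = dtop e" "dbot d' = dtop e'"
  shows "isotopic (dtens (dcomp d e) (dcomp d' e')) (dcomp (dtens d d') (dtens e e'))"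
proof -
  let ?l = "\<lambda>x. dtens x (did (dtop d'))" and ?r = "\<lambda>s x. dtens (did s) x"
  have 1: "dtens (dcomp d e) (dcomp d' e') =
      dcomp (dcomp (?l d) (?l e)) (dcomp (?r (dbot e) d') (?r (dbot e) e'))"
    using assms by (subst dtens_split) (simp add: dtens_did_dcomp)
  also have "\<dots> = dcomp (?l d) (dcomp (dtens e d') (?r (dbot e) e'))"
    using assms by (subst (3) dtens_split) (simp add: dcomp_assoc)
  finally have a: "dtens (dcomp d e) (dcomp d' e') = dcomp (?l d) (dcomp (dtens e d') (?r (dbot e) e'))" .
  have "dcomp (dtens d d') (dtens e e') =
      dcomp (dcomp (?l d) (?r (dbot d) d')) (dcomp (dtens e (did (dtop e'))) (?r (dbot e) e'))"
    using dtens_split[of d d'] dtens_split[of e e'] by simp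
  also have "\<dots> = dcomp (?l d) (dcomp (dcomp (dtens (did (dtop e)) d') (dtens e (did (dbot d')))) (?r (dbot e) e'))"
    using assms by (simp add: dcomp_assoc)
  finally have b: "dcomp (dtens d d') (dtens e e') =
    dcomp (?l d) (dcomp (dcomp (dtens (did (dtop e)) d') (dtens e (did (dbot d')))) (?r (dbot e) e'))" .
  show ?thesis unfolding a b using assms
    by (intro isotopic.comp isotopic.refl isotopic.interchange) auto
qed

lemma wcomp_assoc:
  "wbot x = wtop y \<Longrightarrow> wbot y = wtop z \<Longrightarrow> wcomp (wcomp x y) z = wcomp x (wcomp y z)"
  by transfer (simp add: dcomp_assoc isotopic.refl)

lemma wcomp_wid: "wbot x = s \<Longrightarrow> wcomp x (wid s) = x" "wtop x = s \<Longrightarrow> wcomp (wid s) x = x"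
  by (transfer; simp add: dcomp_did isotopic.refl)+

lemma wtens_assoc: "wtens (wtens x y) z = wtens x (wtens y z)"
  by transfer (simp add: dtens_assoc isotopic.refl)

lemma wtens_wid_Nil: "wtens (wid []) x = x" "wtens x (wid []) = x"
  by (transfer; simp add: dtens_did_Nil isotopic.refl)+

lemma wtens_wid: "wtens (wid s) (wid t) = wid (s @ t)"
  by transfer (simp add: dtens_did isotopic.refl)

lemma wtens_wcomp: "wbot x = wtop y \<Longrightarrow> wbot x' = wtop y' \<Longrightarrow>
   wtens (wcomp x y) (wcomp x' y') = wcomp (wtens x x') (wtens y y')"
  by transfer (rule dtens_dcomp)

section \<open>Bilinear operations on linear combinations and on spiders\<close>

lemma bilin_scale_left: "bilin h (lscale c f) g = lscale c (bilin h f g)"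
proof -
  have "keys (lscale c f) \<subseteq> keys f" by (auto simp: in_keys_iff)
  then show ?thesis
    by (simp add: bilin_superset[of "keys f" _ "keys g"] lincomb.scale_sum_right mult.assoc)
qed

lemma bilin_scale_right: "bilin h f (lscale c g) = lscale c (bilin h f g)"
proof -
  have "keys (lscale c g) \<subseteq> keys g" by (auto simp: in_keys_iff)
  then show ?thesis
    by (simp add: bilin_superset[of "keys f" _ "keys g"] lincomb.scale_sum_right mult.left_commute)
qed

lemma bilin_lin: "bilin h (lin x) (lin y) = h x y"
  by (simp add: bilin_def)

lemma sp_bilinear:
  "(f + f') \<circ>\<^sub>w g = f \<circ>\<^sub>w g + f' \<circ>\<^sub>w g" "f \<circ>\<^sub>w (g + g') = f \<circ>\<^sub>w g + f \<circ>\<^sub>w g'"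
  "(c *\<^sub>w f) \<circ>\<^sub>w g = c *\<^sub>w (f \<circ>\<^sub>w g)" "f \<circ>\<^sub>w (c *\<^sub>w g) = c *\<^sub>w (f \<circ>\<^sub>w g)"
  "(f + f') \<otimes>\<^sub>w g = f \<otimes>\<^sub>w g + f' \<otimes>\<^sub>w g" "f \<otimes>\<^sub>w (g + g') = f \<otimes>\<^sub>w g + f \<otimes>\<^sub>w g'"
  "(c *\<^sub>w f) \<otimes>\<^sub>w g = c *\<^sub>w (f \<otimes>\<^sub>w g)" "f \<otimes>\<^sub>w (c *\<^sub>w g) = c *\<^sub>w (f \<otimes>\<^sub>w g)"
  by (transfer; simp add: lcomp_def ltens_def bilin_add_left bilin_add_right bilin_scale_left
      bilin_scale_right equiv_mod_def null_comb.zero)+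

lemma of_web_comp: "of_web x \<circ>\<^sub>w of_web y = (if wbot x = wtop y then of_web (wcomp x y) else 0)"
proof (cases "wbot x = wtop y")
  case True then show ?thesis
    by (simp, transfer) (simp add: lcomp_def bilin_lin equiv_mod_def null_comb.zero)
next
  case False then show ?thesis
    by (simp, transfer) (simp add: lcomp_def bilin_lin equiv_mod_def null_comb.zero)
qed

lemma of_web_tens: "of_web x \<otimes>\<^sub>w of_web y = of_web (wtens x y)"
  by transfer (simp add: ltens_def bilin_lin equiv_mod_def null_comb.zero)

lemma lincomb_induct:
  assumes "P 0" "\<And>f g. P f \<Longrightarrow> P g \<Longrightarrow> P (f + g)" "\<And>c f. P f \<Longrightarrow> P (lscale c f)" "\<And>x. P (lin x)"
  shows "P f"
proof -
  have "f = (\<Sum>x\<in>keys f. lscale (coeff_of f x) (lin x))"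
    by (rule poly_mapping_eqI)
      (auto simp: lookup_sum lookup_single when_def in_keys_iff if_distrib sum.delta cong: if_cong)
  moreover have "P (\<Sum>x\<in>A. lscale (coeff_of f x) (lin x))" for A
    by (induction A rule: infinite_finite_induct) (use assms in auto)
  ultimately show ?thesis by metis
qed

text \<open>Since composition and juxtaposition are bilinear, applying this rule to one argument
  after another reduces their laws to webs.\<close>

lemma spider_induct [case_names zero add scale web]:
  assumes "P 0" "\<And>f g. P f \<Longrightarrow> P g \<Longrightarrow> P (f + g)" "\<And>c f. P f \<Longrightarrow> P (c *\<^sub>w f)" "\<And>x. P (of_web x)"
  shows "P f"
proof -
  have "P (abs_spider g)" for g
  proof (induction g rule: lincomb_induct)
    case 1 then show ?case using assms(1) by (simp add: zero_spider_def)
  next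
    case (2 f g) then show ?case using assms(2)[OF 2] by (simp add: plus_spider.abs_eq)
  next
    case (3 c f) then show ?case using assms(3)[OF 3] by (simp add: sp_scale.abs_eq)
  next
    case (4 x) then show ?case using assms(4) by (simp add: of_web.abs_eq)
  qed
  then show ?thesis by (metis spider.abs_induct)
qed

lemma sp_zero [simp]: "0 \<circ>\<^sub>w f = 0" "f \<circ>\<^sub>w 0 = 0" "0 \<otimes>\<^sub>w f = 0" "f \<otimes>\<^sub>w 0 = 0"
  using sp_bilinear(3,7)[of 0 0 f] sp_bilinear(4,8)[of f 0 0] by simp_all

lemma sp_comp_assoc: "(f \<circ>\<^sub>w g) \<circ>\<^sub>w h = f \<circ>\<^sub>w (g \<circ>\<^sub>w h)"
proof (induction f rule: spider_induct)
  case (web x) show ?case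
  proof (induction g rule: spider_induct)
    case (web y) show ?case
      by (induction h rule: spider_induct) (auto simp: sp_bilinear of_web_comp wcomp_assoc)
  qed (auto simp: sp_bilinear)
qed (auto simp: sp_bilinear)

lemma sp_tens_assoc: "(f \<otimes>\<^sub>w g) \<otimes>\<^sub>w h = f \<otimes>\<^sub>w (g \<otimes>\<^sub>w h)"
proof (induction f rule: spider_induct)
  case (web x) show ?case
  proof (induction g rule: spider_induct)
    case (web y) show ?case
      by (induction h rule: spider_induct) (auto simp: sp_bilinear of_web_tens wtens_assoc)
  qed (auto simp: sp_bilinear)
qed (auto simp: sp_bilinear)

lemma ident_tens: "ident s \<otimes>\<^sub>w ident t = ident (s @ t)"
  by (simp add: ident_def of_web_tens wtens_wid)

lemma ident_Nil_tens [simp]: "ident [] \<otimes>\<^sub>w f = f" "f \<otimes>\<^sub>w ident [] = f"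
  by (induction f rule: spider_induct; simp add: sp_bilinear ident_def of_web_tens wtens_wid_Nil)+

section \<open>Morphism spaces and the interchange law\<close>

lemma Hom_web: "wbot x = s \<Longrightarrow> wtop x = t \<Longrightarrow> of_web x \<in> Hom s t"
  unfolding Hom_def by (rule spider.span_base) auto

lemma Hom_linear:
  "0 \<in> Hom s t" "f \<in> Hom s t \<Longrightarrow> g \<in> Hom s t \<Longrightarrow> f + g \<in> Hom s t" "f \<in> Hom s t \<Longrightarrow> c *\<^sub>w f \<in> Hom s t"
  unfolding Hom_def by (auto intro: spider.span_zero spider.span_add spider.span_scale)

lemma Hom_induct [consumes 1, case_names zero add scale web]:
  assumes "f \<in> Hom s t" "P 0" "\<And>f g. f \<in> Hom s t \<Longrightarrow> g \<in> Hom s t \<Longrightarrow> P f \<Longrightarrow> P g \<Longrightarrow> P (f + g)"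
    "\<And>c f. f \<in> Hom s t \<Longrightarrow> P f \<Longrightarrow> P (c *\<^sub>w f)" "\<And>x. wbot x = s \<Longrightarrow> wtop x = t \<Longrightarrow> P (of_web x)"
  shows "P f"
proof -
  have "f \<in> Hom s t \<and> P f"
    using assms(1) unfolding Hom_def
  proof (induction rule: spider.span_induct_alt)
    case base then show ?case using assms(2) spider.span_zero by auto
  next
    case (step c x y)
    then obtain w where w: "x = of_web w" "wbot w = s" "wtop w = t" by blast
    then have x: "x \<in> Hom s t" "P x" using assms(5) Hom_web by auto
    then show ?case using step assms(3)[of "c *\<^sub>w x" y] assms(4)[of x c] Hom_linear
      unfolding Hom_def by auto
  qed
  then show ?thesis ..
qed

lemma Hom_ident: "ident s \<in> Hom s s"
  by (simp add: ident_def Hom_web)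

lemma Hom_comp:
  assumes f: "f \<in> Hom t u" and g: "g \<in> Hom s t" shows "f \<circ>\<^sub>w g \<in> Hom s u"
  using f
proof (induction rule: Hom_induct)
  case (web x) show ?case using g
    by (induction rule: Hom_induct) (auto simp: web sp_bilinear of_web_comp intro!: Hom_linear Hom_web)
qed (auto simp: sp_bilinear intro: Hom_linear)

lemma Hom_tens:
  assumes f: "f \<in> Hom s t" and g: "g \<in> Hom s' t'" shows "f \<otimes>\<^sub>w g \<in> Hom (s @ s') (t @ t')"
  using f
proof (induction rule: Hom_induct)
  case (web x) show ?case using g
    by (induction rule: Hom_induct) (auto simp: web sp_bilinear of_web_tens intro!: Hom_linear Hom_web)
qed (auto simp: sp_bilinear intro: Hom_linear)

lemma ident_comp: "f \<in> Hom s t \<Longrightarrow> ident t \<circ>\<^sub>w f = f" "f \<in> Hom s t \<Longrightarrow> f \<circ>\<^sub>w ident s = f"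
  by (induction rule: Hom_induct; simp add: sp_bilinear ident_def of_web_comp wcomp_wid)+

lemma sp_interchange:
  assumes f: "f \<in> Hom t u" and g: "g \<in> Hom s t" and f': "f' \<in> Hom t' u'" and g': "g' \<in> Hom s' t'"
  shows "(f \<otimes>\<^sub>w f') \<circ>\<^sub>w (g \<otimes>\<^sub>w g') = (f \<circ>\<^sub>w g) \<otimes>\<^sub>w (f' \<circ>\<^sub>w g')"
  using f
proof (induction rule: Hom_induct)
  case (web x) then have x: "wbot x = t" "wtop x = u" .
  show ?case using g
  proof (induction rule: Hom_induct)
    case (web y) then have y: "wbot y = s" "wtop y = t" .
    show ?case using f'
    proof (induction rule: Hom_induct)
      case x': (web x') show ?case using g'
        by (induction rule: Hom_induct)
          (auto simp: x y x' sp_bilinear of_web_tens of_web_comp wtens_wcomp)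
    qed (auto simp: sp_bilinear)
  qed (auto simp: sp_bilinear)
qed (auto simp: sp_bilinear)

section \<open>Monoidal categories with a cup, a cap and a crossing\<close>

definition v :: K where "v = q_half"
text \<open>The value of a type 1 loop, which is also 1 - [5].\<close>

definition qd :: K where "qd = - (qint 6 * qint 2 / qint 3)"

lemma v_power: "v ^ n = Fract (monom 1 n) 1"
  by (induction n) (simp_all add: v_def q_half_def monom_Suc One_fract_def pCons_one flip: monom_0)

lemma v_nonzero [simp]: "v \<noteq> 0"
  by (simp add: v_def q_half_def Zero_fract_def eq_fract)

text \<open>An indeterminate has infinite multiplicative order; this is why no quantum integer in a
  denominator vanishes.\<close>

lemma v_power_neq_1: "n > 0 \<Longrightarrow> v ^ n \<noteq> 1"
  by (auto simp: v_power One_fract_def eq_fract monom_eq_1_iff)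

lemma v_diff_nonzero: "n > 0 \<Longrightarrow> v ^ n - inverse v ^ n \<noteq> 0"
proof
  assume n: "n > 0" and "v ^ n - inverse v ^ n = 0"
  then have "v ^ n * v ^ n = inverse v ^ n * v ^ n" by simp
  then have "v ^ (n + n) = 1" by (simp add: power_add flip: power_mult_distrib)
  then show False using v_power_neq_1[of "n + n"] n by simp
qed

lemma qint_nonzero: "n > 0 \<Longrightarrow> qint n \<noteq> 0"
  using v_diff_nonzero[of n] v_diff_nonzero[of 1] by (simp add: qint_def flip: v_def)

lemma qint_0: "qint 0 = 0" and qint_1: "qint (Suc 0) = 1"
  using v_diff_nonzero[of 1] by (simp_all add: qint_def flip: v_def)

lemma qint_v: "qint n = (v ^ n - inverse v ^ n) / (v - inverse v)"
  by (simp add: qint_def v_def)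

lemma v_minus_inv: "v - inverse v \<noteq> 0"
  using v_diff_nonzero[of 1] by simp

lemma qint_2: "qint 2 = v + inverse v"
  using v_minus_inv by (simp add: qint_v power2_eq_square divide_eq_eq) (simp add: algebra_simps)

text \<open>A form of the loop value without division by quantum integers, so that scalar identities
  become consequences of \<open>v * inverse v = 1\<close> alone.\<close>

lemma qd_v: "qd = - ((v ^ 3 + inverse v ^ 3) * (v + inverse v))"
proof -
  have "qint 6 = (v ^ 3 + inverse v ^ 3) * qint 3"
  proof -
    have "v ^ 6 - inverse v ^ 6 = (v ^ 3 + inverse v ^ 3) * (v ^ 3 - inverse v ^ 3)"
      by (simp add: algebra_simps flip: power_add)
    then show ?thesis by (simp add: qint_v)
  qed
  then show ?thesis using qint_nonzero[of 3] by (simp add: qd_def qint_2)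
qed

section \<open>Linear monoidal categories whose objects are the natural numbers\<close>

named_theorems typing

text \<open>A strict linear monoidal category generated by one object, \<open>hom m n\<close> being
  the morphisms from its m-th to its n-th tensor power. All morphisms share one type with total
  operations, so typing premises appear only where the laws depend on them. Working abstractly makes
  every result available in the opposite category too.\<close>

locale monoidal_cat =
  fixes hom :: "nat \<Rightarrow> nat \<Rightarrow> 'a::ab_group_add set"
    and scl :: "K \<Rightarrow> 'a \<Rightarrow> 'a" (infixr "\<star>" 75)
    and comp :: "'a \<Rightarrow> 'a \<Rightarrow> 'a" (infixr "\<odot>" 70)
    and tens :: "'a \<Rightarrow> 'a \<Rightarrow> 'a" (infixr "\<otimes>" 72)
    and idn :: "nat \<Rightarrow> 'a"
  assumes scl_vector_space: "vector_space scl"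
    and hom_zero: "0 \<in> hom m n"
    and hom_add: "f \<in> hom m n \<Longrightarrow> g \<in> hom m n \<Longrightarrow> f + g \<in> hom m n"
    and hom_scl: "f \<in> hom m n \<Longrightarrow> a \<star> f \<in> hom m n"
    and hom_comp: "f \<in> hom n k \<Longrightarrow> g \<in> hom m n \<Longrightarrow> f \<odot> g \<in> hom m k"
    and hom_tens: "f \<in> hom m n \<Longrightarrow> g \<in> hom m' n' \<Longrightarrow> f \<otimes> g \<in> hom (m + m') (n + n')"
    and hom_idn: "idn n \<in> hom n n"
    and comp_assoc: "(f \<odot> g) \<odot> h = f \<odot> (g \<odot> h)"
    and tens_assoc: "(f \<otimes> g) \<otimes> h = f \<otimes> (g \<otimes> h)"
    and comp_add_left: "(f + f') \<odot> g = f \<odot> g + f' \<odot> g"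
    and comp_add_right: "f \<odot> (g + g') = f \<odot> g + f \<odot> g'"
    and comp_scl_left: "(a \<star> f) \<odot> g = a \<star> (f \<odot> g)"
    and comp_scl_right: "f \<odot> (a \<star> g) = a \<star> (f \<odot> g)"
    and tens_add_left: "(f + f') \<otimes> g = f \<otimes> g + f' \<otimes> g"
    and tens_add_right: "f \<otimes> (g + g') = f \<otimes> g + f \<otimes> g'"
    and tens_scl_left: "(a \<star> f) \<otimes> g = a \<star> (f \<otimes> g)"
    and tens_scl_right: "f \<otimes> (a \<star> g) = a \<star> (f \<otimes> g)"
    and idn_comp_left: "f \<in> hom m n \<Longrightarrow> idn n \<odot> f = f"
    and idn_comp_right: "f \<in> hom m n \<Longrightarrow> f \<odot> idn m = f"
    and idn_tens: "idn m \<otimes> idn n = idn (m + n)"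
    and idn_0_left: "idn 0 \<otimes> f = f"
    and idn_0_right: "f \<otimes> idn 0 = f"
    and interchange: "f \<in> hom n k \<Longrightarrow> g \<in> hom m n \<Longrightarrow> f' \<in> hom n' k' \<Longrightarrow> g' \<in> hom m' n' \<Longrightarrow>
      (f \<otimes> f') \<odot> (g \<otimes> g') = (f \<odot> g) \<otimes> (f' \<odot> g')"
begin

sublocale vs: vector_space scl by (rule scl_vector_space)

lemma minus_simps:
  "(- f) \<odot> g = - (f \<odot> g)" "f \<odot> (- g) = - (f \<odot> g)"
  "(- f) \<otimes> g = - (f \<otimes> g)" "f \<otimes> (- g) = - (f \<otimes> g)"
  using comp_scl_left[of "-1" f g] comp_scl_right[of f "-1" g]
    tens_scl_left[of "-1" f g] tens_scl_right[of f "-1" g] by simp_all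

lemma diff_simps:
  "(f - f') \<odot> g = f \<odot> g - f' \<odot> g" "f \<odot> (g - g') = f \<odot> g - f \<odot> g'"
  "(f - f') \<otimes> g = f \<otimes> g - f' \<otimes> g" "f \<otimes> (g - g') = f \<otimes> g - f \<otimes> g'"
  using comp_add_left[of f "- f'" g] comp_add_right[of f g "- g'"]
    tens_add_left[of f "- f'" g] tens_add_right[of f g "- g'"] by (simp_all add: minus_simps)

lemmas bilinear = minus_simps diff_simps comp_add_left comp_add_right comp_scl_left comp_scl_right
  tens_add_left tens_add_right tens_scl_left tens_scl_right
lemmas scl_simps = vs.scale_right_distrib vs.scale_right_diff_distrib vs.scale_scale

lemma zero_simps [simp]: "0 \<odot> f = 0" "f \<odot> 0 = 0" "0 \<otimes> f = 0" "f \<otimes> 0 = 0"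
  using comp_scl_left[of 0 0 f] comp_scl_right[of f 0 0] tens_scl_left[of 0 0 f] tens_scl_right[of f 0 0]
  by simp_all

lemma idn_simps [simp]: "idn m \<otimes> idn n = idn (m + n)" "idn 0 \<otimes> f = f" "f \<otimes> idn 0 = f"
  "idn m \<otimes> (idn n \<otimes> f) = idn (m + n) \<otimes> f"
  by (simp_all add: idn_tens idn_0_left idn_0_right flip: tens_assoc)

text \<open>Arities are tied by equations instead of appearing as sums in the conclusion, so that
  resolution succeeds for any arity and leaves arithmetic to the simplifier.\<close>

lemma tens_hom [typing]:
  "f \<in> hom a b \<Longrightarrow> g \<in> hom a' b' \<Longrightarrow> m = a + a' \<Longrightarrow> n = b + b' \<Longrightarrow> f \<otimes> g \<in> hom m n"
  by (simp add: hom_tens)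

lemma idn_hom [typing]: "m = k \<Longrightarrow> n = k \<Longrightarrow> idn k \<in> hom m n"
  by (simp add: hom_idn)

lemmas [typing] = hom_comp hom_add hom_scl hom_zero

lemma hom_cast: "f \<in> hom a b \<Longrightarrow> m = a \<Longrightarrow> n = b \<Longrightarrow> f \<in> hom m n"
  by simp

text \<open>Composites are kept associated to the right, where a rule for two adjacent factors must
  also fire in front of further factors. This produces that variant of a rule.\<close>

lemma comp_ext: "f \<odot> g = h \<Longrightarrow> f \<odot> (g \<odot> w) = h \<odot> w"
  by (simp flip: comp_assoc)

lemma idn_idn [simp]: "idn k \<odot> idn k = idn k"
  using idn_comp_left hom_idn by blast

lemma tens_LR: "f \<in> hom p q \<Longrightarrow> g \<in> hom r s \<Longrightarrow> (f \<otimes> idn s) \<odot> (idn p \<otimes> g) = f \<otimes> g"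
  by (subst interchange, (assumption | rule hom_idn)+) (simp add: idn_comp_left idn_comp_right)

lemma tens_RL: "f \<in> hom p q \<Longrightarrow> g \<in> hom r s \<Longrightarrow> (idn q \<otimes> g) \<odot> (f \<otimes> idn r) = f \<otimes> g"
  by (subst interchange, (assumption | rule hom_idn)+) (simp add: idn_comp_left idn_comp_right)

lemma comp_tens_idn: "f \<in> hom b c \<Longrightarrow> g \<in> hom a b \<Longrightarrow> (f \<otimes> idn k) \<odot> (g \<otimes> idn k) = (f \<odot> g) \<otimes> idn k"
  by (subst interchange, (assumption | rule hom_idn)+) simp

lemma idn_tens_comp: "f \<in> hom b c \<Longrightarrow> g \<in> hom a b \<Longrightarrow> (idn k \<otimes> f) \<odot> (idn k \<otimes> g) = idn k \<otimes> (f \<odot> g)"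
  by (subst interchange, (assumption | rule hom_idn)+) simp

lemma whisker_comp: "f \<in> hom b c \<Longrightarrow> g \<in> hom a b \<Longrightarrow>
    (idn k \<otimes> f \<otimes> idn l) \<odot> (idn k \<otimes> g \<otimes> idn l) = idn k \<otimes> (f \<odot> g) \<otimes> idn l"
  by (subst idn_tens_comp, (assumption | rule typing HOL.refl)+) (simp add: comp_tens_idn)

end

text \<open>The relations that involve at most two crossings. They are separated from
  \<open>strand_cat\<close> because the calculus derived from them is used to obtain the formulas
  for triple products from the web relations. The eigenvalue \<open>- qd\<close> on cups and caps
  says that the lollipop \<open>cap \<odot> (X + cup \<odot> cap)\<close> vanishes.\<close>

locale strand_cat_pre = monoidal_cat hom scl comp tens idn
  for hom :: "nat \<Rightarrow> nat \<Rightarrow> 'a::ab_group_add set" 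
    and scl :: "K \<Rightarrow> 'a \<Rightarrow> 'a" (infixr "\<star>" 75)
    and comp :: "'a \<Rightarrow> 'a \<Rightarrow> 'a" (infixr "\<odot>" 70)
    and tens :: "'a \<Rightarrow> 'a \<Rightarrow> 'a" (infixr "\<otimes>" 72)
    and idn :: "nat \<Rightarrow> 'a" +
  fixes cup cap X :: 'a
  assumes hom_cup: "cup \<in> hom 0 2" and hom_cap: "cap \<in> hom 2 0" and hom_X: "X \<in> hom 2 2"
    and loop: "cap \<odot> cup = qd \<star> idn 0"
    and snake: "(cap \<otimes> idn (Suc 0)) \<odot> (idn (Suc 0) \<otimes> cup) = idn (Suc 0)"
      "(idn (Suc 0) \<otimes> cap) \<odot> (cup \<otimes> idn (Suc 0)) = idn (Suc 0)"
    and X_rot_cup: "(idn (Suc 0) \<otimes> X) \<odot> (cup \<otimes> idn (Suc 0)) = (X \<otimes> idn (Suc 0)) \<odot> (idn (Suc 0) \<otimes> cup)"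
    and X_rot_cap: "(idn (Suc 0) \<otimes> cap) \<odot> (X \<otimes> idn (Suc 0)) = (cap \<otimes> idn (Suc 0)) \<odot> (idn (Suc 0) \<otimes> X)"
    and X_cup: "X \<odot> cup = (- qd) \<star> cup"
    and cap_X: "cap \<odot> X = (- qd) \<star> cap"
    and X_X: "X \<odot> X = (- (qint 2)\<^sup>2) \<star> X + (qd - (qint 2)\<^sup>2) \<star> (cup \<odot> cap)"
begin

abbreviation U where "U \<equiv> cup \<odot> cap"
abbreviation n1 where "n1 \<equiv> cup \<otimes> idn (Suc 0)"
abbreviation n2 where "n2 \<equiv> idn (Suc 0) \<otimes> cup"
abbreviation u1 where "u1 \<equiv> cap \<otimes> idn (Suc 0)"
abbreviation u2 where "u2 \<equiv> idn (Suc 0) \<otimes> cap"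
abbreviation x1 where "x1 \<equiv> X \<otimes> idn (Suc 0)"
abbreviation x2 where "x2 \<equiv> idn (Suc 0) \<otimes> X"

lemma gen_hom [typing]:
  "m = 0 \<Longrightarrow> n = 2 \<Longrightarrow> cup \<in> hom m n"
  "m = 2 \<Longrightarrow> n = 0 \<Longrightarrow> cap \<in> hom m n"
  "m = 2 \<Longrightarrow> n = 2 \<Longrightarrow> X \<in> hom m n"
  using hom_cup hom_cap hom_X by auto

lemma U_tens: "U \<otimes> idn (Suc 0) = n1 \<odot> u1" "idn (Suc 0) \<otimes> U = n2 \<odot> u2"
  by (rule comp_tens_idn[symmetric] idn_tens_comp[symmetric], (rule typing HOL.refl)+)+

lemma idn1_comp [simp]: "idn (Suc 0) \<odot> u1 = u1" "idn (Suc 0) \<odot> u2 = u2" "n1 \<odot> idn (Suc 0) = n1" "n2 \<odot> idn (Suc 0) = n2"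
  by (rule idn_comp_left idn_comp_right, (rule typing HOL.refl | simp)+)+

lemma strand3:
  "u1 \<odot> n1 = qd \<star> idn (Suc 0)" "u2 \<odot> n2 = qd \<star> idn (Suc 0)"
  "u1 \<odot> n2 = idn (Suc 0)" "u2 \<odot> n1 = idn (Suc 0)"
  "x2 \<odot> n1 = x1 \<odot> n2" "u2 \<odot> x1 = u1 \<odot> x2"
  "u1 \<odot> x1 = (- qd) \<star> u1" "u2 \<odot> x2 = (- qd) \<star> u2" "x1 \<odot> n1 = (- qd) \<star> n1" "x2 \<odot> n2 = (- qd) \<star> n2"
  "x1 \<odot> x1 = (- (qint 2)\<^sup>2) \<star> x1 + (qd - (qint 2)\<^sup>2) \<star> (n1 \<odot> u1)"
  "x2 \<odot> x2 = (- (qint 2)\<^sup>2) \<star> x2 + (qd - (qint 2)\<^sup>2) \<star> (n2 \<odot> u2)"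
proof -
  show "u1 \<odot> n2 = idn (Suc 0)" "u2 \<odot> n1 = idn (Suc 0)"
    "x2 \<odot> n1 = x1 \<odot> n2" "u2 \<odot> x1 = u1 \<odot> x2"
    by (fact snake X_rot_cup X_rot_cap)+
  have *: "u1 \<odot> n1 = (cap \<odot> cup) \<otimes> idn (Suc 0)" "u2 \<odot> n2 = idn (Suc 0) \<otimes> (cap \<odot> cup)"
    "u1 \<odot> x1 = (cap \<odot> X) \<otimes> idn (Suc 0)" "u2 \<odot> x2 = idn (Suc 0) \<otimes> (cap \<odot> X)"
    "x1 \<odot> n1 = (X \<odot> cup) \<otimes> idn (Suc 0)" "x2 \<odot> n2 = idn (Suc 0) \<otimes> (X \<odot> cup)"
    "x1 \<odot> x1 = (X \<odot> X) \<otimes> idn (Suc 0)" "x2 \<odot> x2 = idn (Suc 0) \<otimes> (X \<odot> X)"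
    by (rule comp_tens_idn idn_tens_comp, (rule typing HOL.refl)+)+
  show "u1 \<odot> n1 = qd \<star> idn (Suc 0)" "u2 \<odot> n2 = qd \<star> idn (Suc 0)"
   "u1 \<odot> x1 = (- qd) \<star> u1" "u2 \<odot> x2 = (- qd) \<star> u2" "x1 \<odot> n1 = (- qd) \<star> n1" "x2 \<odot> n2 = (- qd) \<star> n2"
  "x1 \<odot> x1 = (- (qint 2)\<^sup>2) \<star> x1 + (qd - (qint 2)\<^sup>2) \<star> (n1 \<odot> u1)"
  "x2 \<odot> x2 = (- (qint 2)\<^sup>2) \<star> x2 + (qd - (qint 2)\<^sup>2) \<star> (n2 \<odot> u2)"
    unfolding * loop X_cup cap_X X_X by (simp_all add: bilinear U_tens)
qed

text \<open>Rotating the crossing nearest to the cup or cap brings both crossings to the same pair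
  of strands, where they form a square.\<close>

lemma strand3':
  "x2 \<odot> x1 \<odot> n2 = (- (qint 2)\<^sup>2) \<star> (x1 \<odot> n2) + (qd - (qint 2)\<^sup>2) \<star> n2"
  "u1 \<odot> x2 \<odot> x1 = (- (qint 2)\<^sup>2) \<star> (u1 \<odot> x2) + (qd - (qint 2)\<^sup>2) \<star> u1"
proof -
  have "x2 \<odot> x1 \<odot> n2 = (x2 \<odot> x2) \<odot> n1" by (simp add: strand3(5) comp_assoc)
  then show "x2 \<odot> x1 \<odot> n2 = (- (qint 2)\<^sup>2) \<star> (x1 \<odot> n2) + (qd - (qint 2)\<^sup>2) \<star> n2"
    by (simp add: strand3(12) bilinear comp_assoc) (simp add: strand3)
  have "u1 \<odot> x2 \<odot> x1 = u2 \<odot> (x1 \<odot> x1)" by (simp add: strand3(6)[THEN comp_ext] comp_assoc)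
  then show "u1 \<odot> x2 \<odot> x1 = (- (qint 2)\<^sup>2) \<star> (u1 \<odot> x2) + (qd - (qint 2)\<^sup>2) \<star> u1"
    by (simp add: strand3(11) bilinear) (simp add: strand3 strand3(4)[THEN comp_ext])
qed

lemmas strand3_rules = strand3 strand3[THEN comp_ext] strand3' strand3'(1)[THEN comp_ext, unfolded comp_assoc] comp_assoc bilinear

end

text \<open>The two alternating triple products of crossings, left-right mirror images of each
  other. For webs they are the triangle relation with one leg bent down, expanded in cups, caps and
  crossings.\<close>

locale strand_cat = strand_cat_pre +
  assumes X_triple: "(X \<otimes> idn (Suc 0)) \<odot> (idn (Suc 0) \<otimes> X) \<odot> (X \<otimes> idn (Suc 0)) =
       (qint 2)\<^sup>2 \<star> (X \<otimes> idn (Suc 0))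
       + (qint 2)\<^sup>2 \<star> ((idn (Suc 0) \<otimes> X) \<odot> ((cup \<odot> cap) \<otimes> idn (Suc 0)))
       + (qint 2)\<^sup>2 \<star> (((cup \<odot> cap) \<otimes> idn (Suc 0)) \<odot> (idn (Suc 0) \<otimes> X))
       + (3 * (qint 2)\<^sup>2 - qd) \<star> ((cup \<odot> cap) \<otimes> idn (Suc 0))"
    and X_triple': "(idn (Suc 0) \<otimes> X) \<odot> (X \<otimes> idn (Suc 0)) \<odot> (idn (Suc 0) \<otimes> X) =
       (qint 2)\<^sup>2 \<star> (idn (Suc 0) \<otimes> X)
       + (qint 2)\<^sup>2 \<star> ((X \<otimes> idn (Suc 0)) \<odot> (idn (Suc 0) \<otimes> (cup \<odot> cap)))
       + (qint 2)\<^sup>2 \<star> ((idn (Suc 0) \<otimes> (cup \<odot> cap)) \<odot> (X \<otimes> idn (Suc 0)))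
       + (3 * (qint 2)\<^sup>2 - qd) \<star> (idn (Suc 0) \<otimes> (cup \<odot> cap))"
begin

text \<open>The braiding. Its inverse \<open>s'\<close> arises by exchanging \<open>v\<close> and
  its inverse, so the difference of the two is the Kauffman skein relation
  \<open>s_skein\<close>.\<close>

definition s :: 'a where "s = v \<star> idn 2 + inverse v \<star> U + inverse (qint 2) \<star> X"
definition s' :: 'a where "s' = inverse v \<star> idn 2 + v \<star> U + inverse (qint 2) \<star> X"

lemma s_hom [typing]: "m = 2 \<Longrightarrow> n = 2 \<Longrightarrow> s \<in> hom m n" "m = 2 \<Longrightarrow> n = 2 \<Longrightarrow> s' \<in> hom m n"
  unfolding s_def s'_def by ((rule typing HOL.refl | assumption | simp)+)


lemma t_simps: "inverse (qint 2) * qint 2 = 1" "qint 2 \<noteq> 0" 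
  using qint_nonzero[of 2] by simp_all

lemma t_v: "inverse (qint 2) * (v + inverse v) = 1" and v_inv: "v * inverse v = 1"
  using t_simps by (simp_all add: qint_2)

text \<open>The framing factor: the scalar by which \<open>s\<close> removes a curl from a cup or a
  cap.\<close>

definition lam :: K where "lam = - (inverse v ^ 5)"

lemma inverse_lam: "inverse lam = - (v ^ 5)"
  by (simp add: lam_def power_inverse)

lemma cap_idn: "cap \<odot> idn 2 = cap" "idn 2 \<odot> cup = cup" "cup \<odot> idn 0 = cup" "idn 0 \<odot> cap = cap"
  "X \<odot> idn 2 = X" "idn 2 \<odot> X = X"
  by (rule idn_comp_left idn_comp_right, (rule typing HOL.refl)+)+

lemma cap_U: "cap \<odot> U = qd \<star> cap" "U \<odot> cup = qd \<star> cup" "U \<odot> idn 2 = U" "idn 2 \<odot> U = U"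
  "U \<odot> U = qd \<star> U" "X \<odot> U = (-qd) \<star> U" "U \<odot> X = (-qd) \<star> U"
  by (simp_all add: loop loop[THEN comp_ext] cap_X X_cup[THEN comp_ext] comp_assoc cap_idn cap_idn[THEN comp_ext] bilinear
     )

lemma s_cup: "s \<odot> cup = lam \<star> cup" "cap \<odot> s = lam \<star> cap" "cap \<odot> s' = inverse lam \<star> cap"
proof -
  have 1: "v + inverse v * qd - inverse (qint 2) * qd = lam"
    unfolding qd_v lam_def using t_v v_inv by algebra
  have 2: "inverse v + v * qd - inverse (qint 2) * qd = inverse lam"
    unfolding qd_v inverse_lam using t_v v_inv by algebra
  show "s \<odot> cup = lam \<star> cup" "cap \<odot> s = lam \<star> cap"
    unfolding 1[symmetric] by (simp_all add: s_def bilinear cap_U cap_idn X_cup cap_X vs.scale_left_distrib vs.scale_left_diff_distrib scl_simps)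
  show "cap \<odot> s' = inverse lam \<star> cap"
    unfolding 2[symmetric] by (simp_all add: s'_def bilinear cap_U cap_idn X_cup cap_X vs.scale_left_distrib vs.scale_left_diff_distrib scl_simps)
qed

lemma s_s': "s \<odot> s' = idn 2" "s' \<odot> s = idn 2"
proof -
  let ?i = "inverse (qint 2)"
  have 1: "v * ?i + ?i * inverse v - ?i * ?i * (qint 2)\<^sup>2 = 0"
    using t_v v_inv qint_2 by algebra
  have 2: "v * v + inverse v * inverse v + qd - v * ?i * qd - inverse v * ?i * qd + ?i * ?i * (qd - (qint 2)\<^sup>2) = 0"
    using t_v v_inv qd_v qint_2 by algebra
  \<comment> \<open>The identity already has coefficient \<open>v * inverse v = 1\<close> in both
    products; these are the coefficients of \<open>X\<close> and of \<open>U\<close>, which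
    vanish.\<close>
  let ?c = "v * ?i + ?i * inverse v - ?i * ?i * (qint 2)\<^sup>2"
  let ?d = "v * v + inverse v * inverse v + qd - v * ?i * qd - inverse v * ?i * qd + ?i * ?i * (qd - (qint 2)\<^sup>2)"
  have "s \<odot> s' = idn 2 + ?c \<star> X + ?d \<star> U" "s' \<odot> s = idn 2 + ?c \<star> X + ?d \<star> U"
    by (simp_all add: s_def s'_def bilinear cap_U cap_idn X_X scl_simps vs.scale_left_distrib vs.scale_left_diff_distrib)
      (simp_all add: algebra_simps)
  then show "s \<odot> s' = idn 2" "s' \<odot> s = idn 2" unfolding 1 2 by simp_all
qed

lemma s_skein: "s = s' + (v - inverse v) \<star> (idn 2 - U)" "s' = s - (v - inverse v) \<star> (idn 2 - U)"
  by (simp_all add: s_def s'_def algebra_simps vs.scale_left_diff_distrib vs.scale_right_diff_distrib)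

abbreviation s1 where "s1 \<equiv> s \<otimes> idn (Suc 0)"
abbreviation s2 where "s2 \<equiv> idn (Suc 0) \<otimes> s"

lemma idn_3': "idn 3 \<odot> n1 = n1" "idn 3 \<odot> n2 = n2" "u1 \<odot> idn 3 = u1" "u2 \<odot> idn 3 = u2"
  "idn 3 \<odot> x1 = x1" "idn 3 \<odot> x2 = x2" "x1 \<odot> idn 3 = x1" "x2 \<odot> idn 3 = x2" 
  by (rule idn_comp_left idn_comp_right, (rule typing HOL.refl | simp)+)+

lemmas idn_3 = idn_3' idn_3'[unfolded numeral_3_eq_3] idn_3'[THEN comp_ext] idn_3'[unfolded numeral_3_eq_3, THEN comp_ext]

text \<open>A quarter turn fixes \<open>X\<close> and exchanges the identity with \<open>U\<close>,
  so it exchanges \<open>s\<close> and \<open>s'\<close>.\<close>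

lemma s_rot:
  "s2 \<odot> n1 = (s' \<otimes> idn (Suc 0)) \<odot> n2" "(idn (Suc 0) \<otimes> s') \<odot> n1 = s1 \<odot> n2"
  "u1 \<odot> s2 = u2 \<odot> (s' \<otimes> idn (Suc 0))" "u2 \<odot> s1 = u1 \<odot> (idn (Suc 0) \<otimes> s')"
  by (simp_all add: s_def s'_def bilinear U_tens strand3_rules idn_3 algebra_simps)

lemma X_triples:
  "x1 \<odot> x2 \<odot> x1 = (qint 2)\<^sup>2 \<star> x1 + (qint 2)\<^sup>2 \<star> (x1 \<odot> n2 \<odot> u1) + (qint 2)\<^sup>2 \<star> (n1 \<odot> u1 \<odot> x2)
    + (3 * (qint 2)\<^sup>2 - qd) \<star> (n1 \<odot> u1)"
  "x2 \<odot> x1 \<odot> x2 = (qint 2)\<^sup>2 \<star> x2 + (qint 2)\<^sup>2 \<star> (x1 \<odot> n2 \<odot> u2) + (qint 2)\<^sup>2 \<star> (n2 \<odot> u1 \<odot> x2)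
    + (3 * (qint 2)\<^sup>2 - qd) \<star> (n2 \<odot> u2)"
  unfolding X_triple X_triple' U_tens by (simp_all add: comp_assoc strand3(5)[THEN comp_ext] strand3(6))

text \<open>In reduced form the difference of the two sides is a combination of four differences of
  three-strand diagrams, and each of the four coefficients vanishes separately.\<close>

lemma braid_X: "x2 \<odot> s1 \<odot> s2 = s1 \<odot> s2 \<odot> x1"
proof -
  let ?i = "inverse (qint 2)" and ?w = "inverse v"
  let ?a = "v * v - v * ?i * (qint 2)\<^sup>2 + ?i * ?i * (qint 2)\<^sup>2"
  let ?c = "?w * ?w - ?w * ?i * (qint 2)\<^sup>2 + ?i * ?i * (qint 2)\<^sup>2"
  let ?b = "- qd + ?w * ?i * (qd - (qint 2)\<^sup>2) + ?i * v * (qd - (qint 2)\<^sup>2) + ?i * ?i * (3 * (qint 2)\<^sup>2 - qd)"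
  let ?e = "?i * ?i * (qint 2)\<^sup>2 - 1"
  have "x2 \<odot> s1 \<odot> s2 - s1 \<odot> s2 \<odot> x1 = ?a \<star> (x2 - x1) + ?b \<star> (n2 \<odot> u2 - n1 \<odot> u1)
     + ?c \<star> (x1 \<odot> n2 \<odot> u2 - n1 \<odot> u1 \<odot> x2) + ?e \<star> (n2 \<odot> u1 \<odot> x2 - x1 \<odot> n2 \<odot> u1)"
    by (simp add: s_def bilinear U_tens idn_3 strand3_rules X_triples scl_simps vs.scale_left_distrib vs.scale_left_diff_distrib
      idn1_comp[THEN comp_ext])
      (simp add: algebra_simps)
  moreover have "?a = 0" "?b = 0" "?c = 0" "?e = 0" using t_v v_inv qint_2 qd_v by algebra+
  ultimately show ?thesis by (metis (no_types, lifting) add_0 eq_iff_diff_eq_0 vs.scale_zero_left)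
qed

end

section \<open>Strands and arcs drawn with the braiding\<close>

context monoidal_cat begin

lemma idn_tens_slide:
  "f \<in> hom p q \<Longrightarrow> g \<in> hom b c \<Longrightarrow> h \<in> hom a b \<Longrightarrow> (idn q \<otimes> g) \<odot> (f \<otimes> h) = f \<otimes> (g \<odot> h)"
  "f \<in> hom p q \<Longrightarrow> g \<in> hom b c \<Longrightarrow> h \<in> hom a b \<Longrightarrow> (f \<otimes> g) \<odot> (idn p \<otimes> h) = f \<otimes> (g \<odot> h)"
  "f \<in> hom p q \<Longrightarrow> g \<in> hom b c \<Longrightarrow> h \<in> hom a b \<Longrightarrow> (g \<otimes> idn q) \<odot> (h \<otimes> f) = (g \<odot> h) \<otimes> f"
  "f \<in> hom p q \<Longrightarrow> g \<in> hom b c \<Longrightarrow> h \<in> hom a b \<Longrightarrow> (g \<otimes> f) \<odot> (h \<otimes> idn p) = (g \<odot> h) \<otimes> f"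
  by (subst interchange, (assumption | rule hom_idn)+, simp add: idn_comp_left idn_comp_right)+

lemma idn_comp:
  "f \<in> hom m n \<Longrightarrow> n = k \<Longrightarrow> idn k \<odot> f = f" "f \<in> hom m n \<Longrightarrow> m = k \<Longrightarrow> f \<odot> idn k = f"
  by (auto simp: idn_comp_left idn_comp_right)

end

context strand_cat begin

text \<open>The last of k + 1 strands is carried to the front, crossing the others by
  \<open>s\<close>.\<close>

primrec cr :: "nat \<Rightarrow> 'a" where
  "cr 0 = idn (Suc 0)"
| "cr (Suc k) = (s \<otimes> idn k) \<odot> (idn (Suc 0) \<otimes> cr k)"

lemma cr_hom [typing]: "m = Suc k \<Longrightarrow> n = Suc k \<Longrightarrow> cr k \<in> hom m n"
proof -
  have "cr k \<in> hom (Suc k) (Suc k)"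
  proof (induction k)
    case (Suc k)
    note [typing] = hom_cast[OF Suc]
    show ?case by (simp, (rule typing HOL.refl | simp)+)
  qed (simp add: hom_idn)
  then show "m = Suc k \<Longrightarrow> n = Suc k \<Longrightarrow> cr k \<in> hom m n" by simp
qed

lemma cr_1: "cr (Suc 0) = s"
  using idn_comp_right[of s 2 2] s_hom(1) by (simp add: numeral_2_eq_2)

lemma cr_add: "cr (a + b) = (cr a \<otimes> idn b) \<odot> (idn a \<otimes> cr b)"
proof (induction a)
  case 0
  show ?case by (simp, rule idn_comp_left[symmetric], (rule typing HOL.refl | simp)+)
next
  case (Suc a)
  have "cr (Suc a + b) = (s \<otimes> idn (a + b)) \<odot> (idn (Suc 0) \<otimes> ((cr a \<otimes> idn b) \<odot> (idn a \<otimes> cr b)))"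
    by (simp add: Suc)
  also have "idn (Suc 0) \<otimes> ((cr a \<otimes> idn b) \<odot> (idn a \<otimes> cr b)) =
      ((idn (Suc 0) \<otimes> cr a) \<otimes> idn b) \<odot> (idn (Suc a) \<otimes> cr b)"
    by (subst idn_tens_comp[symmetric], (rule typing HOL.refl | simp)+) (simp add: tens_assoc)
  also have "(s \<otimes> idn (a + b)) \<odot> \<dots> =
     (((s \<otimes> idn a) \<otimes> idn b) \<odot> ((idn (Suc 0) \<otimes> cr a) \<otimes> idn b)) \<odot> (idn (Suc a) \<otimes> cr b)"
    by (simp add: comp_assoc tens_assoc)
  also have "((s \<otimes> idn a) \<otimes> idn b) \<odot> ((idn (Suc 0) \<otimes> cr a) \<otimes> idn b) = cr (Suc a) \<otimes> idn b"
    by (subst comp_tens_idn, (rule typing HOL.refl | simp)+)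
  finally show ?case .
qed

lemma hom3: "s1 \<in> hom 3 3" "idn (Suc 0) \<otimes> s' \<in> hom 3 3" "s' \<otimes> idn (Suc 0) \<in> hom 3 3" "s2 \<in> hom 3 3"
  "n1 \<in> hom (Suc 0) 3" "n2 \<in> hom (Suc 0) 3" "u1 \<in> hom 3 (Suc 0)" "u2 \<in> hom 3 (Suc 0)"
  "x1 \<in> hom 3 3" "x2 \<in> hom 3 3" "U \<otimes> idn (Suc 0) \<in> hom 3 3" "idn (Suc 0) \<otimes> U \<in> hom 3 3"
  by (rule typing HOL.refl | simp)+

text \<open>The morphism slides through a strand that is carried from its right to its left:
  naturality of the half braiding \<open>cr\<close>.\<close>

definition natural :: "nat \<Rightarrow> nat \<Rightarrow> 'a \<Rightarrow> bool" where
  "natural p q f \<longleftrightarrow> f \<in> hom p q \<and> cr q \<odot> (f \<otimes> idn (Suc 0)) = (idn (Suc 0) \<otimes> f) \<odot> cr p"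

lemma natural_tens:
  assumes "natural p q f" "natural r t g"
  shows "natural (p + r) (q + t) (f \<otimes> g)"
proof -
  have f: "f \<in> hom p q" "cr q \<odot> (f \<otimes> idn (Suc 0)) = (idn (Suc 0) \<otimes> f) \<odot> cr p"
    and g: "g \<in> hom r t" "cr t \<odot> (g \<otimes> idn (Suc 0)) = (idn (Suc 0) \<otimes> g) \<odot> cr r"
    using assms by (auto simp: natural_def)
  note [typing] = hom_cast[OF f(1)] hom_cast[OF g(1)]
  have "cr (q + t) \<odot> ((f \<otimes> g) \<otimes> idn (Suc 0)) = (cr q \<otimes> idn t) \<odot> (idn q \<otimes> cr t) \<odot> (f \<otimes> (g \<otimes> idn (Suc 0)))"
    by (simp add: cr_add comp_assoc tens_assoc)
  also have "(idn q \<otimes> cr t) \<odot> (f \<otimes> (g \<otimes> idn (Suc 0))) = f \<otimes> ((idn (Suc 0) \<otimes> g) \<odot> cr r)"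
    by (subst idn_tens_slide(1), (rule typing HOL.refl | simp)+) (simp add: g)
  also have "\<dots> = ((f \<otimes> idn (Suc 0)) \<otimes> g) \<odot> (idn p \<otimes> cr r)"
    by (subst idn_tens_slide(2)[symmetric], (rule typing HOL.refl | simp)+) (simp add: tens_assoc)
  also have "(cr q \<otimes> idn t) \<odot> ((f \<otimes> idn (Suc 0)) \<otimes> g) \<odot> (idn p \<otimes> cr r) =
     ((cr q \<otimes> idn t) \<odot> ((f \<otimes> idn (Suc 0)) \<otimes> g)) \<odot> (idn p \<otimes> cr r)" by (simp add: comp_assoc)
  also have "(cr q \<otimes> idn t) \<odot> ((f \<otimes> idn (Suc 0)) \<otimes> g) = ((idn (Suc 0) \<otimes> f) \<odot> cr p) \<otimes> g"
    by (subst idn_tens_slide(3), (rule typing HOL.refl | simp)+) (simp add: f)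
  also have "\<dots> = ((idn (Suc 0) \<otimes> f) \<otimes> g) \<odot> (cr p \<otimes> idn r)"
    by (subst idn_tens_slide(4)[symmetric], (rule typing HOL.refl | simp)+)
  finally have "cr (q + t) \<odot> ((f \<otimes> g) \<otimes> idn (Suc 0)) = (idn (Suc 0) \<otimes> (f \<otimes> g)) \<odot> cr (p + r)"
    by (simp add: cr_add comp_assoc tens_assoc)
  then show ?thesis using f g by (simp add: natural_def hom_tens)
qed

lemma natural_comp:
  assumes "natural q r f" "natural p q g"
  shows "natural p r (f \<odot> g)"
proof -
  have f: "f \<in> hom q r" "cr r \<odot> (f \<otimes> idn (Suc 0)) = (idn (Suc 0) \<otimes> f) \<odot> cr q"
    and g: "g \<in> hom p q" "cr q \<odot> (g \<otimes> idn (Suc 0)) = (idn (Suc 0) \<otimes> g) \<odot> cr p"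
    using assms by (auto simp: natural_def)
  have "cr r \<odot> ((f \<odot> g) \<otimes> idn (Suc 0)) = cr r \<odot> (f \<otimes> idn (Suc 0)) \<odot> (g \<otimes> idn (Suc 0))"
    using f g by (simp add: comp_tens_idn)
  also have "\<dots> = (idn (Suc 0) \<otimes> f) \<odot> (idn (Suc 0) \<otimes> g) \<odot> cr p"
    using f(2)[THEN comp_ext] g(2) by (simp add: comp_assoc)
  also have "\<dots> = (idn (Suc 0) \<otimes> (f \<odot> g)) \<odot> cr p"
    using f g by (simp add: idn_tens_comp flip: comp_assoc)
  finally show ?thesis using f g hom_comp by (auto simp: natural_def)
qed

lemma natural_add: "natural p q f \<Longrightarrow> natural p q g \<Longrightarrow> natural p q (f + g)"
  by (simp add: natural_def bilinear hom_add)

lemma natural_scl: "natural p q f \<Longrightarrow> natural p q (a \<star> f)"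
  by (simp add: natural_def bilinear hom_scl)

lemma natural_idn: "natural p p (idn p)"
  unfolding natural_def
  by (simp add: hom_idn idn_comp[where m = "Suc p" and n = "Suc p"] cr_hom)

lemma cr_2: "cr 2 = s1 \<odot> s2"
  by (simp only: numeral_2_eq_2 cr.simps(2)[of "Suc 0"] cr_1)

lemma s_s'_tens: "s1 \<odot> (s' \<otimes> idn (Suc 0)) = idn (Suc (Suc (Suc 0)))" "(idn (Suc 0) \<otimes> s') \<odot> s2 = idn (Suc (Suc (Suc 0)))"
  by (subst comp_tens_idn idn_tens_comp, (rule typing HOL.refl)+, simp add: s_s' numeral_2_eq_2)+

text \<open>A strand is pulled off a cup: \<open>s_rot\<close> turns one of the two crossings into
  the inverse of the other, and they cancel.\<close>

lemma natural_cup: "natural 0 2 cup"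
proof -
  have "cr 2 \<odot> n1 = n2"
    by (simp add: cr_2 comp_assoc s_rot s_s'_tens[THEN comp_ext] idn_3)
  then show ?thesis by (simp add: natural_def hom_cup)
qed

lemma natural_cap: "natural 2 0 cap"
proof -
  have "u2 \<odot> cr 2 = u1"
    by (simp add: cr_2 s_rot(4)[THEN comp_ext] comp_assoc s_s'_tens idn_3)
  then show ?thesis by (simp add: natural_def hom_cap idn_comp)
qed

lemma natural_X: "natural 2 2 X"
  by (simp add: natural_def hom_X cr_2 comp_assoc braid_X)

text \<open>The braid relation for \<open>s\<close>, obtained by linearity from sliding
  \<open>X\<close>, the cup and the cap.\<close>

lemma natural_s: "natural 2 2 s"
  unfolding s_def using natural_idn[of 2] natural_X natural_comp[OF natural_cup natural_cap]
  by (intro natural_add natural_scl)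

lemma natural_at:
  assumes "natural p q f"
  shows "natural (a + p + b) (a + q + b) (idn a \<otimes> f \<otimes> idn b)"
  using natural_tens[OF natural_idn[of a] natural_tens[OF assms natural_idn[of b]]] by (simp add: add.assoc)

text \<open>A cup is placed to the right of the outputs of \<open>y\<close>, and its left leg is
  drawn leftwards across the last \<open>k\<close> of them. Counting outputs from 0, the feet of the
  arc are number \<open>j\<close> and the last one.\<close>

definition arc :: "nat \<Rightarrow> nat \<Rightarrow> 'a \<Rightarrow> 'a" where
  "arc j k y = (idn j \<otimes> cr k \<otimes> idn (Suc 0)) \<odot> (y \<otimes> cup)"

lemma arc_hom: "y \<in> hom n (j + k) \<Longrightarrow> arc j k y \<in> hom n (j + k + 2)"
proof -
  assume y: "y \<in> hom n (j + k)"
  note [typing] = hom_cast[OF y]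
  show ?thesis unfolding arc_def by (rule typing HOL.refl | simp)+
qed

lemma arc_left:
  assumes "G \<in> hom j j'" "y \<in> hom n (j + k)"
  shows "(G \<otimes> idn (Suc (Suc k))) \<odot> arc j k y = arc j' k ((G \<otimes> idn k) \<odot> y)"
proof -
  note [typing] = hom_cast[OF assms(1)] hom_cast[OF assms(2)]
  have "(G \<otimes> idn (Suc (Suc k))) \<odot> arc j k y =
     ((G \<otimes> idn (Suc (Suc k))) \<odot> (idn j \<otimes> (cr k \<otimes> idn (Suc 0)))) \<odot> (y \<otimes> cup)"
    by (simp add: arc_def comp_assoc)
  also have "(G \<otimes> idn (Suc (Suc k))) \<odot> (idn j \<otimes> (cr k \<otimes> idn (Suc 0))) = G \<otimes> (cr k \<otimes> idn (Suc 0))"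
    by (rule tens_LR, (rule typing HOL.refl | simp)+)
  also have "\<dots> = (idn j' \<otimes> (cr k \<otimes> idn (Suc 0))) \<odot> (G \<otimes> idn (k + 2))"
    by (rule tens_RL[symmetric], (rule typing HOL.refl | simp)+)
  also have "\<dots> \<odot> (y \<otimes> cup) = (idn j' \<otimes> (cr k \<otimes> idn (Suc 0))) \<odot> (((G \<otimes> idn k) \<otimes> idn 2) \<odot> (y \<otimes> cup))"
    by (simp add: comp_assoc tens_assoc)
  also have "((G \<otimes> idn k) \<otimes> idn 2) \<odot> (y \<otimes> cup) = ((G \<otimes> idn k) \<odot> y) \<otimes> cup"
    by (rule idn_tens_slide(3), (rule typing HOL.refl | simp)+)
  finally show ?thesis by (simp add: arc_def)
qed

text \<open>A morphism acting between the two feet has to pass through the displaced left leg, and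
  naturality permits exactly this.\<close>

lemma arc_inside:
  assumes "natural k k' G" "y \<in> hom n (j + k)"
  shows "(idn (Suc j) \<otimes> G \<otimes> idn (Suc 0)) \<odot> arc j k y = arc j k' ((idn j \<otimes> G) \<odot> y)"
proof -
  have G: "G \<in> hom k k'" "cr k' \<odot> (G \<otimes> idn (Suc 0)) = (idn (Suc 0) \<otimes> G) \<odot> cr k"
    using assms(1) by (auto simp: natural_def)
  note [typing] = hom_cast[OF G(1)] hom_cast[OF assms(2)]
  have "(idn (Suc j) \<otimes> G \<otimes> idn (Suc 0)) \<odot> arc j k y =
    ((idn j \<otimes> (idn (Suc 0) \<otimes> G) \<otimes> idn (Suc 0)) \<odot> (idn j \<otimes> cr k \<otimes> idn (Suc 0))) \<odot> (y \<otimes> cup)"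
    by (simp add: arc_def comp_assoc tens_assoc)
  also have "(idn j \<otimes> (idn (Suc 0) \<otimes> G) \<otimes> idn (Suc 0)) \<odot> (idn j \<otimes> cr k \<otimes> idn (Suc 0)) =
    idn j \<otimes> (cr k' \<odot> (G \<otimes> idn (Suc 0))) \<otimes> idn (Suc 0)"
    unfolding G(2) by (rule whisker_comp, (rule typing HOL.refl | simp)+)
  also have "\<dots> = (idn j \<otimes> cr k' \<otimes> idn (Suc 0)) \<odot> ((idn j \<otimes> G) \<otimes> idn 2)"
    by (subst whisker_comp[symmetric], (rule typing HOL.refl | simp)+) (simp add: tens_assoc numeral_2_eq_2)
  also have "\<dots> \<odot> (y \<otimes> cup) = (idn j \<otimes> cr k' \<otimes> idn (Suc 0)) \<odot> (((idn j \<otimes> G) \<otimes> idn 2) \<odot> (y \<otimes> cup))"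
    by (simp add: comp_assoc)
  also have "((idn j \<otimes> G) \<otimes> idn 2) \<odot> (y \<otimes> cup) = ((idn j \<otimes> G) \<odot> y) \<otimes> cup"
    by (rule idn_tens_slide(3), (rule typing HOL.refl | simp)+)
  finally show ?thesis by (simp add: arc_def)
qed

text \<open>One more crossing carries the left foot one place further to the left.\<close>

lemma arc_s: "(idn j \<otimes> s \<otimes> idn (Suc k)) \<odot> arc (Suc j) k y = arc j (Suc k) y"
proof -
  have "(idn j \<otimes> s \<otimes> idn (Suc k)) \<odot> arc (Suc j) k y =
    ((idn j \<otimes> (s \<otimes> idn k) \<otimes> idn (Suc 0)) \<odot> (idn j \<otimes> (idn (Suc 0) \<otimes> cr k) \<otimes> idn (Suc 0))) \<odot> (y \<otimes> cup)"
    by (simp add: arc_def comp_assoc tens_assoc)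
  also have "(idn j \<otimes> (s \<otimes> idn k) \<otimes> idn (Suc 0)) \<odot> (idn j \<otimes> (idn (Suc 0) \<otimes> cr k) \<otimes> idn (Suc 0)) =
     idn j \<otimes> cr (Suc k) \<otimes> idn (Suc 0)"
    by (subst whisker_comp, (rule typing HOL.refl | simp)+)
  finally show ?thesis by (simp add: arc_def)
qed

lemma at_s'_s: "(idn j \<otimes> s' \<otimes> idn k) \<odot> (idn j \<otimes> s \<otimes> idn k) = idn (Suc (Suc (j + k)))"
  by (subst whisker_comp, (rule typing HOL.refl)+) (simp add: s_s')

lemma arc_s':
  assumes "y \<in> hom n (Suc (j + k))"
  shows "(idn j \<otimes> s' \<otimes> idn (Suc k)) \<odot> arc j (Suc k) y = arc (Suc j) k y"
proof -
  have "(idn j \<otimes> s' \<otimes> idn (Suc k)) \<odot> arc j (Suc k) y =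
    ((idn j \<otimes> s' \<otimes> idn (Suc k)) \<odot> (idn j \<otimes> s \<otimes> idn (Suc k))) \<odot> arc (Suc j) k y"
    by (simp add: arc_s comp_assoc)
  also have "\<dots> = arc (Suc j) k y"
    unfolding at_s'_s using arc_hom[of y n "Suc j" k] assms by (intro idn_comp_left) auto
  finally show ?thesis .
qed

text \<open>The first strand is carried to the end by \<open>s'\<close>, in the order that undoes
  \<open>cr\<close>.\<close>

primrec cr' :: "nat \<Rightarrow> 'a" where
  "cr' 0 = idn (Suc 0)"
| "cr' (Suc k) = (idn (Suc 0) \<otimes> cr' k) \<odot> (s' \<otimes> idn k)"

lemma cr'_hom [typing]: "m = Suc k \<Longrightarrow> n = Suc k \<Longrightarrow> cr' k \<in> hom m n"
proof -
  have "cr' k \<in> hom (Suc k) (Suc k)"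
  proof (induction k)
    case (Suc k)
    note [typing] = hom_cast[OF Suc]
    show ?case by (simp, (rule typing HOL.refl | simp)+)
  qed (simp add: hom_idn)
  then show "m = Suc k \<Longrightarrow> n = Suc k \<Longrightarrow> cr' k \<in> hom m n" by simp
qed

text \<open>Joining the left foot of an arc to the strand on its left straightens the two into one
  strand that runs to the far right. The turn inverts each crossing met on the way.\<close>

lemma cap_cr_cup:
  "(cap \<otimes> idn (Suc k)) \<odot> (idn (Suc 0) \<otimes> cr k \<otimes> idn (Suc 0)) \<odot> (idn (Suc k) \<otimes> cup) = cr' k"
proof (induction k)
  case 0
  show ?case
    using strand3(3) by (simp add: idn_comp[where m = "Suc 0" and n = "Suc (Suc (Suc 0))"] tens_hom[OF hom_idn hom_cup])
next
  case (Suc k)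
  let ?I = "idn (Suc 0)"
  have 1: "?I \<otimes> cr (Suc k) \<otimes> ?I = ((?I \<otimes> s) \<otimes> idn (Suc k)) \<odot> (idn 2 \<otimes> (cr k \<otimes> ?I))"
  proof -
    have "?I \<otimes> cr (Suc k) \<otimes> ?I = (?I \<otimes> (s \<otimes> idn k) \<otimes> ?I) \<odot> (?I \<otimes> (?I \<otimes> cr k) \<otimes> ?I)"
      by (subst whisker_comp, (rule typing HOL.refl | simp)+)
    then show ?thesis by (simp add: tens_assoc numeral_2_eq_2)
  qed
  have 2: "((cap \<otimes> ?I) \<otimes> idn (Suc k)) \<odot> ((?I \<otimes> s) \<otimes> idn (Suc k)) =
     ((?I \<otimes> cap) \<otimes> idn (Suc k)) \<odot> (s' \<otimes> idn (Suc (Suc k)))"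
  proof -
    have "((cap \<otimes> ?I) \<otimes> idn (Suc k)) \<odot> ((?I \<otimes> s) \<otimes> idn (Suc k)) = (u1 \<odot> s2) \<otimes> idn (Suc k)"
      by (rule comp_tens_idn, (rule typing HOL.refl | simp)+)
    also have "\<dots> = (u2 \<odot> (s' \<otimes> ?I)) \<otimes> idn (Suc k)" by (simp add: s_rot)
    also have "\<dots> = ((?I \<otimes> cap) \<otimes> idn (Suc k)) \<odot> ((s' \<otimes> ?I) \<otimes> idn (Suc k))"
      by (rule comp_tens_idn[symmetric], (rule typing HOL.refl | simp)+)
    finally show ?thesis by (simp add: tens_assoc)
  qed
  have 3: "(s' \<otimes> idn (Suc (Suc k))) \<odot> (idn 2 \<otimes> (cr k \<otimes> ?I)) = (idn 2 \<otimes> (cr k \<otimes> ?I)) \<odot> (s' \<otimes> idn (Suc (Suc k)))"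
    by (subst tens_LR[where p = 2 and q = 2], (rule typing HOL.refl | simp)+)
      (subst tens_RL, (rule typing HOL.refl | simp)+)
  have 4: "(s' \<otimes> idn (Suc (Suc k))) \<odot> (idn (Suc (Suc k)) \<otimes> cup) = (idn (Suc (Suc k)) \<otimes> cup) \<odot> (s' \<otimes> idn k)"
  proof -
    have "(s' \<otimes> idn (Suc (Suc k))) \<odot> (idn 2 \<otimes> (idn k \<otimes> cup)) = s' \<otimes> (idn k \<otimes> cup)"
      by (rule tens_LR, (rule typing HOL.refl | simp)+)
    also have "\<dots> = (idn 2 \<otimes> (idn k \<otimes> cup)) \<odot> (s' \<otimes> idn k)"
      by (rule tens_RL[symmetric], (rule typing HOL.refl | simp)+)
    finally show ?thesis by (simp add: numeral_2_eq_2)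
  qed
  have "(cap \<otimes> idn (Suc (Suc k))) \<odot> (?I \<otimes> cr (Suc k) \<otimes> ?I) \<odot> (idn (Suc (Suc k)) \<otimes> cup)
    = (((cap \<otimes> ?I) \<otimes> idn (Suc k)) \<odot> ((?I \<otimes> s) \<otimes> idn (Suc k))) \<odot> (idn 2 \<otimes> (cr k \<otimes> ?I)) \<odot> (idn (Suc (Suc k)) \<otimes> cup)"
    unfolding 1 by (simp add: comp_assoc tens_assoc)
  also have "\<dots> = ((?I \<otimes> cap) \<otimes> idn (Suc k)) \<odot> ((s' \<otimes> idn (Suc (Suc k))) \<odot> (idn 2 \<otimes> (cr k \<otimes> ?I))) \<odot> (idn (Suc (Suc k)) \<otimes> cup)"
    unfolding 2 by (simp add: comp_assoc)
  also have "\<dots> = (((?I \<otimes> cap) \<otimes> idn (Suc k)) \<odot> (idn 2 \<otimes> (cr k \<otimes> ?I)) \<odot> (idn (Suc (Suc k)) \<otimes> cup)) \<odot> (s' \<otimes> idn k)"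
    unfolding 3 by (simp add: comp_assoc 4)
  also have "((?I \<otimes> cap) \<otimes> idn (Suc k)) \<odot> (idn 2 \<otimes> (cr k \<otimes> ?I)) \<odot> (idn (Suc (Suc k)) \<otimes> cup) =
     (?I \<otimes> (cap \<otimes> idn (Suc k))) \<odot> (?I \<otimes> (?I \<otimes> (cr k \<otimes> ?I))) \<odot> (?I \<otimes> (idn (Suc k) \<otimes> cup))"
    by (simp add: tens_assoc numeral_2_eq_2)
  also have "\<dots> = ?I \<otimes> cr' k"
    unfolding Suc[symmetric] by (subst idn_tens_comp, (rule typing HOL.refl | simp)+)+
  finally show ?case by simp
qed

lemma tens_cup: "y \<in> hom n m \<Longrightarrow> y \<otimes> cup = (idn m \<otimes> cup) \<odot> y"
  using tens_RL[of y n m cup 0 2] hom_cup by simp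

lemma arc_cap:
  assumes "y \<in> hom n (Suc (j + k))"
  shows "(idn j \<otimes> cap \<otimes> idn (Suc k)) \<odot> arc (Suc j) k y = (idn j \<otimes> cr' k) \<odot> y"
proof -
  have "(idn j \<otimes> cap \<otimes> idn (Suc k)) \<odot> arc (Suc j) k y =
    ((idn j \<otimes> (cap \<otimes> idn (Suc k))) \<odot> (idn j \<otimes> (idn (Suc 0) \<otimes> cr k \<otimes> idn (Suc 0))) \<odot> (idn j \<otimes> (idn (Suc k) \<otimes> cup))) \<odot> y"
    using tens_cup[OF assms] by (simp add: arc_def comp_assoc)
  also have "(idn j \<otimes> (cap \<otimes> idn (Suc k))) \<odot> (idn j \<otimes> (idn (Suc 0) \<otimes> cr k \<otimes> idn (Suc 0))) \<odot> (idn j \<otimes> (idn (Suc k) \<otimes> cup))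
     = idn j \<otimes> cr' k"
    unfolding cap_cr_cup[of k, symmetric] by (subst idn_tens_comp, (rule typing HOL.refl | simp)+)+
  finally show ?thesis .
qed

text \<open>The crossing nearest to the cup is moved from its left leg to its right leg, where it
  becomes \<open>s'\<close>. This exposes a crossing on the last two outputs, which a further
  crossing or cap placed there can absorb.\<close>

lemma arc_last:
  assumes "y \<in> hom n (Suc (j + k))"
  shows "arc j (Suc k) y = (idn (Suc (j + k)) \<otimes> s') \<odot> (idn j \<otimes> cr k \<otimes> idn 2) \<odot> (idn (j + k) \<otimes> cup \<otimes> idn (Suc 0)) \<odot> y"
proof -
  let ?I = "idn (Suc 0)"
  have 1: "idn j \<otimes> cr (Suc k) \<otimes> ?I = (idn j \<otimes> cr k \<otimes> idn 2) \<odot> (idn (j + k) \<otimes> s1)"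
  proof -
    have *: "cr (Suc k) = (cr k \<otimes> ?I) \<odot> (idn k \<otimes> s)"
      using cr_add[of k "Suc 0"] by (simp add: cr_1 del: cr.simps)
    have "idn j \<otimes> cr (Suc k) \<otimes> ?I = (idn j \<otimes> (cr k \<otimes> ?I) \<otimes> ?I) \<odot> (idn j \<otimes> (idn k \<otimes> s) \<otimes> ?I)"
      unfolding * by (rule whisker_comp[symmetric], (rule typing HOL.refl | simp)+)
    then show ?thesis by (simp add: tens_assoc numeral_2_eq_2 del: cr.simps)
  qed
  have 2: "(idn (j + k) \<otimes> s1) \<odot> (idn (j + k) \<otimes> n2) = (idn (j + k) \<otimes> (?I \<otimes> s')) \<odot> (idn (j + k) \<otimes> n1)"
    using s_rot(2) idn_tens_comp[of s1 3 3 n2 "Suc 0" "j + k"] idn_tens_comp[of "?I \<otimes> s'" 3 3 n1 "Suc 0" "j + k"]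
    by (simp add: hom3)
  have 3: "(idn j \<otimes> cr k \<otimes> idn 2) \<odot> (idn (Suc (j + k)) \<otimes> s') = (idn (Suc (j + k)) \<otimes> s') \<odot> (idn j \<otimes> cr k \<otimes> idn 2)"
  proof -
    have "((idn j \<otimes> cr k) \<otimes> idn 2) \<odot> (idn (Suc (j + k)) \<otimes> s') = (idn (Suc (j + k)) \<otimes> s') \<odot> ((idn j \<otimes> cr k) \<otimes> idn 2)"
      by (subst tens_LR[where p = "Suc (j + k)"], (rule typing HOL.refl | simp)+)
        (subst tens_RL, (rule typing HOL.refl | simp)+)
    then show ?thesis by (simp add: tens_assoc)
  qed
  have "arc j (Suc k) y = (idn j \<otimes> cr k \<otimes> idn 2) \<odot> ((idn (j + k) \<otimes> s1) \<odot> (idn (j + k) \<otimes> n2)) \<odot> y"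
    unfolding arc_def 1 using tens_cup[OF assms] by (simp add: comp_assoc)
  also have "\<dots> = ((idn j \<otimes> cr k \<otimes> idn 2) \<odot> (idn (Suc (j + k)) \<otimes> s')) \<odot> (idn (j + k) \<otimes> n1) \<odot> y"
    unfolding 2 by (simp add: comp_assoc)
  finally show ?thesis unfolding 3 by (simp add: comp_assoc)
qed

end

section \<open>Morphisms generated by few strands\<close>

context strand_cat begin

text \<open>The distinguished cap or crossing sits next to the inputs, below an arbitrary
  \<open>w\<close>. So whatever is annihilated by these layers from above is annihilated by the
  whole ideal.\<close>

inductive Low :: "nat \<Rightarrow> nat \<Rightarrow> 'a \<Rightarrow> bool" where
  cap: "w \<in> hom (i + j) m \<Longrightarrow> n = i + 2 + j \<Longrightarrow> Low n m (w \<odot> (idn i \<otimes> cap \<otimes> idn j))"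
| X: "w \<in> hom n m \<Longrightarrow> n = i + 2 + j \<Longrightarrow> Low n m (w \<odot> (idn i \<otimes> X \<otimes> idn j))"
| zero: "Low n m 0"
| add: "Low n m f \<Longrightarrow> Low n m g \<Longrightarrow> Low n m (f + g)"

lemma at_hom [typing]:
  "f \<in> hom p q \<Longrightarrow> m = a + p + b \<Longrightarrow> n = a + q + b \<Longrightarrow> idn a \<otimes> f \<otimes> idn b \<in> hom m n"
  using hom_tens[OF hom_idn[of a] hom_tens[OF _ hom_idn[of b]]] by (simp add: add.assoc)

lemma Low_hom: "Low n m f \<Longrightarrow> f \<in> hom n m"
proof (induction rule: Low.induct)
  case (cap w i j m n)
  note [typing] = hom_cast[OF cap(1)]
  show ?case unfolding cap(2) by (rule typing HOL.refl | simp)+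
next
  case (X w n m i j)
  note [typing] = hom_cast[OF X(1)]
  show ?case by (rule typing HOL.refl | simp add: X(2))+
qed (auto intro: hom_zero hom_add)

lemma Low_comp: "Low n m f \<Longrightarrow> g \<in> hom m k \<Longrightarrow> Low n k (g \<odot> f)"
proof (induction rule: Low.induct)
  case (cap w i j m n)
  show ?case using Low.cap[OF hom_comp[OF cap(3,1)] cap(2)] by (simp only: comp_assoc)
next
  case (X w n m i j)
  show ?case using Low.X[OF hom_comp[OF X(3,1)] X(2)] by (simp only: comp_assoc)
qed (simp_all add: bilinear Low.zero Low.add)

lemma Low_scl: "Low n m f \<Longrightarrow> Low n m (a \<star> f)"
  using Low_comp[of n m f "a \<star> idn m" m] Low_hom[of n m f] hom_scl[OF hom_idn, of a m]
  by (simp add: bilinear idn_comp)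

lemma Low_tens: "Low n m f \<Longrightarrow> g \<in> hom p q \<Longrightarrow> Low (n + p) (m + q) (f \<otimes> g)"
proof (induction rule: Low.induct)
  case (cap w i j m n)
  have "(w \<odot> (idn i \<otimes> cap \<otimes> idn j)) \<otimes> g = (w \<otimes> g) \<odot> ((idn i \<otimes> cap \<otimes> idn j) \<otimes> idn p)"
    using idn_tens_slide(4)[OF cap(3,1), of "idn i \<otimes> cap \<otimes> idn j" "i + 2 + j"] by (simp add: at_hom[OF hom_cap])
  then show ?case using Low.cap[of "w \<otimes> g" i "j + p" "m + q"] hom_tens[OF cap(1,3)] cap(2)
    by (simp add: tens_assoc add.assoc)
next
  case (X w n m i j)
  have "(w \<odot> (idn i \<otimes> X \<otimes> idn j)) \<otimes> g = (w \<otimes> g) \<odot> ((idn i \<otimes> X \<otimes> idn j) \<otimes> idn p)"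
    using idn_tens_slide(4)[OF X(3,1), of "idn i \<otimes> X \<otimes> idn j" n] X(2) by (simp add: at_hom[OF hom_X])
  then show ?case using Low.X[of "w \<otimes> g" "n + p" "m + q" i "j + p"] hom_tens[OF X(1,3)] X(2)
    by (simp add: tens_assoc add.assoc)
qed (simp_all add: bilinear Low.zero Low.add)

text \<open>Combinations of normal forms modulo \<open>Low\<close>, built up at the right end: the
  last output is either a through strand or the right foot of an arc. Through strands do not cross
  each other; only left legs of arcs cross anything.\<close>

inductive V :: "nat \<Rightarrow> nat \<Rightarrow> 'a \<Rightarrow> bool" where
  empty: "V 0 0 (idn 0)"
| low: "Low n m f \<Longrightarrow> V n m f"
| add: "V n m f \<Longrightarrow> V n m g \<Longrightarrow> V n m (f + g)"
| scl: "V n m f \<Longrightarrow> V n m (a \<star> f)"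
| arch: "V n (j + k) f \<Longrightarrow> m = Suc (Suc (j + k)) \<Longrightarrow> V n m (arc j k f)"
| strand: "V n m f \<Longrightarrow> V (Suc n) (Suc m) (f \<otimes> idn (Suc 0))"

lemma V_hom: "V n m f \<Longrightarrow> f \<in> hom n m"
proof (induction rule: V.induct)
  case (arch n j k f m)
  then show ?case using arc_hom by simp
next
  case (strand n m f)
  then show ?case using hom_tens[OF _ hom_idn[of "Suc 0"]] by fastforce
qed (auto intro: hom_idn Low_hom hom_add hom_scl)

section \<open>Normal forms are preserved by cups, braidings and caps\<close>

abbreviation lay where "lay a f b \<equiv> idn a \<otimes> f \<otimes> idn b"

lemma at_strand:
  assumes "f \<in> hom p q" "g \<in> hom n (a + p + b)"
  shows "lay a f (Suc b) \<odot> (g \<otimes> idn (Suc 0)) = (lay a f b \<odot> g) \<otimes> idn (Suc 0)"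
  using comp_tens_idn[OF at_hom[OF assms(1) HOL.refl HOL.refl] assms(2), of "Suc 0"] by (simp add: tens_assoc)

lemma at_arc_left:
  assumes "f \<in> hom p q" "g \<in> hom n (a + p + b + k)"
  shows "lay a f (b + Suc (Suc k)) \<odot> arc (a + p + b) k g = arc (a + q + b) k (lay a f (b + k) \<odot> g)"
  using arc_left[OF at_hom[OF assms(1) HOL.refl HOL.refl] assms(2)] by (simp add: tens_assoc)

lemma at_arc_inside:
  assumes "natural p q f" "g \<in> hom n (j + (a + p + b))"
  shows "lay (Suc j + a) f (Suc b) \<odot> arc j (a + p + b) g = arc j (a + q + b) (lay (j + a) f b \<odot> g)"
  using arc_inside[OF natural_at[OF assms(1)] assms(2)] by (simp add: tens_assoc)

lemma arc_0: "g \<in> hom n m \<Longrightarrow> arc m 0 g = (idn m \<otimes> cup) \<odot> g"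
proof -
  assume g: "g \<in> hom n m"
  have "arc m 0 g = g \<otimes> cup"
    unfolding arc_def using hom_tens[OF g hom_cup] by (simp add: idn_comp)
  then show ?thesis using tens_cup[OF g] by simp
qed

text \<open>A new cup descends through the last arc or strand, from the left of an arc directly and
  from between its feet by naturality, until it lies at the right end, where it is an arc crossing
  nothing.\<close>

lemma V_cup: "V n m f \<Longrightarrow> a + b = m \<Longrightarrow> V n (Suc (Suc m)) (lay a cup b \<odot> f)"
proof (induction arbitrary: a b rule: V.induct)
  case empty
  then show ?case using V.arch[of 0 0 0 "idn 0" "Suc (Suc 0)"] V.empty arc_0[OF hom_idn[of 0]] by simp
next
  case (low n m f)
  then show ?case by (auto intro!: V.low Low_comp at_hom hom_cup)
next
  case (arch n j k f m)
  note f = V_hom[OF arch.hyps(1)]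
  consider "a \<le> j" | "j < a" "a \<le> Suc (j + k)" | "a = Suc (Suc (j + k))" "b = 0" using arch by linarith
  then show ?case
  proof cases
    case 1
    then obtain c where c: "j = a + c" by (auto simp: le_iff_add)
    then have b: "b = c + Suc (Suc k)" using arch by simp
    have "V n (Suc (Suc j) + k) (lay a cup (c + k) \<odot> f)" using arch.IH[of a "c + k"] c by simp
    then have "V n (Suc (Suc m)) (arc (Suc (Suc j)) k (lay a cup (c + k) \<odot> f))"
      by (rule V.arch) (use arch in simp)
    then show ?thesis using at_arc_left[OF hom_cup, of f n a c k] c f b by simp
  next
    case 2
    then obtain c where c: "a = Suc j + c" by (auto simp: less_iff_Suc_add)
    then have "b > 0" "k = c + (b - 1)" using arch 2 by auto
    then obtain b' where b: "b = Suc b'" "k = c + b'" by (cases b) auto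
    have "V n (j + Suc (Suc k)) (lay (j + c) cup b' \<odot> f)" using arch.IH[of "j + c" b'] b by simp
    then have "V n (Suc (Suc m)) (arc j (Suc (Suc k)) (lay (j + c) cup b' \<odot> f))"
      by (rule V.arch) (use arch in simp)
    then show ?thesis using at_arc_inside[OF natural_cup, of f n j c b'] c f b by simp
  next
    case 3
    note g = V_hom[OF V.arch[OF arch.hyps]]
    have "V n (Suc (Suc m)) (arc m 0 (arc j k f))"
      by (rule V.arch) (use V.arch[OF arch.hyps] in simp_all)
    then show ?thesis using arc_0[OF g] 3 arch.hyps(2) by simp
  qed
next
  case (strand n m f)
  show ?case
  proof (cases b)
    case 0
    note g = V_hom[OF V.strand[OF strand(1)]]
    have "V (Suc n) (Suc (Suc (Suc m))) (arc (Suc m) 0 (f \<otimes> idn (Suc 0)))"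
      by (rule V.arch) (use V.strand[OF strand(1)] in simp_all)
    then show ?thesis using arc_0[OF g] 0 strand by simp
  next
    case (Suc b')
    then show ?thesis using at_strand[OF hom_cup, of f n a b'] V_hom[OF strand(1)] strand.prems V.strand[OF strand.IH[of a b']]
      by simp
  qed
qed (simp_all add: bilinear V.add V.scl)

text \<open>Closure is formulated for \<open>s\<close> and not for \<open>X\<close> because
  \<open>s\<close> lengthens or shortens the arcs of a normal form, whereas \<open>X\<close> has no
  such effect. \<open>X\<close> is recovered afterwards as a linear combination.\<close>

definition clo :: "nat \<Rightarrow> bool" where
  "clo m \<longleftrightarrow> (\<forall>n f a b. V n m f \<longrightarrow> a + 2 + b = m \<longrightarrow>
     V n m (lay a s b \<odot> f) \<and> V n (a + b) (lay a cap b \<odot> f))"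

lemma cloD:
  assumes "clo m" "V n m f" "a + 2 + b = m"
  shows "V n m (lay a s b \<odot> f)" and "k = a + b \<Longrightarrow> V n k (lay a cap b \<odot> f)"
  using assms by (auto simp: clo_def)

lemma at_lin: "lay a (f + g) b = lay a f b + lay a g b" "lay a (f - g) b = lay a f b - lay a g b"
   "lay a (c \<star> f) b = c \<star> lay a f b"
  by (simp_all add: bilinear)

lemma at_U: "lay a U b = lay a cup b \<odot> lay a cap b"
  by (rule whisker_comp[symmetric], (rule typing HOL.refl)+)

lemma V_uminus: "V n m f \<Longrightarrow> V n m (- f)"
  using V.scl[of n m f "-1"] by simp

lemma V_diff: "V n m f \<Longrightarrow> V n m g \<Longrightarrow> V n m (f - g)"
  using V.add[of n m f "- g"] V_uminus by simp

text \<open>\<open>s\<close> and \<open>s'\<close> differ by multiples of the identity and of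
  \<open>U\<close>, and \<open>U\<close> factors through the cap.\<close>

lemma V_skein:
  assumes "V n m f" "a + 2 + b = m" "V n (a + b) (lay a cap b \<odot> f)"
  shows "V n m (lay a s b \<odot> f) \<longleftrightarrow> V n m (lay a s' b \<odot> f)"
proof -
  have U: "V n m (lay a U b \<odot> f)"
    unfolding at_U comp_assoc using V_cup[OF assms(3)] assms(2) by auto
  have 1: "lay a (idn 2) b \<odot> f = f" using V_hom[OF assms(1)] assms(2) by (simp add: idn_comp)
  have "lay a s b \<odot> f = lay a s' b \<odot> f + (v - inverse v) \<star> (f - lay a U b \<odot> f)"
    by (subst s_skein) (simp only: at_lin bilinear 1)
  moreover have "V n m ((v - inverse v) \<star> (f - lay a U b \<odot> f))" using U assms(1) by (intro V.scl V_diff)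
  ultimately show ?thesis using V.add V_diff by (metis add_diff_cancel_right')
qed

text \<open>The last \<open>r\<close> outputs are left alone, so only crossings at distance at least
  \<open>r\<close> from the right end are assumed to be harmless. This permits its use before the
  last position has been dealt with.\<close>

lemma V_cr:
  assumes "\<And>a b f. V n m f \<Longrightarrow> a + 2 + b = m \<Longrightarrow> b \<ge> r \<Longrightarrow> V n m (lay a s b \<odot> f)"
  shows "V n m f \<Longrightarrow> j + Suc k + r = m \<Longrightarrow> V n m ((idn j \<otimes> cr k \<otimes> idn r) \<odot> f)"
proof (induction k arbitrary: j)
  case 0
  then show ?case using V_hom[OF 0(1)] by (simp add: idn_comp)
next
  case (Suc k)
  have "(idn j \<otimes> cr (Suc k) \<otimes> idn r) = (idn j \<otimes> (s \<otimes> idn k) \<otimes> idn r) \<odot> (idn j \<otimes> (idn (Suc 0) \<otimes> cr k) \<otimes> idn r)"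
    by (subst whisker_comp, (rule typing HOL.refl | simp)+)
  then have "(idn j \<otimes> cr (Suc k) \<otimes> idn r) \<odot> f = lay j s (k + r) \<odot> (idn (Suc j) \<otimes> cr k \<otimes> idn r) \<odot> f"
    by (simp add: comp_assoc tens_assoc)
  then show ?case using assms[OF Suc.IH[of "Suc j"], of j "k + r"] Suc.prems by simp
qed

lemma V_cr':
  assumes "clo m"
  shows "V n m f \<Longrightarrow> j + Suc k = m \<Longrightarrow> V n m ((idn j \<otimes> cr' k) \<odot> f)"
proof (induction k arbitrary: j f)
  case 0
  then show ?case using V_hom[OF 0(1)] by (simp add: idn_comp)
next
  case (Suc k)
  have "idn j \<otimes> cr' (Suc k) = (idn j \<otimes> (idn (Suc 0) \<otimes> cr' k)) \<odot> (idn j \<otimes> (s' \<otimes> idn k))"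
    by (subst idn_tens_comp, (rule typing HOL.refl | simp)+)
  then have "(idn j \<otimes> cr' (Suc k)) \<odot> f = (idn (Suc j) \<otimes> cr' k) \<odot> lay j s' k \<odot> f"
    by (simp add: comp_assoc tens_assoc)
  moreover have "V n m (lay j s' k \<odot> f)"
    using assms Suc.prems V_skein[OF Suc.prems(1), of j k] by (auto simp: clo_def)
  ultimately show ?case using Suc.IH[of "lay j s' k \<odot> f" "Suc j"] Suc.prems by simp
qed

lemma at_cap_s: "lay a cap b \<odot> lay a s b = lam \<star> lay a cap b" "lay a cap b \<odot> lay a s' b = inverse lam \<star> lay a cap b"
   "lay a s b \<odot> lay a cup b = lam \<star> lay a cup b" "lay a cap b \<odot> lay a cup b = qd \<star> idn (a + b)"
   "lay a s b \<odot> lay a s' b = idn (a + 2 + b)"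
  by (subst whisker_comp, (rule typing HOL.refl)+, simp add: s_cup loop s_s' bilinear)+

definition reduces :: "nat \<Rightarrow> nat \<Rightarrow> nat \<Rightarrow> 'a \<Rightarrow> bool" where
  "reduces n a b f \<longleftrightarrow> V n (a + 2 + b) (lay a s b \<odot> f) \<and> V n (a + b) (lay a cap b \<odot> f)"

lemma reduces_Low:
  assumes "Low n (a + 2 + b) f"
  shows "reduces n a b f"
  using V.low[OF Low_comp[OF assms at_hom[OF s_hom(1)[OF HOL.refl HOL.refl] HOL.refl HOL.refl]]]
    V.low[OF Low_comp[OF assms at_hom[OF hom_cap HOL.refl HOL.refl]]]
  by (simp add: reduces_def)

text \<open>A layer that spares the last output. When the normal form ends in an arc, everything
  depends on where the layer lies relative to the left foot \<open>j\<close>: away from it the layer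
  passes on to a word with two outputs less, and at the foot it changes the arc itself.\<close>

lemma reduces_inside:
  "V n m f \<Longrightarrow> a + 2 + Suc b = m \<Longrightarrow> (\<And>m'. m' < m \<Longrightarrow> clo m') \<Longrightarrow> reduces n a (Suc b) f"
proof (induction arbitrary: a b rule: V.induct)
  case empty then show ?case by simp
next
  case (low n m f)
  then show ?case by (intro reduces_Low) simp
next
  case (arch n j k f m)
  note f = V_hom[OF arch.hyps(1)]
  have clo: "clo (j + k)" using arch by simp
  have A: "V n m (arc j k f)" by (rule V.arch[OF arch.hyps])
  consider "a + 2 \<le> j" | "j = Suc a" | "a = j" | "Suc j \<le> a" by linarith
  then show ?case
  proof cases
    case 1
    then obtain c where c: "j = a + 2 + c" by (auto simp: le_iff_add)
    then have b: "Suc b = c + Suc (Suc k)" using arch by simp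
    have "V n (j + k) (lay a s (c + k) \<odot> f)" "V n (a + (c + k)) (lay a cap (c + k) \<odot> f)"
      using cloD[OF clo arch.hyps(1), of a "c + k"] c by simp_all
    then show ?thesis 
      using at_arc_left[OF hom_cap, of f n a c k] at_arc_left[OF s_hom(1)[OF HOL.refl HOL.refl], of f n a c k] c f arch.hyps(2) b
       V.arch[of n j k] V.arch[of n "a + c" k] by (simp add: reduces_def add.assoc)
  next
    \<comment> \<open>The layer meets the left foot and the strand on its left: the crossing
      lengthens the arc, the cap straightens it.\<close>
    case 2
    then have b: "b = k" using arch by simp
    have "V n (j + k) ((idn a \<otimes> cr' k) \<odot> f)" using V_cr'[OF clo arch.hyps(1), of a k] 2 by simp
    then show ?thesis using arc_s[of a k f] arc_cap[of f n a k] f 2 b V.arch[of n a "Suc k" f m] arch.hyps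
      by (simp add: reduces_def)
  next
    \<comment> \<open>The layer meets the left foot and the strand that its leg has crossed last.
      Here \<open>s'\<close> undoes that crossing and the cap absorbs it with the factor
      \<open>lam\<close>; the skein relation then passes from \<open>s'\<close> to
      \<open>s\<close>.\<close>
    case 3
    then have b: "k = Suc b" using arch by simp
    have "V n (j + k) ((idn (Suc 0 + j - Suc 0) \<otimes> cr' b) \<odot> f)" using V_cr'[OF clo arch.hyps(1), of j b] b by simp
    then have "V n (j + k) (lay j cap (Suc b) \<odot> arc (Suc j) b f)" using arc_cap[of f n j b] f b by simp
    moreover have "lay j cap (Suc b) \<odot> arc j k f = lam \<star> (lay j cap (Suc b) \<odot> arc (Suc j) b f)"
      unfolding b arc_s[symmetric] by (simp add: at_cap_s(1)[THEN comp_ext] bilinear)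
    ultimately have 1: "V n (j + k) (lay j cap (Suc b) \<odot> arc j k f)" by (simp add: V.scl)
    have "V n m (lay j s' (Suc b) \<odot> arc j k f)"
      using arc_s'[of f n j b] f b V.arch[of n "Suc j" b f m] arch.hyps by simp
    then show ?thesis using V_skein[OF A, of j "Suc b"] 1 3 b arch.hyps(2) by (simp add: reduces_def)
  next
    case 4
    then obtain c where c: "a = Suc j + c" by (auto simp: le_iff_add)
    then have b: "k = c + 2 + b" using arch by simp
    have "V n (j + k) (lay (j + c) s b \<odot> f)" "V n (j + c + b) (lay (j + c) cap b \<odot> f)"
      using cloD[OF clo arch.hyps(1), of "j + c" b] b by simp_all
    then show ?thesis 
      using at_arc_inside[OF natural_cap, of f n j c b] at_arc_inside[OF natural_s, of f n j c b] c f arch.hyps(2) b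
       V.arch[of n j k] V.arch[of n j "c + b"] by (simp add: reduces_def add.assoc)
  qed
next
  case (strand n m f)
  have "clo m" using strand by simp
  then have "V n m (lay a s b \<odot> f)" "V n (a + b) (lay a cap b \<odot> f)" using cloD[OF \<open>clo m\<close> strand.hyps(1)] strand.prems(1) by simp_all
  then show ?case using at_strand[OF hom_cap, of f n a b] at_strand[OF s_hom(1)[OF HOL.refl HOL.refl], of f n a b] 
    V_hom[OF strand(1)] strand.prems V.strand by (auto simp: reduces_def)
qed (simp_all add: reduces_def bilinear V.add V.scl)

lemma at_last_strand:
  assumes "g \<in> hom n m"
  shows "lay m f 0 \<odot> ((g \<otimes> idn (Suc 0)) \<otimes> idn (Suc 0)) = lay m f 0 \<odot> (g \<otimes> idn 2)"
  by (simp add: tens_assoc numeral_2_eq_2)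

lemma arc_strand:
  assumes g: "g \<in> hom n (j + k)"
  shows "arc j k g \<otimes> idn (Suc 0) =
    (idn j \<otimes> cr k \<otimes> idn 2) \<odot> lay (j + k) cup (Suc 0) \<odot> (g \<otimes> idn (Suc 0))"
proof -
  note [typing] = hom_cast[OF g]
  have "arc j k g \<otimes> idn (Suc 0) = ((idn j \<otimes> cr k \<otimes> idn (Suc 0)) \<otimes> idn (Suc 0)) \<odot> ((g \<otimes> cup) \<otimes> idn (Suc 0))"
    unfolding arc_def by (rule comp_tens_idn[symmetric], (rule typing HOL.refl | simp)+)
  also have "(g \<otimes> cup) \<otimes> idn (Suc 0) = ((idn (j + k) \<otimes> cup) \<otimes> idn (Suc 0)) \<odot> (g \<otimes> idn (Suc 0))"
    unfolding tens_cup[OF g] by (rule comp_tens_idn[symmetric], (rule typing HOL.refl | simp)+)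
  finally show ?thesis by (simp add: tens_assoc numeral_2_eq_2)
qed

lemma cr_last_slide:
  assumes "f \<in> hom 2 q"
  shows "lay (Suc (j + k)) f 0 \<odot> (idn j \<otimes> cr k \<otimes> idn 2) = (idn j \<otimes> cr k \<otimes> idn q) \<odot> lay (Suc (j + k)) f 0"
proof -
  note [typing] = hom_cast[OF assms]
  have "(idn (Suc (j + k)) \<otimes> f) \<odot> ((idn j \<otimes> cr k) \<otimes> idn 2) = ((idn j \<otimes> cr k) \<otimes> idn q) \<odot> (idn (Suc (j + k)) \<otimes> f)"
    by (subst tens_RL, (rule typing HOL.refl | simp)+) (subst tens_LR[where p = "Suc (j + k)"], (rule typing HOL.refl | simp)+)
  then show ?thesis by (simp add: tens_assoc)
qed

lemma at_s_cup: "lay (Suc m) s 0 \<odot> lay m cup (Suc 0) = lay m s' (Suc 0) \<odot> lay (Suc m) cup 0"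
  "lay (Suc m) cap 0 \<odot> lay m cup (Suc 0) = idn (Suc m)"
proof -
  have "(idn m \<otimes> s2) \<odot> (idn m \<otimes> n1) = (idn m \<otimes> (s' \<otimes> idn (Suc 0))) \<odot> (idn m \<otimes> n2)"
    using s_rot(1) idn_tens_comp[of s2 3 3 n1 "Suc 0" m] idn_tens_comp[of "s' \<otimes> idn (Suc 0)" 3 3 n2 "Suc 0" m]
    by (simp add: hom3)
  then show "lay (Suc m) s 0 \<odot> lay m cup (Suc 0) = lay m s' (Suc 0) \<odot> lay (Suc m) cup 0" by simp
  have "(idn m \<otimes> u2) \<odot> (idn m \<otimes> n1) = idn m \<otimes> idn (Suc 0)"
    using idn_tens_comp[of u2 3 "Suc 0" n1 "Suc 0" m] by (simp add: hom3 strand3)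
  then show "lay (Suc m) cap 0 \<odot> lay m cup (Suc 0) = idn (Suc m)" by simp
qed

text \<open>Above two neighbouring through strands the layer slides down to the inputs. There its
  cap and \<open>X\<close> parts fall into the ideal, and the identity part of \<open>s\<close>
  returns the normal form.\<close>

lemma reduces_strand_strand:
  assumes "V n m f"
  shows "reduces (Suc (Suc n)) m 0 ((f \<otimes> idn (Suc 0)) \<otimes> idn (Suc 0))"
proof -
  note f = V_hom[OF assms]
  have ff: "V (Suc (Suc n)) (Suc (Suc m)) (f \<otimes> idn 2)"
    using V.strand[OF V.strand[OF assms]] by (simp add: tens_assoc numeral_2_eq_2)
  have slide: "(idn m \<otimes> g) \<odot> (f \<otimes> idn 2) = (f \<otimes> idn q) \<odot> (idn n \<otimes> g)" if "g \<in> hom 2 q" for g q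
    by (simp only: tens_LR[OF f that] tens_RL[OF f that])
  have cap: "Low (Suc (Suc n)) m ((idn m \<otimes> cap) \<odot> (f \<otimes> idn 2))"
    using slide[OF hom_cap] Low.cap[of f n 0 m] f by simp
  have "idn m \<otimes> cup \<in> hom m (Suc (Suc m))" using hom_tens[OF hom_idn[of m] hom_cup] by simp
  from Low_comp[OF cap this]
  have U: "Low (Suc (Suc n)) (Suc (Suc m)) ((idn m \<otimes> U) \<odot> (f \<otimes> idn 2))"
    unfolding idn_tens_comp[OF hom_cup hom_cap, of m, symmetric] by (simp only: comp_assoc)
  have X: "Low (Suc (Suc n)) (Suc (Suc m)) ((idn m \<otimes> X) \<odot> (f \<otimes> idn 2))"
    using Low.X[OF V_hom[OF ff], of n 0] by (simp add: slide[OF hom_X])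
  have "(idn m \<otimes> idn 2) \<odot> (f \<otimes> idn 2) = f \<otimes> idn 2"
    by (simp only: idn_tens) (rule idn_comp_left, use V_hom[OF ff] in simp)
  then have "(idn m \<otimes> s) \<odot> (f \<otimes> idn 2) = v \<star> (f \<otimes> idn 2) + inverse v \<star> ((idn m \<otimes> U) \<odot> (f \<otimes> idn 2))
     + inverse (qint 2) \<star> ((idn m \<otimes> X) \<odot> (f \<otimes> idn 2))"
    by (simp only: s_def bilinear)
  then have "V (Suc (Suc n)) (Suc (Suc m)) ((idn m \<otimes> s) \<odot> (f \<otimes> idn 2))"
    using ff V.low[OF U] V.low[OF X] by (simp add: V.add V.scl)
  then show ?thesis unfolding reduces_def at_last_strand[OF f] using V.low[OF cap] by simp
qed

text \<open>Strong induction on the number of outputs. What remains after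
  \<open>reduces_inside\<close> is a layer on the last two outputs; it is treated according to what
  ends there: an arc, a strand next to the right foot of an arc, or two strands.\<close>

lemma clo: "clo m"
proof (induction m rule: less_induct)
  case (less m)
  have inside: "reduces n a (Suc b) f" if "V n m f" "a + 2 + Suc b = m" for n a b f
    by (rule reduces_inside) (use that less in auto)
  have inside_s: "V n m (lay a s b \<odot> f)" if "V n m f" "a + 2 + b = m" "b \<ge> Suc 0" for n a b f
    using inside[of n f a "b - 1"] that by (auto simp: reduces_def)
  have inside_s': "V n m (lay a s' b \<odot> f)" if "V n m f" "a + 2 + b = m" "b \<ge> Suc 0" for n a b f
    using V_skein[OF that(1,2)] inside[of n f a "b - 1"] that by (auto simp: reduces_def)
  have "reduces n a 0 f" if "V n m f" "a + 2 = m" for n a f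
    using that less inside_s inside_s'
  proof (induction arbitrary: a rule: V.induct)
    case empty then show ?case by simp
  next
    case (low n m f)
    then show ?case by (intro reduces_Low) simp
  next
    case (arch n j k f m)
    note f = V_hom[OF arch.hyps(1)]
    have clo: "clo (j + k)" using arch by simp
    have a: "a = j + k" using arch by simp
    show ?case
    proof (cases k)
      \<comment> \<open>Both outputs are the feet of one cup, so the layer produces a curl or a
        loop.\<close>
      case 0
      have *: "(idn j \<otimes> s) \<odot> (idn j \<otimes> cup) = lam \<star> (idn j \<otimes> cup)" "(idn j \<otimes> cap) \<odot> (idn j \<otimes> cup) = qd \<star> idn j"
        using at_cap_s(3)[of j 0] at_cap_s(4)[of j 0] by simp_all
      then show ?thesis using V.scl[OF arch.hyps(1)] V.scl[OF V.arch[OF arch.hyps]] arc_0[of f n j] f 0 a arch.hyps(2)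
        by (simp add: reduces_def *[THEN comp_ext] idn_comp bilinear)
    next
      \<comment> \<open>By \<open>arc_last\<close> the two outputs carry an \<open>s'\<close>. The
        layer \<open>s\<close> cancels it; the cap absorbs it up to a scalar and then straightens
        the cup below.\<close>
      case (Suc k')
      let ?Z = "idn j \<otimes> cr k' \<otimes> idn 2" and ?f = "lay (j + k') cup (Suc 0) \<odot> f"
      have f': "V n m ?f" using V_cup[OF arch.hyps(1), of "j + k'" "Suc 0"] Suc arch.hyps(2) by simp
      have last: "arc j k f = lay (Suc (j + k')) s' 0 \<odot> ?Z \<odot> ?f" using arc_last[of f n j k'] f Suc by simp
      \<comment> \<open>The crossings in \<open>?Z\<close> spare the last two outputs and are thus
        covered by the case already settled for this number of outputs.\<close>
      have Zf: "V n m (?Z \<odot> ?f)"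
        by (rule V_cr[where r = 2]) (use arch.prems f' Suc arch.hyps(2) in auto)
      have 1: "lay a s 0 \<odot> arc j k f = ?Z \<odot> ?f"
        unfolding last using at_cap_s(5)[of "Suc (j + k')" 0, THEN comp_ext] a Suc V_hom[OF Zf] arch.hyps(2) by (simp add: idn_comp)
      have "lay a cap 0 \<odot> arc j k f = inverse lam \<star> (lay (Suc (j + k')) cap 0 \<odot> ?Z \<odot> ?f)"
        unfolding last using at_cap_s(2)[of "Suc (j + k')" 0, THEN comp_ext] a Suc by (simp add: bilinear)
      moreover have "lay (Suc (j + k')) cap 0 \<odot> ?Z \<odot> ?f = (idn j \<otimes> cr k' \<otimes> idn 0) \<odot> f"
        using cr_last_slide[OF hom_cap, of j k', THEN comp_ext] at_s_cup(2)[of "j + k'", THEN comp_ext] f Suc by (simp add: idn_comp comp_assoc)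
      moreover have "V n (j + k) ((idn j \<otimes> cr k' \<otimes> idn 0) \<odot> f)"
        by (rule V_cr[where r = 0]) (use clo arch.hyps(1) Suc in \<open>auto simp: clo_def\<close>)
      ultimately show ?thesis unfolding reduces_def 1 using Zf a arch.hyps(2) V.scl by simp
    qed
  next
    case (strand n m f)
    note clo = strand.prems(2) and inside_s = strand.prems(3) and inside_s' = strand.prems(4)
    have "a + 1 = m" using strand by simp
    \<comment> \<open>The last output is a strand; the output before it decides, so the construction
      of \<open>f\<close> is analysed once more.\<close>
    with strand(1) show ?case using clo inside_s inside_s'
    proof (induction arbitrary: a rule: V.induct)
      case empty then show ?case by simp
    next
      case (low n m f)
      have "Low (Suc n) (Suc m) (f \<otimes> idn (Suc 0))" using Low_tens[OF low(1) hom_idn[of "Suc 0"]] by simp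
      then show ?case using low.prems by (intro reduces_Low) simp
    next
      case (arch n j k f m)
      note f = V_hom[OF arch.hyps(1)]
      have a: "a = Suc (j + k)" using arch by simp
      let ?Z = "idn j \<otimes> cr k \<otimes> idn 2" and ?f = "f \<otimes> idn (Suc 0)"
      have f': "V (Suc n) (Suc (j + k)) ?f" by (rule V.strand[OF arch.hyps(1)])
      then have f'': "V (Suc n) (Suc m) (lay (Suc (j + k)) cup 0 \<odot> ?f)"
        using V_cup[OF f', of "Suc (j + k)" 0] arch.hyps(2) by simp
      have *: "lay a g 0 \<odot> (arc j k f \<otimes> idn (Suc 0)) = (idn j \<otimes> cr k \<otimes> idn q) \<odot> lay (Suc (j + k)) g 0 \<odot> lay (j + k) cup (Suc 0) \<odot> ?f"
        if "g \<in> hom 2 q" for g q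
        unfolding arc_strand[OF f] a using cr_last_slide[OF that, of j k, THEN comp_ext] by (simp add: comp_assoc)
      \<comment> \<open>Rotation about the cup replaces the crossing on the last two outputs by an
        \<open>s'\<close> one place further left, which is no longer at the end.\<close>
      have 1: "V (Suc n) (Suc m) (lay (j + k) s' (Suc 0) \<odot> lay (Suc (j + k)) cup 0 \<odot> ?f)"
        using arch.prems(4)[OF f''] arch.hyps(2) by simp
      have "V (Suc n) (Suc m) (?Z \<odot> (lay (j + k) s' (Suc 0) \<odot> lay (Suc (j + k)) cup 0 \<odot> ?f))"
        by (rule V_cr[where r = 2]) (use arch.prems 1 arch.hyps(2) in auto)
      moreover have "lay a s 0 \<odot> (arc j k f \<otimes> idn (Suc 0)) = ?Z \<odot> (lay (j + k) s' (Suc 0) \<odot> lay (Suc (j + k)) cup 0 \<odot> ?f)"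
        using *[OF s_hom(1)[OF HOL.refl HOL.refl]] at_s_cup(1)[of "j + k", THEN comp_ext] by (simp add: comp_assoc)
      moreover have "lay a cap 0 \<odot> (arc j k f \<otimes> idn (Suc 0)) = (idn j \<otimes> cr k \<otimes> idn 0) \<odot> ?f"
        using *[OF hom_cap] at_s_cup(2)[of "j + k", THEN comp_ext] V_hom[OF f'] by (simp add: comp_assoc idn_comp)
      moreover have "V (Suc n) (Suc (j + k)) ((idn j \<otimes> cr k \<otimes> idn 0) \<odot> ?f)"
        by (rule V_cr[where r = 0]) (use arch.prems(2)[of "Suc (j + k)"] f' arch.hyps(2) in \<open>auto simp: clo_def\<close>)
      ultimately show ?case using a arch.hyps(2) by (simp add: reduces_def)
    next
      case (strand n m f)
      then show ?case using reduces_strand_strand[OF strand(1)] by simp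
    qed (simp_all add: reduces_def bilinear V.add V.scl)
  qed (simp_all add: reduces_def bilinear V.add V.scl)
  then show ?case using inside unfolding clo_def reduces_def
    by (metis add.right_neutral old.nat.exhaust)
qed

end

section \<open>The clasp recursion\<close>

definition al :: "nat \<Rightarrow> K" where
  "al n = qint (2 * n) * qint (n + 1) * qint (n - 1) / (qint (2 * n + 2) * qint n * qint n)"

definition be :: "nat \<Rightarrow> K" where
  "be n = qint (n - 1) / (qint n * qint 2)"

text \<open>Here a = v^n and A = v^-n. The pair \<open>a'\<close>, \<open>b'\<close> consists of the
  recursion coefficients for n strands and \<open>a1\<close>, \<open>b1\<close> of those for n + 1
  strands, so the quantum integers are gone and only rational identities modulo
  \<open>a * A = 1\<close> and \<open>v * w = 1\<close> remain.\<close>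

lemma jw_coeffs_aux:
  fixes a A v w :: K
  assumes "a * A = 1" "v * w = 1" "a - A \<noteq> 0" "a * v - A * w \<noteq> 0" "a * v + A * w \<noteq> 0" "a * v\<^sup>2 + A * w\<^sup>2 \<noteq> 0" "v + w \<noteq> 0"
  defines "d \<equiv> - ((v ^ 3 + w ^ 3) * (v + w))" and "t \<equiv> v + w"
    and "a' \<equiv> (a + A) * (a * w - A * v) / ((a * v + A * w) * (a - A))" and "b' \<equiv> (a * w - A * v) / ((a - A) * (v + w))"
    and "a1 \<equiv> (a * v + A * w) * (a - A) / ((a * v\<^sup>2 + A * w\<^sup>2) * (a * v - A * w))" and "b1 \<equiv> (a - A) / ((a * v - A * w) * (v + w))"
  shows "1 + b1 * (- t\<^sup>2 + b' * t\<^sup>2) = 0"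
    and "a1 * (a' - b' * t\<^sup>2) + b1 * b' * t\<^sup>2 = 0"
    and "a1 * (- d + b' * (d - t\<^sup>2)) + b1 * (d - t\<^sup>2 + b' * (3 * t\<^sup>2 - d)) = 0"
    and "1 + a1 * (d + a' - d * b') + b1 * (- d + b' * (d - t\<^sup>2)) = 0"
proof -
  \<comment> \<open>Named denominators are atoms known to be nonzero, so fractions can be cleared
    before anything is multiplied out.\<close>
  define p where "p = a - A"
  define r where "r = a * v - A * w"
  define x where "x = a * v + A * w"
  define y where "y = a * v\<^sup>2 + A * w\<^sup>2"
  have nz: "p \<noteq> 0" "r \<noteq> 0" "x \<noteq> 0" "y \<noteq> 0" "t \<noteq> 0" using assms by (simp_all add: p_def r_def x_def y_def)
  have e: "a' = (a + A) * (a * w - A * v) / (x * p)" "b' = (a * w - A * v) / (p * t)" "a1 = x * p / (y * r)" "b1 = p / (r * t)"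
    by (simp_all add: a'_def b'_def a1_def b1_def p_def r_def x_def y_def t_def)
  have td: "t = v + w" "d = - ((v ^ 3 + w ^ 3) * (v + w))" by (simp_all add: t_def d_def)
  show "1 + b1 * (- t\<^sup>2 + b' * t\<^sup>2) = 0"
    unfolding e apply (simp add: field_simps nz) 
    unfolding p_def r_def x_def y_def td by (simp add: algebra_simps power2_eq_square)
  show "a1 * (a' - b' * t\<^sup>2) + b1 * b' * t\<^sup>2 = 0"
    unfolding e apply (simp add: field_simps nz) 
    unfolding p_def r_def x_def y_def td using assms(1,2) by algebra
  show "a1 * (- d + b' * (d - t\<^sup>2)) + b1 * (d - t\<^sup>2 + b' * (3 * t\<^sup>2 - d)) = 0"
    unfolding e apply (simp add: field_simps nz) 
    unfolding p_def r_def x_def y_def td using assms(1,2) by algebra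
  show "1 + a1 * (d + a' - d * b') + b1 * (- d + b' * (d - t\<^sup>2)) = 0"
    unfolding e apply (simp add: field_simps nz) 
    unfolding p_def r_def x_def y_def td using assms(1,2) by algebra
qed

text \<open>In the notation of \<open>jw_step\<close>, these are the coefficients of
  \<open>Q \<odot> x\<close>, \<open>F\<close> and \<open>Q \<odot> e\<close> in
  \<open>R \<odot> x\<close>, followed by that of \<open>Q \<odot> e\<close> in
  \<open>R \<odot> e\<close>.\<close>

lemma jw_coeffs:
  assumes "n \<ge> 1"
  shows "1 + be (Suc n) * (- (qint 2)\<^sup>2 + be n * (qint 2)\<^sup>2) = 0"
    and "al (Suc n) * (al n - be n * (qint 2)\<^sup>2) + be (Suc n) * be n * (qint 2)\<^sup>2 = 0"
    and "al (Suc n) * (- qd + be n * (qd - (qint 2)\<^sup>2)) + be (Suc n) * (qd - (qint 2)\<^sup>2 + be n * (3 * (qint 2)\<^sup>2 - qd)) = 0"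
    and "1 + al (Suc n) * (qd + al n - qd * be n) + be (Suc n) * (- qd + be n * (qd - (qint 2)\<^sup>2)) = 0"
proof -
  define w where "w = inverse v"
  define a where "a = v ^ n"
  define A where "A = w ^ n"
  have vw: "v * w = 1" by (simp add: w_def)
  have aA: "a * A = 1" using vw by (simp add: a_def A_def flip: power_mult_distrib)
  have z: "v - w \<noteq> 0" using v_minus_inv by (simp add: w_def)
  have q: "qint k = (v ^ k - w ^ k) / (v - w)" for k by (simp add: qint_v w_def)
  have qn: "qint n = (a - A) / (v - w)" by (simp add: q a_def A_def)
  have qn1: "qint (Suc n) = (a * v - A * w) / (v - w)" by (simp add: q a_def A_def mult.commute)
  have qn0: "qint (n - 1) = (a * w - A * v) / (v - w)"
  proof -
    obtain m where m: "n = Suc m" using assms by (cases n) auto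
    have "a * w = v ^ m * (v * w)" "A * v = w ^ m * (v * w)" by (simp_all only: a_def A_def m power_Suc mult_ac)
    then show ?thesis by (simp add: q vw m)
  qed
  \<comment> \<open>The quotient [2k]/[k] is v^k + w^k; this eliminates the doubled quantum integers
    from \<open>al\<close>.\<close>
  have dbl: "qint (2 * k) = qint k * (v ^ k + w ^ k)" for k
  proof -
    have "v ^ (2 * k) - w ^ (2 * k) = (v ^ k - w ^ k) * (v ^ k + w ^ k)"
      by (simp only: mult_2 power_add) (simp add: algebra_simps)
    then show ?thesis by (simp add: q)
  qed
  have nz: "a - A \<noteq> 0" "a * v - A * w \<noteq> 0" "qint (n + 2) \<noteq> 0"
    using qint_nonzero[of n] qint_nonzero[of "Suc n"] qint_nonzero[of "n + 2"] assms z unfolding qn qn1 by auto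
  have sums: "a * v + A * w = v ^ Suc n + w ^ Suc n" "a * v\<^sup>2 + A * w\<^sup>2 = v ^ (n + 2) + w ^ (n + 2)"
    by (simp_all only: a_def A_def power_add power_Suc mult.commute)
  have nz2: "a * v + A * w \<noteq> 0" "a * v\<^sup>2 + A * w\<^sup>2 \<noteq> 0"
  proof -
    have *: "v ^ k + w ^ k \<noteq> 0" if "k > 0" for k using qint_nonzero[of "2 * k"] dbl[of k] that by auto
    show "a * v + A * w \<noteq> 0" "a * v\<^sup>2 + A * w\<^sup>2 \<noteq> 0" unfolding sums by (rule *; simp)+
  qed
  have nz3: "v + w \<noteq> 0" using qint_nonzero[of 2] by (simp add: qint_2 w_def)
  have al: "al n = (a + A) * (a * w - A * v) / ((a * v + A * w) * (a - A))"
  proof -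
    have "al n = qint n * (a + A) * qint (Suc n) * qint (n - 1) / (qint (Suc n) * (a * v + A * w) * qint n * qint n)"
      unfolding sums using dbl[of n] dbl[of "Suc n"] by (simp add: al_def a_def A_def)
    then show ?thesis using nz z by (simp add: qn qn1 qn0[unfolded One_nat_def])
  qed
  have al1: "al (Suc n) = (a * v + A * w) * (a - A) / ((a * v\<^sup>2 + A * w\<^sup>2) * (a * v - A * w))"
  proof -
    have "al (Suc n) = qint (Suc n) * (a * v + A * w) * qint (n + 2) * qint n / (qint (n + 2) * (a * v\<^sup>2 + A * w\<^sup>2) * qint (Suc n) * qint (Suc n))"
      unfolding sums using dbl[of "Suc n"] dbl[of "n + 2"] by (simp add: al_def)
    then show ?thesis using nz z by (simp add: qn qn1)
  qed
  have be: "be n = (a * w - A * v) / ((a - A) * (v + w))"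
    using z by (simp add: be_def qn qn0[unfolded One_nat_def] qint_2 w_def[symmetric])
  have be1: "be (Suc n) = (a - A) / ((a * v - A * w) * (v + w))"
    using z by (simp add: be_def qn qn1 qint_2 w_def[symmetric])
  have d: "qd = - ((v ^ 3 + w ^ 3) * (v + w))" and t: "qint 2 = v + w" by (simp_all add: qd_v qint_2 w_def)
  note * = jw_coeffs_aux[OF aA vw nz(1,2) nz2 nz3]
  show "1 + be (Suc n) * (- (qint 2)\<^sup>2 + be n * (qint 2)\<^sup>2) = 0"
    and "al (Suc n) * (al n - be n * (qint 2)\<^sup>2) + be (Suc n) * be n * (qint 2)\<^sup>2 = 0"
    and "al (Suc n) * (- qd + be n * (qd - (qint 2)\<^sup>2)) + be (Suc n) * (qd - (qint 2)\<^sup>2 + be n * (3 * (qint 2)\<^sup>2 - qd)) = 0"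
    and "1 + al (Suc n) * (qd + al n - qd * be n) + be (Suc n) * (- qd + be n * (qd - (qint 2)\<^sup>2)) = 0"
    unfolding al al1 be be1 d t by (fact *)+
qed

lemma al_1: "al (Suc 0) = 0" and be_1: "be (Suc 0) = 0"
  by (simp_all add: al_def be_def qint_0)

context strand_cat begin

section \<open>The subcategory generated by cup, cap and crossing, modulo the ideal\<close>

inductive G :: "nat \<Rightarrow> nat \<Rightarrow> 'a \<Rightarrow> bool" where
  idn: "G n n (idn n)"
| cup: "G 0 2 cup"
| cap: "G 2 0 cap"
| X: "G 2 2 X"
| comp: "G n k f \<Longrightarrow> G m n g \<Longrightarrow> G m k (f \<odot> g)"
| tens: "G m n f \<Longrightarrow> G m' n' g \<Longrightarrow> G (m + m') (n + n') (f \<otimes> g)"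
| zero: "G m n 0"
| add: "G m n f \<Longrightarrow> G m n g \<Longrightarrow> G m n (f + g)"
| scl: "G m n f \<Longrightarrow> G m n (a \<star> f)"

lemma G_hom: "G m n f \<Longrightarrow> f \<in> hom m n"
  by (induction rule: G.induct)
    (auto simp: hom_idn hom_cup hom_cap hom_X hom_zero intro: hom_comp hom_tens hom_add hom_scl)

text \<open>\<open>X\<close> is a combination of \<open>s\<close>, the identity and
  \<open>U\<close>, and all three preserve normal forms.\<close>

lemma V_X:
  assumes "V n (a + 2 + b) f"
  shows "V n (a + 2 + b) (lay a X b \<odot> f)"
proof -
  let ?t = "qint 2"
  note c = clo[of "a + 2 + b"]
  have s: "V n (a + 2 + b) (lay a s b \<odot> f)" and cap: "V n (a + b) (lay a cap b \<odot> f)"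
    using cloD[OF c assms] by simp_all
  have U: "V n (a + 2 + b) (lay a U b \<odot> f)"
    unfolding at_U comp_assoc using V_cup[OF cap, of a b] by simp
  have "X = ?t \<star> (s - v \<star> idn 2 - inverse v \<star> U)"
    using t_simps by (simp add: s_def scl_simps)
  from arg_cong[OF this, of "\<lambda>g. lay a g b \<odot> f"]
  have "lay a X b \<odot> f = lay a (?t \<star> (s - v \<star> idn 2 - inverse v \<star> U)) b \<odot> f" .
  moreover have "lay a (idn 2) b \<odot> f = f"
    using V_hom[OF assms] by (simp add: idn_comp)
  ultimately have "lay a X b \<odot> f = ?t \<star> (lay a s b \<odot> f - v \<star> f - inverse v \<star> (lay a U b \<odot> f))"
    by (simp only: bilinear)
  then show ?thesis using s U assms V.scl V_diff by simp
qed

lemma V_G: "G p q g \<Longrightarrow> V n (a + p + b) f \<Longrightarrow> V n (a + q + b) (lay a g b \<odot> f)"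
proof (induction arbitrary: a b f rule: G.induct)
  case (idn p)
  have "lay a (idn p) b \<odot> f = f" using V_hom[OF idn] by (simp add: idn_comp)
  then show ?case using idn by simp
next
  case cup
  then show ?case using V_cup[OF cup, of a b] by simp
next
  case cap
  then show ?case using cloD(2)[OF clo cap] by simp
next
  case X
  then show ?case by (rule V_X)
next
  case (comp r k g m h)
  have "lay a (g \<odot> h) b = lay a g b \<odot> lay a h b"
    by (rule whisker_comp[symmetric]) (rule G_hom[OF comp(1)], rule G_hom[OF comp(2)])
  then show ?case using comp by (simp only: comp_assoc)
next
  case (tens p q g p' q' h)
  have "lay a (g \<otimes> h) b = lay a ((g \<otimes> idn q') \<odot> (idn p \<otimes> h)) b"
    using tens_LR[OF G_hom[OF tens(1)] G_hom[OF tens(2)]] by simp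
  also have "\<dots> = lay a (g \<otimes> idn q') b \<odot> lay a (idn p \<otimes> h) b"
    by (rule whisker_comp[symmetric, OF hom_tens[OF G_hom[OF tens(1)] hom_idn] hom_tens[OF hom_idn G_hom[OF tens(2)]]])
  finally have *: "lay a (g \<otimes> h) b \<odot> f = lay a g (q' + b) \<odot> lay (a + p) h b \<odot> f"
    by (simp add: comp_assoc tens_assoc)
  have "V n (a + p + q' + b) (lay (a + p) h b \<odot> f)" using tens.IH(2)[of "a + p" b f] tens.prems by (simp add: add.assoc)
  then show ?case unfolding * using tens.IH(1)[of a "q' + b"] by (simp add: add.assoc)
next
  case (zero m k)
  then show ?case by (simp add: V.low Low.zero)
next
  case (add m k g h)
  then show ?case by (simp add: bilinear V.add)
next
  case (scl m k g c)
  then show ?case by (simp add: bilinear V.scl)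
qed

lemma V_idn: "V n n (idn n)"
proof (induction n)
  case 0 then show ?case by (rule V.empty)
next
  case (Suc n)
  then show ?case using V.strand[OF Suc] by simp
qed

text \<open>Counting endpoints: a normal form outside the ideal has two more outputs than inputs for
  each of its arcs. So arcs cannot occur when m is at most n, and the only candidate left is the
  identity with m = n.\<close>

lemma V_Low: "V n m f \<Longrightarrow> m \<le> n \<Longrightarrow> (m < n \<longrightarrow> Low n m f) \<and> (m = n \<longrightarrow> (\<exists>c. Low n n (f - c \<star> idn n)))"
proof (induction rule: V.induct)
  case empty
  have "Low 0 0 (idn 0 - 1 \<star> idn 0)" by (simp add: Low.zero)
  then show ?case by blast
next
  case (low n m f)
  then have "Low n m (f - 0 \<star> idn n)" by simp
  then show ?case using low by blast
next
  case (add n m f g)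
  have "\<exists>c. Low n n (f + g - c \<star> idn n)" if "Low n n (f - c \<star> idn n)" "Low n n (g - c' \<star> idn n)" for c c'
    using Low.add[OF that] by (intro exI[of _ "c + c'"]) (simp add: algebra_simps)
  then show ?case using add Low.add by blast
next
  case (scl n m f a)
  have "\<exists>c. Low n n (a \<star> f - c \<star> idn n)" if "Low n n (f - c \<star> idn n)" for c
    using Low_scl[OF that, of a] by (intro exI[of _ "a * c"]) (simp add: algebra_simps)
  then show ?case using scl Low_scl by blast
next
  case (arch n j k f m)
  have f: "Low n (j + k) f" using arch by simp
  then have 1: "Low n m (arc j k f)" unfolding arc_def
    using Low_tens[OF f hom_cup] Low_comp[of n m "f \<otimes> cup" "idn j \<otimes> cr k \<otimes> idn (Suc 0)" m]
      at_hom[OF cr_hom[OF HOL.refl HOL.refl, of k], of m j "Suc 0" m] arch.hyps by simp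
  then have "Low n m (arc j k f - 0 \<star> idn n)" by simp
  then show ?case using 1 by blast
next
  case (strand n m f)
  have l: "Low (Suc n) (Suc m) (g \<otimes> idn (Suc 0))" if "Low n m g" for g
    using Low_tens[OF that hom_idn[of "Suc 0"]] by simp
  show ?case
  proof (cases "m = n")
    case True
    then obtain c where "Low n n (f - c \<star> idn n)" using strand by auto
    then have "Low (Suc n) (Suc m) ((f - c \<star> idn n) \<otimes> idn (Suc 0))" using l True by simp
    then show ?thesis using True by (auto simp: bilinear)
  next
    case False
    then show ?thesis using strand l by simp
  qed
qed

lemma G_Low: "G n m f \<Longrightarrow> m < n \<Longrightarrow> Low n m f"
  and G_idn_Low: "G n n f \<Longrightarrow> \<exists>c. Low n n (f - c \<star> idn n)"
proof -
  \<comment> \<open>A generated morphism is the result of acting on the identity, which is a normal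
    form.\<close>
  have *: "V n m f" if "G n m f" for n m f
    using V_G[OF that, of n 0 0 "idn n"] V_idn G_hom[OF that] by (simp add: idn_comp)
  show "G n m f \<Longrightarrow> m < n \<Longrightarrow> Low n m f" using V_Low[OF *] by auto
  show "G n n f \<Longrightarrow> \<exists>c. Low n n (f - c \<star> idn n)" using V_Low[OF *[of n n f]] by auto
qed

text \<open>Here \<open>R\<close>, \<open>Q\<close> and \<open>Q'\<close> stand for the projectors
  on p + 3, p + 2 and p + 1 strands, the latter two completed by vertical strands. \<open>Q'\<close>
  commutes with layers on the last two strands, and \<open>Q\<close> absorbs \<open>Q'\<close> and
  kills layers one place to the left. Expanding the inner \<open>Q\<close> in
  \<open>Q \<odot> y \<odot> Q \<odot> z\<close> therefore leaves products of three generators on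
  three strands.\<close>

lemma jw_step:
  fixes p :: nat
  defines "e \<equiv> idn p \<otimes> (idn (Suc 0) \<otimes> U)" and "x \<equiv> idn p \<otimes> x2"
    and "e' \<equiv> idn p \<otimes> (U \<otimes> idn (Suc 0))" and "x' \<equiv> idn p \<otimes> x1"
  assumes QQ: "Q \<odot> Q = Q" and QQ': "Q \<odot> Q' = Q"
    and comm: "Q' \<odot> e = e \<odot> Q'" "Q' \<odot> x = x \<odot> Q'"
    and kill: "Q \<odot> e' = 0" "Q \<odot> x' = 0"
    and Q: "Q = Q' + a' \<star> (Q' \<odot> e' \<odot> Q') + b' \<star> (Q' \<odot> x' \<odot> Q')"
    and R: "R = Q + a \<star> (Q \<odot> e \<odot> Q) + b \<star> (Q \<odot> x \<odot> Q)"
    and coeffs: "1 + b * (- (qint 2)\<^sup>2 + b' * (qint 2)\<^sup>2) = 0"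
      "a * (a' - b' * (qint 2)\<^sup>2) + b * b' * (qint 2)\<^sup>2 = 0"
      "a * (- qd + b' * (qd - (qint 2)\<^sup>2)) + b * (qd - (qint 2)\<^sup>2 + b' * (3 * (qint 2)\<^sup>2 - qd)) = 0"
      "1 + a * (qd + a' - qd * b') + b * (- qd + b' * (qd - (qint 2)\<^sup>2)) = 0"
  shows "R \<odot> e = 0" "R \<odot> x = 0"
proof -
  let ?t = "qint 2" and ?I = "idn (Suc 0)"
  define W where "W f = idn p \<otimes> f" for f
  have W: "W f \<odot> W g = W (f \<odot> g)" if "f \<in> hom 3 3" "g \<in> hom 3 3" for f g
    unfolding W_def by (rule idn_tens_comp[OF that])
  have W3: "W f \<odot> W g \<odot> W h = W (f \<odot> g \<odot> h)" if "f \<in> hom 3 3" "g \<in> hom 3 3" "h \<in> hom 3 3" for f g h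
    using that by (simp add: W hom_comp[OF that(2,3)])
  have def: "e = W (?I \<otimes> U)" "x = W x2" "e' = W (U \<otimes> ?I)" "x' = W x1"
    by (simp_all add: e_def x_def e'_def x'_def W_def)
  have W_lin: "W (f + g) = W f + W g" "W (f - g) = W f - W g" "W (c \<star> f) = c \<star> W f" "W (- f) = - W f" for f g c
    by (simp_all add: W_def bilinear)
  note simps = strand3_rules U_tens idn1_comp[THEN comp_ext] idn_comp[where f = n1] X_triples
  have rel: "e \<odot> e = qd \<star> e" "x \<odot> e = (- qd) \<star> e" "e \<odot> x = (- qd) \<star> e"
    "x \<odot> x = (- ?t\<^sup>2) \<star> x + (qd - ?t\<^sup>2) \<star> e"
    unfolding def by (simp_all add: W hom3 flip: W_lin) (simp_all add: simps)
  have rel3: "e \<odot> e' \<odot> e = e" "e \<odot> x' \<odot> e = (- qd) \<star> e" "e \<odot> e' \<odot> x = e \<odot> x'"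
    "e \<odot> x' \<odot> x = (- ?t\<^sup>2) \<star> (e \<odot> x') + (qd - ?t\<^sup>2) \<star> e"
    "x \<odot> e' \<odot> e = x' \<odot> e" "x \<odot> x' \<odot> e = (- ?t\<^sup>2) \<star> (x' \<odot> e) + (qd - ?t\<^sup>2) \<star> e"
    "x \<odot> e' \<odot> x = x' \<odot> e \<odot> x'"
    "x \<odot> x' \<odot> x = ?t\<^sup>2 \<star> x + ?t\<^sup>2 \<star> (x' \<odot> e) + ?t\<^sup>2 \<star> (e \<odot> x') + (3 * ?t\<^sup>2 - qd) \<star> e"
    unfolding def by (simp_all only: W hom3 hom_comp[of _ 3 3 _ 3] W_lin[symmetric]) (simp_all add: simps)
  have abs: "Q \<odot> y \<odot> Q' = Q \<odot> y" if "Q' \<odot> y = y \<odot> Q'" for y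
    using that QQ' by (metis comp_assoc)
  \<comment> \<open>Of the two factors \<open>Q\<close> only the inner one is expanded; each
    \<open>Q'\<close> coming from it is absorbed by the outer \<open>Q\<close> or moved past
    \<open>z\<close> to the right end.\<close>
  have yz: "Q \<odot> y \<odot> Q \<odot> z = Q \<odot> y \<odot> z + a' \<star> (Q \<odot> (y \<odot> e' \<odot> z) \<odot> Q') + b' \<star> (Q \<odot> (y \<odot> x' \<odot> z) \<odot> Q')"
    if y: "Q' \<odot> y = y \<odot> Q'" and z: "Q' \<odot> z = z \<odot> Q'" for y z
  proof -
    have "Q \<odot> y \<odot> Q \<odot> z = (Q \<odot> y) \<odot> Q \<odot> z" by (simp add: comp_assoc)
    also have "(Q \<odot> y) \<odot> Q \<odot> z = (Q \<odot> y) \<odot> (Q' + a' \<star> (Q' \<odot> e' \<odot> Q') + b' \<star> (Q' \<odot> x' \<odot> Q')) \<odot> z"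
      by (subst (2) Q) (rule HOL.refl)
    also have "\<dots> = (Q \<odot> y \<odot> Q') \<odot> z + a' \<star> ((Q \<odot> y \<odot> Q') \<odot> e' \<odot> Q' \<odot> z) + b' \<star> ((Q \<odot> y \<odot> Q') \<odot> x' \<odot> Q' \<odot> z)"
      by (simp add: bilinear comp_assoc)
    finally show ?thesis unfolding abs[OF y] z by (simp add: comp_assoc)
  qed
  have kill': "Q \<odot> (e' \<odot> w) = 0" "Q \<odot> (x' \<odot> w) = 0" for w
    using kill[THEN comp_ext] by simp_all
  \<comment> \<open>The only term in the products with \<open>x\<close> that is not reduced to a
    multiple of \<open>Q \<odot> e\<close> or \<open>Q \<odot> x\<close>; its total coefficient has
    to vanish on its own.\<close>
  define F where "F = Q \<odot> (e \<odot> x') \<odot> Q'"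
  have ee: "Q \<odot> e \<odot> Q \<odot> e = (qd + a' - qd * b') \<star> (Q \<odot> e)"
    by (simp add: yz comm rel rel3 bilinear abs) (simp add: algebra_simps)
  have xe: "Q \<odot> x \<odot> Q \<odot> e = (- qd + b' * (qd - ?t\<^sup>2)) \<star> (Q \<odot> e)"
    by (simp add: yz comm rel rel3 bilinear abs kill' comp_assoc) (simp add: algebra_simps)
  have ex: "Q \<odot> e \<odot> Q \<odot> x = (- qd + b' * (qd - ?t\<^sup>2)) \<star> (Q \<odot> e) + (a' - b' * ?t\<^sup>2) \<star> F"
    unfolding F_def by (simp add: yz comm rel rel3 bilinear abs) (simp add: algebra_simps)
  have xx: "Q \<odot> x \<odot> Q \<odot> x = (- ?t\<^sup>2 + b' * ?t\<^sup>2) \<star> (Q \<odot> x) + (qd - ?t\<^sup>2 + b' * (3 * ?t\<^sup>2 - qd)) \<star> (Q \<odot> e) + (b' * ?t\<^sup>2) \<star> F"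
    unfolding F_def by (simp add: yz comm rel rel3 bilinear abs kill' comp_assoc) (simp add: algebra_simps)
  have "R \<odot> e = (1 + a * (qd + a' - qd * b') + b * (- qd + b' * (qd - (qint 2)\<^sup>2))) \<star> (Q \<odot> e)"
    unfolding R by (simp add: bilinear comp_assoc ee xe) (simp add: algebra_simps)
  then show "R \<odot> e = 0" unfolding coeffs by simp
  have "R \<odot> x = (1 + b * (- ?t\<^sup>2 + b' * ?t\<^sup>2)) \<star> (Q \<odot> x)
     + (a * (- qd + b' * (qd - ?t\<^sup>2)) + b * (qd - ?t\<^sup>2 + b' * (3 * ?t\<^sup>2 - qd))) \<star> (Q \<odot> e)
     + (a * (a' - b' * ?t\<^sup>2) + b * b' * ?t\<^sup>2) \<star> F"
    unfolding R by (simp add: bilinear comp_assoc ex xx) (simp add: algebra_simps)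
  then show "R \<odot> x = 0" unfolding coeffs by simp
qed

text \<open>The recursion of the theorem in an arbitrary \<open>strand_cat\<close>. The guard covers
  a single strand, where there is no pair of last strands to act on.\<close>

primrec jw :: "nat \<Rightarrow> 'a" where
  "jw 0 = idn 0"
| "jw (Suc n) = jw n \<otimes> idn (Suc 0) + (if n = 0 then 0 else
     al (Suc n) \<star> ((jw n \<otimes> idn (Suc 0)) \<odot> (idn (n - 1) \<otimes> U) \<odot> (jw n \<otimes> idn (Suc 0)))
     + be (Suc n) \<star> ((jw n \<otimes> idn (Suc 0)) \<odot> (idn (n - 1) \<otimes> X) \<odot> (jw n \<otimes> idn (Suc 0))))"

lemma jw_Suc_0: "jw (Suc 0) = idn (Suc 0)"
  by simp

lemma jw_Suc_Suc: "jw (Suc (Suc m)) = jw (Suc m) \<otimes> idn (Suc 0) +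
     al (Suc (Suc m)) \<star> ((jw (Suc m) \<otimes> idn (Suc 0)) \<odot> (idn m \<otimes> U) \<odot> (jw (Suc m) \<otimes> idn (Suc 0)))
     + be (Suc (Suc m)) \<star> ((jw (Suc m) \<otimes> idn (Suc 0)) \<odot> (idn m \<otimes> X) \<odot> (jw (Suc m) \<otimes> idn (Suc 0)))"
  by (simp del: jw.simps(2) add: jw.simps(2)[of "Suc m"])

lemma jw_hom: "jw n \<in> hom n n"
proof (induction n)
  case 0 then show ?case by (simp add: hom_idn)
next
  case (Suc n)
  show ?case
  proof (cases n)
    case 0 then show ?thesis by (simp add: hom_idn)
  next
    case n: (Suc m)
    note [typing] = hom_cast[OF Suc.IH[unfolded n]]
    show ?thesis unfolding n jw_Suc_Suc by (rule typing HOL.refl | simp del: jw.simps)+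
  qed
qed

definition jw_kills :: "nat \<Rightarrow> bool" where
  "jw_kills n \<longleftrightarrow> jw n \<odot> jw n = jw n \<and>
    (\<forall>i j. i + 2 + j = n \<longrightarrow> jw n \<odot> lay i U j = 0 \<and> jw n \<odot> lay i X j = 0)"

lemma jw_Suc_absorb:
  assumes "jw n \<odot> jw n = jw n"
  shows "jw (Suc n) \<odot> (jw n \<otimes> idn (Suc 0)) = jw (Suc n)"
proof -
  have QQ: "(jw n \<otimes> idn (Suc 0)) \<odot> (jw n \<otimes> idn (Suc 0)) = jw n \<otimes> idn (Suc 0)"
    using comp_tens_idn[OF jw_hom jw_hom, of n "Suc 0"] assms by simp
  show ?thesis
    by (cases n) (use QQ in \<open>simp_all only: jw_Suc_Suc jw_Suc_0 bilinear comp_assoc, simp_all\<close>)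
qed

text \<open>A layer avoiding the last strand is killed already by \<open>Q\<close>, which
  \<open>R\<close> absorbs; on the last two strands \<open>jw_step\<close> applies. Idempotency
  follows: in \<open>R \<odot> R\<close> with the right factor expanded, \<open>R\<close> absorbs
  each leading \<open>Q\<close> and kills the layer after it.\<close>

lemma jw_kills: "jw_kills n"
proof (induction n rule: less_induct)
  case (less n)
  consider "n = 0" | "n = 1" | m where "n = Suc (Suc m)" by (metis One_nat_def not0_implies_Suc)
  then show ?case
  proof cases
    case 1 then show ?thesis by (simp add: jw_kills_def)
  next
    case 2 then show ?thesis by (simp add: jw_kills_def)
  next
    case (3 m)
    define Q where "Q = jw (Suc m) \<otimes> idn (Suc 0)"
    define R where "R = jw (Suc (Suc m))"
    have IH: "jw (Suc m) \<odot> jw (Suc m) = jw (Suc m)"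
      "i + 2 + j = Suc m \<Longrightarrow> jw (Suc m) \<odot> lay i U j = 0" "i + 2 + j = Suc m \<Longrightarrow> jw (Suc m) \<odot> lay i X j = 0" for i j
      using less[of "Suc m"] 3 by (auto simp: jw_kills_def)
    have R: "R = Q + al (Suc (Suc m)) \<star> (Q \<odot> (idn m \<otimes> U) \<odot> Q) + be (Suc (Suc m)) \<star> (Q \<odot> (idn m \<otimes> X) \<odot> Q)"
      unfolding R_def Q_def by (rule jw_Suc_Suc)
    have QQ: "Q \<odot> Q = Q"
      using comp_tens_idn[OF jw_hom jw_hom, of "Suc m" "Suc 0"] IH(1) by (simp only: Q_def)
    have RQ: "R \<odot> Q = R" unfolding R_def Q_def by (rule jw_Suc_absorb[OF IH(1)])
    have Q_lay: "Q \<odot> lay i f (Suc j) = (jw (Suc m) \<odot> lay i f j) \<otimes> idn (Suc 0)" if "i + 2 + j = Suc m" "f \<in> hom 2 2" for i j f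
    proof -
      have "lay i f j \<in> hom (Suc m) (Suc m)" using at_hom[OF that(2), of "Suc m" i j] that(1) by simp
      from comp_tens_idn[OF jw_hom this, of "Suc 0"] show ?thesis by (simp add: Q_def tens_assoc)
    qed
    have hU: "U \<in> hom 2 2" by (rule hom_comp[OF hom_cup hom_cap])
    have Re: "R \<odot> (idn m \<otimes> U) = 0 \<and> R \<odot> (idn m \<otimes> X) = 0"
    proof (cases m)
      \<comment> \<open>On two strands there is no smaller projector \<open>Q'\<close>. The
        identities for n = 1 serve here, where \<open>al\<close> and \<open>be\<close>
        vanish.\<close>
      case 0
      have Q0: "Q = idn 2" by (simp add: Q_def 0 numeral_2_eq_2)
      have c: "1 + al 2 * qd - be 2 * qd = 0" "1 - be 2 * (qint 2)\<^sup>2 = 0" "- al 2 * qd + be 2 * (qd - (qint 2)\<^sup>2) = 0"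
        using jw_coeffs[of "Suc 0"] al_1 be_1 by (simp_all add: numeral_2_eq_2)
      have R0: "R = idn 2 + al 2 \<star> U + be 2 \<star> X"
        unfolding R Q0 by (simp add: 0 cap_U cap_idn numeral_2_eq_2[symmetric])
      have "R \<odot> U = (1 + al 2 * qd - be 2 * qd) \<star> U"
        unfolding R0 by (simp add: bilinear cap_U cap_idn scl_simps) (simp add: algebra_simps)
      moreover have "R \<odot> X = (1 - be 2 * (qint 2)\<^sup>2) \<star> X + (- al 2 * qd + be 2 * (qd - (qint 2)\<^sup>2)) \<star> U"
        unfolding R0 by (simp add: bilinear cap_U cap_idn scl_simps X_X) (simp add: algebra_simps)
      ultimately show ?thesis unfolding c by (simp add: 0)
    next
      case (Suc p)
      define Q' where "Q' = jw m \<otimes> idn 2"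
      have IH': "jw m \<odot> jw m = jw m" using less[of m] 3 by (auto simp: jw_kills_def)
      have Q'': "(jw m \<otimes> idn (Suc 0)) \<otimes> idn (Suc 0) = Q'" by (simp add: Q'_def tens_assoc numeral_2_eq_2)
      have jI: "jw m \<otimes> idn (Suc 0) \<in> hom (Suc m) (Suc m)" using hom_tens[OF jw_hom hom_idn, of m "Suc 0"] by simp
      have QQ': "Q \<odot> Q' = Q"
        unfolding Q_def Q''[symmetric] comp_tens_idn[OF jw_hom jI] jw_Suc_absorb[OF IH'] ..
      have comm: "Q' \<odot> (idn m \<otimes> f) = (idn m \<otimes> f) \<odot> Q'" if "f \<in> hom 2 2" for f
        unfolding Q'_def by (simp only: tens_LR[OF jw_hom that] tens_RL[OF jw_hom that])
      have mid: "((jw m \<otimes> idn (Suc 0)) \<odot> (idn p \<otimes> f) \<odot> (jw m \<otimes> idn (Suc 0))) \<otimes> idn (Suc 0) =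
         Q' \<odot> (idn p \<otimes> (f \<otimes> idn (Suc 0))) \<odot> Q'" if "f \<in> hom 2 2" for f
      proof -
        have f: "idn p \<otimes> f \<in> hom (Suc m) (Suc m)" using hom_tens[OF hom_idn that, of p] Suc by simp
        show ?thesis
          unfolding Q''[symmetric] comp_tens_idn[OF jI hom_comp[OF f jI], symmetric] comp_tens_idn[OF f jI, symmetric]
          by (simp only: tens_assoc)
      qed
      have Q: "Q = Q' + al m' \<star> (Q' \<odot> (idn p \<otimes> (U \<otimes> idn (Suc 0))) \<odot> Q') + be m' \<star> (Q' \<odot> (idn p \<otimes> (X \<otimes> idn (Suc 0))) \<odot> Q')"
        if "m' = Suc m" for m'
        unfolding mid[OF hU, symmetric] mid[OF hom_X, symmetric]
        unfolding Q_def Q''[symmetric] that jw_Suc_Suc[of p, folded Suc] by (simp only: bilinear)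
      have kill: "Q \<odot> (idn p \<otimes> (U \<otimes> idn (Suc 0))) = 0" "Q \<odot> (idn p \<otimes> (X \<otimes> idn (Suc 0))) = 0"
        using Q_lay[OF _ hU, of p 0] Q_lay[OF _ hom_X, of p 0] IH(2,3)[of p 0] Suc by simp_all
      have idn: "idn p \<otimes> (idn (Suc 0) \<otimes> f) = idn m \<otimes> f" for f using Suc by simp
      show ?thesis
        using jw_step[OF QQ QQ', of p, unfolded idn, OF comm[OF hU] comm[OF hom_X] kill Q[OF HOL.refl] R]
          jw_coeffs[of "Suc m"] by simp
    qed
    have kills: "R \<odot> lay i f j = 0" if "i + 2 + j = n" "f = U \<or> f = X" for i j f
    proof (cases j)
      case 0
      then show ?thesis using Re that 3 by auto
    next
      case (Suc j')
      then have "Q \<odot> lay i f j = 0" using Q_lay[of i j' f] IH(2,3)[of i j'] that 3 hU hom_X by auto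
      then show ?thesis using RQ by (metis comp_assoc zero_simps(2))
    qed
    have "R \<odot> R = R \<odot> Q + al (Suc (Suc m)) \<star> ((R \<odot> Q) \<odot> (idn m \<otimes> U) \<odot> Q) + be (Suc (Suc m)) \<star> ((R \<odot> Q) \<odot> (idn m \<otimes> X) \<odot> Q)"
      by (subst (2) R) (simp only: bilinear comp_assoc)
    also have "\<dots> = R" using Re[THEN conjunct1, THEN comp_ext] Re[THEN conjunct2, THEN comp_ext] by (simp add: RQ)
    finally show ?thesis using kills 3 unfolding jw_kills_def R_def by auto
  qed
qed

lemma qd_nonzero: "qd \<noteq> 0"
  using qint_nonzero[of 6] qint_nonzero[of 2] qint_nonzero[of 3] by (simp add: qd_def)

lemma jw_idem: "jw n \<odot> jw n = jw n"
  using jw_kills by (simp add: jw_kills_def)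

lemma jw_X: "i + 2 + j = n \<Longrightarrow> jw n \<odot> lay i X j = 0"
  using jw_kills by (simp add: jw_kills_def)

text \<open>As the loop value is nonzero, a cup is a multiple of \<open>U\<close> composed with that
  cup.\<close>

lemma jw_cup: "i + 2 + j = n \<Longrightarrow> jw n \<odot> lay i cup j = 0"
proof -
  assume n: "i + 2 + j = n"
  have "lay i U j \<odot> lay i cup j = qd \<star> lay i cup j"
    using whisker_comp[OF hom_comp[OF hom_cup hom_cap] hom_cup, of i j] by (simp add: cap_U bilinear)
  then have "qd \<star> (jw n \<odot> lay i cup j) = (jw n \<odot> lay i U j) \<odot> lay i cup j"
    by (simp add: comp_assoc bilinear)
  also have "\<dots> = 0" using jw_kills n by (simp add: jw_kills_def)
  finally show ?thesis using qd_nonzero by simp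
qed

text \<open>Every correction term of the recursion passes through a layer \<open>U\<close> or
  \<open>X\<close>. This congruence is the source both of nonvanishing and of uniqueness.\<close>

lemma jw_Low: "Low n n (jw n - idn n)"
proof (induction n)
  case 0 then show ?case by (simp add: Low.zero)
next
  case (Suc n)
  show ?case
  proof (cases n)
    case 0 then show ?thesis by (simp add: Low.zero)
  next
    case (Suc m)
    let ?Q = "jw n \<otimes> idn (Suc 0)"
    have Q: "?Q \<in> hom (Suc n) (Suc n)" using hom_tens[OF jw_hom hom_idn, of n "Suc 0"] by simp
    have l: "Low (Suc n) (Suc n) (?Q - idn (Suc n))"
      using Low_tens[OF Suc.IH hom_idn[of "Suc 0"]] by (simp add: bilinear)
    have step: "Low (Suc n) (Suc n) (g \<odot> ?Q)" if "Low (Suc n) (Suc n) g" for g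
    proof -
      have "g \<odot> ?Q = g + g \<odot> (?Q - idn (Suc n))" using Low_hom[OF that] by (simp add: bilinear idn_comp)
      then show ?thesis using Low.add[OF that Low_comp[OF l Low_hom[OF that]]] by simp
    qed
    have U: "Low (Suc n) (Suc n) (idn m \<otimes> U)"
    proof -
      have "idn m \<otimes> cup \<in> hom (m + 0) (Suc n)" using hom_tens[OF hom_idn hom_cup, of m] Suc by simp
      from Low.cap[OF this, of "Suc n"] show ?thesis using idn_tens_comp[OF hom_cup hom_cap, of m] Suc by simp
    qed
    have X: "Low (Suc n) (Suc n) (idn m \<otimes> X)"
      using Low.X[OF hom_idn, of "Suc n" m 0] Suc hom_tens[OF hom_idn hom_X, of m] by (simp add: idn_comp)
    have "jw (Suc n) - idn (Suc n) = (?Q - idn (Suc n)) + al (Suc n) \<star> (?Q \<odot> (idn m \<otimes> U) \<odot> ?Q) + be (Suc n) \<star> (?Q \<odot> (idn m \<otimes> X) \<odot> ?Q)"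
      unfolding Suc jw_Suc_Suc by (simp only: algebra_simps)
    moreover have "Low (Suc n) (Suc n) (?Q \<odot> (idn m \<otimes> U) \<odot> ?Q)" "Low (Suc n) (Suc n) (?Q \<odot> (idn m \<otimes> X) \<odot> ?Q)"
      using Low_comp[OF step[OF U] Q] Low_comp[OF step[OF X] Q] by simp_all
    ultimately show ?thesis using l by (simp only: Low.add Low_scl)
  qed
qed

end

text \<open>Reading diagrams upside down exchanges cup and cap and preserves the axioms. It turns
  each result on annihilation from one side into the result for the other side.\<close>

lemma (in strand_cat) opposite:
  "strand_cat (\<lambda>m n. hom n m) scl (\<lambda>f g. g \<odot> f) tens idn cap cup X"
proof -
  have mono: "monoidal_cat (\<lambda>m n. hom n m) scl (\<lambda>f g. g \<odot> f) tens idn"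
    by unfold_locales
      (auto simp: hom_zero hom_add hom_scl hom_comp hom_tens hom_idn comp_assoc tens_assoc bilinear
        idn_comp_left idn_comp_right interchange)
  have pre: "strand_cat_pre (\<lambda>m n. hom n m) scl (\<lambda>f g. g \<odot> f) tens idn cap cup X"
    by (rule strand_cat_pre.intro[OF mono], unfold_locales)
      (simp_all add: hom_cup hom_cap hom_X loop snake X_rot_cup X_rot_cap X_cup cap_X X_X)
  show ?thesis
    by (rule strand_cat.intro[OF pre], unfold_locales)
      (simp_all add: comp_assoc X_triple X_triple')
qed

text \<open>The web relations expressed on single strands: \<open>X + cup \<odot> cap\<close> is the
  web \<open>I\<close>, a merge followed by a split, so each relation that mentions double strands
  can be written with it.\<close>

locale web_cat = monoidal_cat hom scl comp tens idn
  for hom :: "nat \<Rightarrow> nat \<Rightarrow> 'a::ab_group_add set"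
    and scl :: "K \<Rightarrow> 'a \<Rightarrow> 'a" (infixr "\<star>" 75)
    and comp :: "'a \<Rightarrow> 'a \<Rightarrow> 'a" (infixr "\<odot>" 70)
    and tens :: "'a \<Rightarrow> 'a \<Rightarrow> 'a" (infixr "\<otimes>" 72)
    and idn :: "nat \<Rightarrow> 'a" +
  fixes cup cap X :: 'a
  assumes hom_cup: "cup \<in> hom 0 2" and hom_cap: "cap \<in> hom 2 0" and hom_X: "X \<in> hom 2 2"
    and loop: "cap \<odot> cup = qd \<star> idn 0"
    and snake: "(cap \<otimes> idn (Suc 0)) \<odot> (idn (Suc 0) \<otimes> cup) = idn (Suc 0)"
      "(idn (Suc 0) \<otimes> cap) \<odot> (cup \<otimes> idn (Suc 0)) = idn (Suc 0)"
    and rotation: "(idn 2 \<otimes> cap) \<odot> (idn (Suc 0) \<otimes> X \<otimes> idn (Suc 0)) \<odot> (cup \<otimes> idn 2) = X"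
    and lollipop: "cap \<odot> (X + cup \<odot> cap) = 0"
    and bigon: "(X + cup \<odot> cap) \<odot> (X + cup \<odot> cap) = (- (qint 2)\<^sup>2) \<star> (X + cup \<odot> cap)"
    and triangle: "((X + cup \<odot> cap) \<otimes> (X + cup \<odot> cap)) \<odot> (idn (Suc 0) \<otimes> cup \<otimes> idn (Suc 0)) \<odot> (X + cup \<odot> cap) = 0"
begin

section \<open>Crossing relations derived from the web relations\<close>

abbreviation I where "I \<equiv> idn (Suc 0)"

lemma gen_hom [typing]:
  "m = 0 \<Longrightarrow> n = 2 \<Longrightarrow> cup \<in> hom m n"
  "m = 2 \<Longrightarrow> n = 0 \<Longrightarrow> cap \<in> hom m n"
  "m = 2 \<Longrightarrow> n = 2 \<Longrightarrow> X \<in> hom m n"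
  using hom_cup hom_cap hom_X by auto

lemma cap_X: "cap \<odot> X = (- qd) \<star> cap"
proof -
  have "cap \<odot> (cup \<odot> cap) = qd \<star> cap"
    using idn_comp_left[OF hom_cap] by (simp add: loop comp_ext[OF loop] bilinear)
  then show ?thesis using lollipop by (simp add: bilinear eq_neg_iff_add_eq_0)
qed

lemma whisker_snake:
  "(idn 2 \<otimes> (cap \<otimes> I)) \<odot> (idn 3 \<otimes> cup) = idn 3"
  "(cap \<otimes> idn 3) \<odot> (I \<otimes> cup \<otimes> idn 2) = idn 3"
  "(idn 2 \<otimes> (cap \<otimes> I)) \<odot> ((I \<otimes> cup) \<otimes> idn 2) = idn 3"
  "((I \<otimes> cap) \<otimes> idn 2) \<odot> (idn 2 \<otimes> (cup \<otimes> I)) = idn 3"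
proof -
  have "(idn 2 \<otimes> (cap \<otimes> I)) \<odot> (idn 2 \<otimes> (I \<otimes> cup)) = idn 2 \<otimes> I"
    by (subst idn_tens_comp, (rule typing HOL.refl | simp)+) (simp add: snake)
  then show "(idn 2 \<otimes> (cap \<otimes> I)) \<odot> (idn 3 \<otimes> cup) = idn 3" by (simp add: numeral_2_eq_2 numeral_3_eq_3)
  have "((cap \<otimes> I) \<otimes> idn 2) \<odot> ((I \<otimes> cup) \<otimes> idn 2) = I \<otimes> idn 2"
    by (subst comp_tens_idn, (rule typing HOL.refl | simp)+) (simp add: snake)
  then show "(cap \<otimes> idn 3) \<odot> (I \<otimes> cup \<otimes> idn 2) = idn 3"
    by (simp add: tens_assoc numeral_2_eq_2 numeral_3_eq_3)
  have "(I \<otimes> (I \<otimes> cap) \<otimes> I) \<odot> (I \<otimes> (cup \<otimes> I) \<otimes> I) = idn 3"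
    by (subst whisker_comp, (rule typing HOL.refl | simp)+) (simp add: snake numeral_3_eq_3)
  then show "(idn 2 \<otimes> (cap \<otimes> I)) \<odot> ((I \<otimes> cup) \<otimes> idn 2) = idn 3"
    by (simp add: tens_assoc numeral_2_eq_2)
  have "(I \<otimes> (cap \<otimes> I) \<otimes> I) \<odot> (I \<otimes> (I \<otimes> cup) \<otimes> I) = idn 3"
    by (subst whisker_comp, (rule typing HOL.refl | simp)+) (simp add: snake numeral_3_eq_3)
  then show "((I \<otimes> cap) \<otimes> idn 2) \<odot> (idn 2 \<otimes> (cup \<otimes> I)) = idn 3"
    by (simp add: tens_assoc numeral_2_eq_2)
qed

text \<open>\<open>X\<close> is replaced by its quarter turn, and the surplus bend is straightened.
  Moving one leg at a time is the form in which rotation invariance is used later.\<close>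

lemma X_rot_cup: "(I \<otimes> X) \<odot> (cup \<otimes> I) = (X \<otimes> I) \<odot> (I \<otimes> cup)"
proof -
  have h: "I \<otimes> X \<otimes> I \<in> hom 4 4" "cup \<otimes> idn 2 \<in> hom 2 4" "idn 2 \<otimes> cap \<in> hom 4 2"
    by ((rule typing HOL.refl | simp)+)
  have 1: "X \<otimes> I = ((idn 2 \<otimes> cap) \<otimes> I) \<odot> ((I \<otimes> X \<otimes> I) \<otimes> I) \<odot> ((cup \<otimes> idn 2) \<otimes> I)"
    by (subst rotation[symmetric]) (simp only: comp_tens_idn[OF h(1,2)] comp_tens_idn[OF h(3) hom_comp[OF h(1,2)]])
  have 2: "(cup \<otimes> idn 3) \<odot> (I \<otimes> cup) = (idn 3 \<otimes> cup) \<odot> (cup \<otimes> I)"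
  proof -
    have "(cup \<otimes> idn 3) \<odot> (I \<otimes> cup) = cup \<otimes> (I \<otimes> cup)"
      using tens_LR[of cup 0 2 "I \<otimes> cup" "Suc 0" 3] hom_cup tens_hom[OF hom_idn hom_cup, of "Suc 0" "Suc 0" 3] by simp
    also have "\<dots> = (cup \<otimes> I) \<otimes> cup" by (simp add: tens_assoc)
    also have "\<dots> = (idn 3 \<otimes> cup) \<odot> (cup \<otimes> I)"
      using tens_RL[of "cup \<otimes> I" "Suc 0" 3 cup 0 2] hom_cup tens_hom[OF hom_cup hom_idn, of "Suc 0" "Suc 0" 3] by simp
    finally show ?thesis .
  qed
  have 3: "((I \<otimes> X) \<otimes> idn 2) \<odot> (idn 3 \<otimes> cup) = (idn 3 \<otimes> cup) \<odot> (I \<otimes> X)"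
    using tens_LR[of "I \<otimes> X" 3 3 cup 0 2] tens_RL[of "I \<otimes> X" 3 3 cup 0 2] hom_cup tens_hom[OF hom_idn hom_X, of 3 "Suc 0" 3] by simp
  have "(X \<otimes> I) \<odot> (I \<otimes> cup) = (idn 2 \<otimes> (cap \<otimes> I)) \<odot> ((I \<otimes> X) \<otimes> idn 2) \<odot> (cup \<otimes> idn 3) \<odot> (I \<otimes> cup)"
    by (subst 1) (simp add: comp_assoc tens_assoc numeral_2_eq_2 numeral_3_eq_3)
  also have "\<dots> = ((idn 2 \<otimes> (cap \<otimes> I)) \<odot> (idn 3 \<otimes> cup)) \<odot> (I \<otimes> X) \<odot> (cup \<otimes> I)"
    unfolding 2 using 3[THEN comp_ext] by (simp add: comp_assoc)
  also have "\<dots> = (I \<otimes> X) \<odot> (cup \<otimes> I)"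
    unfolding whisker_snake by (rule idn_comp_left, (rule typing HOL.refl | simp)+)
  finally show ?thesis ..
qed

lemma X_rot_cap: "(I \<otimes> cap) \<odot> (X \<otimes> I) = (cap \<otimes> I) \<odot> (I \<otimes> X)"
proof -
  have h: "I \<otimes> X \<otimes> I \<in> hom 4 4" "cup \<otimes> idn 2 \<in> hom 2 4" "idn 2 \<otimes> cap \<in> hom 4 2"
    by ((rule typing HOL.refl | simp)+)
  have 1: "I \<otimes> X = (I \<otimes> (idn 2 \<otimes> cap)) \<odot> (I \<otimes> (I \<otimes> X \<otimes> I)) \<odot> (I \<otimes> (cup \<otimes> idn 2))"
    by (subst rotation[symmetric]) (simp only: idn_tens_comp[OF h(1,2)] idn_tens_comp[OF h(3) hom_comp[OF h(1,2)]])
  have 2: "(cap \<otimes> I) \<odot> (idn 3 \<otimes> cap) = (I \<otimes> cap) \<odot> (cap \<otimes> idn 3)"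
    using tens_RL[of cap 2 0 "I \<otimes> cap" 3 "Suc 0"] tens_LR[of "cap \<otimes> I" 3 "Suc 0" cap 2 0] hom_cap
      tens_hom[OF hom_idn hom_cap, of 3 "Suc 0" "Suc 0"] tens_hom[OF hom_cap hom_idn, of 3 "Suc 0" "Suc 0"]
    by (simp add: tens_assoc)
  have 3: "(cap \<otimes> idn 3) \<odot> (idn 2 \<otimes> (X \<otimes> I)) = (X \<otimes> I) \<odot> (cap \<otimes> idn 3)"
  proof -
    have h: "X \<otimes> I \<in> hom 3 3" by (rule typing HOL.refl | simp)+
    show ?thesis using tens_RL[OF hom_cap h] tens_LR[OF hom_cap h] by (simp only: idn_0_left)
  qed
  have "(cap \<otimes> I) \<odot> (I \<otimes> X) = ((cap \<otimes> I) \<odot> (idn 3 \<otimes> cap)) \<odot> (idn 2 \<otimes> (X \<otimes> I)) \<odot> (I \<otimes> cup \<otimes> idn 2)"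
    by (subst 1) (simp add: comp_assoc tens_assoc numeral_2_eq_2 numeral_3_eq_3)
  also have "\<dots> = (I \<otimes> cap) \<odot> (X \<otimes> I) \<odot> (cap \<otimes> idn 3) \<odot> (I \<otimes> cup \<otimes> idn 2)"
    unfolding 2 using 3[THEN comp_ext] by (simp add: comp_assoc)
  also have "\<dots> = (I \<otimes> cap) \<odot> (X \<otimes> I)"
    unfolding whisker_snake by (subst idn_comp_right[of "X \<otimes> I" 3], (rule typing HOL.refl | simp)+)
  finally show ?thesis ..
qed

text \<open>Rotation carries the curl from below the crossing to above it, where
  \<open>cap_X\<close> evaluates it.\<close>

lemma X_cup: "X \<odot> cup = (- qd) \<star> cup"
proof -
  have 1: "(cup \<otimes> idn 2) \<odot> cup = (idn 2 \<otimes> cup) \<odot> cup"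
    using tens_LR[OF hom_cup hom_cup] tens_RL[OF hom_cup hom_cup] by simp
  have 2: "(I \<otimes> (I \<otimes> cap)) \<odot> (I \<otimes> (X \<otimes> I)) \<odot> (I \<otimes> (I \<otimes> cup)) = (- qd) \<star> idn 2"
  proof -
    have h: "I \<otimes> cap \<in> hom 3 (Suc 0)" "I \<otimes> X \<in> hom 3 3" "X \<otimes> I \<in> hom 3 3" "I \<otimes> cup \<in> hom (Suc 0) 3" "cup \<otimes> I \<in> hom (Suc 0) 3"
      by ((rule typing HOL.refl | simp)+)
    have "(I \<otimes> (I \<otimes> cap)) \<odot> (I \<otimes> (X \<otimes> I)) \<odot> (I \<otimes> (I \<otimes> cup)) = I \<otimes> ((I \<otimes> cap) \<odot> (X \<otimes> I) \<odot> (I \<otimes> cup))"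
      by (simp only: idn_tens_comp[OF h(3,4)] idn_tens_comp[OF h(1) hom_comp[OF h(3,4)]])
    also have "(I \<otimes> cap) \<odot> (X \<otimes> I) \<odot> (I \<otimes> cup) = ((I \<otimes> cap) \<odot> (I \<otimes> X)) \<odot> (cup \<otimes> I)"
      by (simp add: X_rot_cup comp_assoc)
    also have "(I \<otimes> cap) \<odot> (I \<otimes> X) = I \<otimes> (cap \<odot> X)" by (rule idn_tens_comp[OF hom_cap hom_X])
    also have "\<dots> \<odot> (cup \<otimes> I) = (- qd) \<star> I" by (simp add: cap_X bilinear snake)
    finally show ?thesis by (simp add: bilinear numeral_2_eq_2)
  qed
  have "X \<odot> cup = (idn 2 \<otimes> cap) \<odot> (I \<otimes> X \<otimes> I) \<odot> (cup \<otimes> idn 2) \<odot> cup"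
    by (subst rotation[symmetric]) (simp add: comp_assoc)
  also have "\<dots> = ((I \<otimes> (I \<otimes> cap)) \<odot> (I \<otimes> (X \<otimes> I)) \<odot> (I \<otimes> (I \<otimes> cup))) \<odot> cup"
    unfolding 1 by (simp add: comp_assoc numeral_2_eq_2)
  also have "\<dots> = (- qd) \<star> cup" unfolding 2 using idn_comp_left[OF hom_cup] by (simp add: bilinear)
  finally show ?thesis .
qed

lemma X_X: "X \<odot> X = (- (qint 2)\<^sup>2) \<star> X + (qd - (qint 2)\<^sup>2) \<star> (cup \<odot> cap)"
proof -
  have 1: "(cup \<odot> cap) \<odot> (cup \<odot> cap) = qd \<star> (cup \<odot> cap)"
    using idn_comp_left[OF hom_cap] by (simp add: comp_ext[OF loop] bilinear comp_assoc)
  have 2: "X \<odot> (cup \<odot> cap) = (- qd) \<star> (cup \<odot> cap)" "(cup \<odot> cap) \<odot> X = (- qd) \<star> (cup \<odot> cap)"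
    by (simp_all add: X_cup[THEN comp_ext] cap_X comp_assoc bilinear)
  have "X \<odot> X + X \<odot> (cup \<odot> cap) + ((cup \<odot> cap) \<odot> X + (cup \<odot> cap) \<odot> (cup \<odot> cap)) = (- (qint 2)\<^sup>2) \<star> (X + cup \<odot> cap)"
    unfolding bigon[symmetric] by (simp only: comp_add_left comp_add_right add_ac)
  then have "X \<odot> X = (- (qint 2)\<^sup>2) \<star> (X + cup \<odot> cap) + qd \<star> (cup \<odot> cap)"
    unfolding 1 2 by (simp add: algebra_simps)
  then show ?thesis by (simp only: vs.scale_right_distrib vs.scale_left_diff_distrib vs.scale_minus_left) simp
qed

sublocale strand_cat_pre hom scl comp tens idn cup cap X
  by unfold_locales (fact hom_cup hom_cap hom_X loop snake X_rot_cup X_rot_cap X_cup cap_X X_X)+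

abbreviation H where "H \<equiv> X + cup \<odot> cap"

lemma H_hom: "H \<in> hom 2 2"
  by (rule typing HOL.refl | simp)+

lemma idn_merge: "idn 2 \<otimes> (I \<otimes> f) = idn 3 \<otimes> f" "I \<otimes> idn 2 = idn 3" "idn 2 \<otimes> I = idn 3" "I \<otimes> I = idn 2"
  "I \<otimes> (I \<otimes> f) = idn 2 \<otimes> f"
  by (simp_all add: numeral_2_eq_2 numeral_3_eq_3)

lemma idn3_simps: "idn 3 \<odot> n1 = n1" "idn 3 \<odot> n2 = n2" "idn 3 \<odot> x1 = x1" "idn 3 \<odot> x2 = x2"
  "u1 \<odot> idn 3 = u1" "u2 \<odot> idn 3 = u2"
  by (rule idn_comp_left idn_comp_right, (rule typing HOL.refl | simp)+)+

text \<open>The triangle relation with its rightmost upper leg bent down. Bending turns one factor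
  \<open>H\<close> by a quarter, which makes it \<open>X + idn 2\<close>, the web \<open>J\<close>,
  and so places three factors on alternating pairs of strands.\<close>

lemma hexagon: "(H \<otimes> I) \<odot> (I \<otimes> (X + idn 2)) \<odot> (H \<otimes> I) = 0"
proof -
  let ?Z = "X + idn 2"
  have Z: "?Z \<in> hom 2 2" by (rule typing HOL.refl | simp)+
  note [typing] = hom_cast[OF H_hom] hom_cast[OF Z]
  have a: "(H \<otimes> H) \<odot> (I \<otimes> cup \<otimes> I) \<in> hom 2 4" "I \<otimes> cup \<otimes> I \<in> hom 2 4" "H \<otimes> H \<in> hom 4 4"
     "(I \<otimes> cup \<otimes> I) \<odot> H \<in> hom 2 4"
    by ((rule typing HOL.refl | simp)+)
  have 1: "(((H \<otimes> H) \<odot> (I \<otimes> cup \<otimes> I) \<odot> H) \<otimes> I) = (H \<otimes> (H \<otimes> I)) \<odot> ((I \<otimes> cup) \<otimes> idn 2) \<odot> (H \<otimes> I)"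
    using comp_tens_idn[OF a(3,4), of "Suc 0"] comp_tens_idn[OF a(2) H_hom, of "Suc 0"] by (simp only: tens_assoc idn_merge)
  have 2: "(idn 3 \<otimes> cap) \<odot> (H \<otimes> (H \<otimes> I)) = (H \<otimes> u1) \<odot> (idn 3 \<otimes> ?Z)"
  proof -
    have "(idn 2 \<otimes> u2) \<odot> (H \<otimes> (H \<otimes> I)) = H \<otimes> (u2 \<odot> (H \<otimes> I))"
      by (rule idn_tens_slide(1), (rule typing HOL.refl | simp)+)
    then have "(idn 3 \<otimes> cap) \<odot> (H \<otimes> (H \<otimes> I)) = H \<otimes> (u2 \<odot> (H \<otimes> I))"
      by (simp only: idn_merge)
    also have "u2 \<odot> (H \<otimes> I) = u1 \<odot> (I \<otimes> ?Z)"
    proof -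
      have "u2 \<odot> (H \<otimes> I) = u2 \<odot> x1 + (u2 \<odot> n1) \<odot> u1" by (simp only: bilinear U_tens comp_assoc)
      also have "\<dots> = u1 \<odot> x2 + u1 \<odot> idn 3" by (simp only: strand3 idn1_comp idn3_simps)
      also have "\<dots> = u1 \<odot> (I \<otimes> ?Z)" by (simp only: bilinear idn_merge)
      finally show ?thesis .
    qed
    also have "H \<otimes> (u1 \<odot> (I \<otimes> ?Z)) = (H \<otimes> u1) \<odot> (idn 2 \<otimes> (I \<otimes> ?Z))"
      by (rule idn_tens_slide(2)[symmetric], (rule typing HOL.refl | simp)+)
    finally show ?thesis by (simp only: idn_merge)
  qed
  have 3: "(idn 3 \<otimes> ?Z) \<odot> ((I \<otimes> cup) \<otimes> idn 2) = ((I \<otimes> cup) \<otimes> idn 2) \<odot> (I \<otimes> ?Z)"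
  proof -
    have h: "I \<otimes> cup \<in> hom (Suc 0) 3" by (rule typing HOL.refl | simp)+
    show ?thesis by (simp only: tens_RL[OF h Z] tens_LR[OF h Z])
  qed
  have 4: "(H \<otimes> u1) \<odot> ((I \<otimes> cup) \<otimes> idn 2) = H \<otimes> I"
  proof -
    have "H \<otimes> u1 = (H \<otimes> I) \<odot> (idn 2 \<otimes> u1)"
      by (rule tens_LR[symmetric], (rule typing HOL.refl | simp)+)
    then have "(H \<otimes> u1) \<odot> ((I \<otimes> cup) \<otimes> idn 2) = (H \<otimes> I) \<odot> idn 3"
      using whisker_snake(3) by (simp add: comp_assoc)
    also have "\<dots> = H \<otimes> I" by (rule idn_comp_right, (rule typing HOL.refl | simp)+)
    finally show ?thesis .
  qed
  have "0 = (idn 3 \<otimes> cap) \<odot> (((H \<otimes> H) \<odot> (I \<otimes> cup \<otimes> I) \<odot> H) \<otimes> I)" using triangle by simp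
  also have "\<dots> = ((idn 3 \<otimes> cap) \<odot> (H \<otimes> (H \<otimes> I))) \<odot> ((I \<otimes> cup) \<otimes> idn 2) \<odot> (H \<otimes> I)"
    unfolding 1 by (simp only: comp_assoc)
  also have "\<dots> = (H \<otimes> u1) \<odot> ((idn 3 \<otimes> ?Z) \<odot> ((I \<otimes> cup) \<otimes> idn 2)) \<odot> (H \<otimes> I)"
    unfolding 2 by (simp only: comp_assoc)
  also have "\<dots> = ((H \<otimes> u1) \<odot> ((I \<otimes> cup) \<otimes> idn 2)) \<odot> (I \<otimes> ?Z) \<odot> (H \<otimes> I)"
    unfolding 3 by (simp only: comp_assoc)
  finally show ?thesis unfolding 4 ..
qed

text \<open>The same with the leftmost upper leg bent down.\<close>

lemma hexagon': "(I \<otimes> H) \<odot> ((X + idn 2) \<otimes> I) \<odot> (I \<otimes> H) = 0"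
proof -
  let ?Z = "X + idn 2"
  have Z: "?Z \<in> hom 2 2" by (rule typing HOL.refl | simp)+
  note [typing] = hom_cast[OF H_hom] hom_cast[OF Z]
  have a: "I \<otimes> cup \<otimes> I \<in> hom 2 4" "H \<otimes> H \<in> hom 4 4"
     "(I \<otimes> cup \<otimes> I) \<odot> H \<in> hom 2 4"
    by ((rule typing HOL.refl | simp)+)
  have 1: "(I \<otimes> ((H \<otimes> H) \<odot> (I \<otimes> cup \<otimes> I) \<odot> H)) = ((I \<otimes> H) \<otimes> H) \<odot> (idn 2 \<otimes> (cup \<otimes> I)) \<odot> (I \<otimes> H)"
    using idn_tens_comp[OF a(2,3), of "Suc 0"] idn_tens_comp[OF a(1) H_hom, of "Suc 0"] by (simp only: tens_assoc idn_merge)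
  have 2: "(cap \<otimes> idn 3) \<odot> ((I \<otimes> H) \<otimes> H) = (u2 \<otimes> H) \<odot> (?Z \<otimes> idn 3)"
  proof -
    have "(u1 \<otimes> idn 2) \<odot> ((I \<otimes> H) \<otimes> H) = (u1 \<odot> (I \<otimes> H)) \<otimes> H"
      by (rule idn_tens_slide(3), (rule typing HOL.refl | simp)+)
    then have "(cap \<otimes> idn 3) \<odot> ((I \<otimes> H) \<otimes> H) = (u1 \<odot> (I \<otimes> H)) \<otimes> H"
      by (simp only: tens_assoc idn_merge)
    also have "u1 \<odot> (I \<otimes> H) = u2 \<odot> (?Z \<otimes> I)"
    proof -
      have "u1 \<odot> (I \<otimes> H) = u1 \<odot> x2 + (u1 \<odot> n2) \<odot> u2" by (simp only: bilinear U_tens comp_assoc)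
      also have "\<dots> = u2 \<odot> x1 + u2 \<odot> idn 3" by (simp only: strand3 idn1_comp idn3_simps)
      also have "\<dots> = u2 \<odot> (?Z \<otimes> I)" by (simp only: bilinear idn_merge)
      finally show ?thesis .
    qed
    also have "(u2 \<odot> (?Z \<otimes> I)) \<otimes> H = (u2 \<otimes> H) \<odot> ((?Z \<otimes> I) \<otimes> idn 2)"
      by (rule idn_tens_slide(4)[symmetric], (rule typing HOL.refl | simp)+)
    finally show ?thesis by (simp only: tens_assoc idn_merge)
  qed
  have 3: "(?Z \<otimes> idn 3) \<odot> (idn 2 \<otimes> (cup \<otimes> I)) = (idn 2 \<otimes> (cup \<otimes> I)) \<odot> (?Z \<otimes> I)"
  proof -
    have h: "cup \<otimes> I \<in> hom (Suc 0) 3" by (rule typing HOL.refl | simp)+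
    show ?thesis by (simp only: tens_RL[OF Z h] tens_LR[OF Z h])
  qed
  have 4: "(u2 \<otimes> H) \<odot> (idn 2 \<otimes> (cup \<otimes> I)) = I \<otimes> H"
  proof -
    have "u2 \<otimes> H = (I \<otimes> H) \<odot> (u2 \<otimes> idn 2)"
      by (rule tens_RL[symmetric], (rule typing HOL.refl | simp)+)
    then have "(u2 \<otimes> H) \<odot> (idn 2 \<otimes> (cup \<otimes> I)) = (I \<otimes> H) \<odot> idn 3"
      using whisker_snake(4) by (simp add: comp_assoc)
    also have "\<dots> = I \<otimes> H" by (rule idn_comp_right, (rule typing HOL.refl | simp)+)
    finally show ?thesis .
  qed
  have "0 = (cap \<otimes> idn 3) \<odot> (I \<otimes> ((H \<otimes> H) \<odot> (I \<otimes> cup \<otimes> I) \<odot> H))" using triangle by simp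
  also have "\<dots> = ((cap \<otimes> idn 3) \<odot> ((I \<otimes> H) \<otimes> H)) \<odot> (idn 2 \<otimes> (cup \<otimes> I)) \<odot> (I \<otimes> H)"
    unfolding 1 by (simp only: comp_assoc)
  also have "\<dots> = (u2 \<otimes> H) \<odot> ((?Z \<otimes> idn 3) \<odot> (idn 2 \<otimes> (cup \<otimes> I))) \<odot> (I \<otimes> H)"
    unfolding 2 by (simp only: comp_assoc)
  also have "\<dots> = ((u2 \<otimes> H) \<odot> (idn 2 \<otimes> (cup \<otimes> I))) \<odot> (?Z \<otimes> I) \<odot> (I \<otimes> H)"
    unfolding 3 by (simp only: comp_assoc)
  finally show ?thesis unfolding 4 ..
qed

text \<open>Multiplying out the bent triangle relation isolates the alternating triple product; the
  relations with at most two crossings reduce all other terms.\<close>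

lemma triples:
  "x1 \<odot> x2 \<odot> x1 = (qint 2)\<^sup>2 \<star> x1 + (qint 2)\<^sup>2 \<star> (x1 \<odot> n2 \<odot> u1) + (qint 2)\<^sup>2 \<star> (n1 \<odot> u1 \<odot> x2)
    + (3 * (qint 2)\<^sup>2 - qd) \<star> (n1 \<odot> u1)"
  "x2 \<odot> x1 \<odot> x2 = (qint 2)\<^sup>2 \<star> x2 + (qint 2)\<^sup>2 \<star> (x1 \<odot> n2 \<odot> u2) + (qint 2)\<^sup>2 \<star> (n2 \<odot> u1 \<odot> x2)
    + (3 * (qint 2)\<^sup>2 - qd) \<star> (n2 \<odot> u2)"
proof -
  have "I \<otimes> idn 2 = idn 3" "idn 2 \<otimes> I = idn 3" by (simp_all add: numeral_2_eq_2 numeral_3_eq_3)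
  then have e: "I \<otimes> (X + idn 2) = x2 + idn 3" "(X + idn 2) \<otimes> I = x1 + idn 3"
    "H \<otimes> I = x1 + n1 \<odot> u1" "I \<otimes> H = x2 + n2 \<odot> u2"
    by (simp_all only: bilinear U_tens)
  have three: "(3 * c) \<star> f = c \<star> f + (c \<star> f + c \<star> f)" for c f
    by (simp flip: vs.scale_left_distrib)
  note simps = strand3_rules idn3_simps idn3_simps[THEN comp_ext] idn1_comp[THEN comp_ext] scl_simps
  have "x1 \<odot> x2 \<odot> x1 - ((qint 2)\<^sup>2 \<star> x1 + (qint 2)\<^sup>2 \<star> (x1 \<odot> n2 \<odot> u1) + (qint 2)\<^sup>2 \<star> (n1 \<odot> u1 \<odot> x2)
    + (3 * (qint 2)\<^sup>2 - qd) \<star> (n1 \<odot> u1)) = (x1 + n1 \<odot> u1) \<odot> (x2 + idn 3) \<odot> (x1 + n1 \<odot> u1)"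
    by (simp add: simps) (simp add: algebra_simps three)
  then show "x1 \<odot> x2 \<odot> x1 = (qint 2)\<^sup>2 \<star> x1 + (qint 2)\<^sup>2 \<star> (x1 \<odot> n2 \<odot> u1) + (qint 2)\<^sup>2 \<star> (n1 \<odot> u1 \<odot> x2)
    + (3 * (qint 2)\<^sup>2 - qd) \<star> (n1 \<odot> u1)" using hexagon unfolding e by simp
  have "x2 \<odot> x1 \<odot> x2 - ((qint 2)\<^sup>2 \<star> x2 + (qint 2)\<^sup>2 \<star> (x1 \<odot> n2 \<odot> u2) + (qint 2)\<^sup>2 \<star> (n2 \<odot> u1 \<odot> x2)
    + (3 * (qint 2)\<^sup>2 - qd) \<star> (n2 \<odot> u2)) = (x2 + n2 \<odot> u2) \<odot> (x1 + idn 3) \<odot> (x2 + n2 \<odot> u2)"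
    by (simp add: simps) (simp add: algebra_simps three)
  then show "x2 \<odot> x1 \<odot> x2 = (qint 2)\<^sup>2 \<star> x2 + (qint 2)\<^sup>2 \<star> (x1 \<odot> n2 \<odot> u2) + (qint 2)\<^sup>2 \<star> (n2 \<odot> u1 \<odot> x2)
    + (3 * (qint 2)\<^sup>2 - qd) \<star> (n2 \<odot> u2)" using hexagon' unfolding e by simp
qed

sublocale strand_cat hom scl comp tens idn cup cap X
  by unfold_locales
    (simp_all only: triples U_tens comp_assoc strand3(5)[THEN comp_ext] strand3(6))

lemma is_strand_cat: "strand_cat hom scl comp tens idn cup cap X"
  by unfold_locales

end

section \<open>Webs on single strands\<close>

lemma web_snake:
  "wcomp (wtens (wpiece (Cap a)) (wid [a])) (wtens (wid [a]) (wpiece (Cup a))) = wid [a]"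
  "wcomp (wtens (wid [a]) (wpiece (Cap a))) (wtens (wpiece (Cup a)) (wid [a])) = wid [a]"
  by (transfer, rule isotopic.snake_right) (transfer, rule isotopic.snake_left)

lemma web_turn:
  "valid_piece (Vertex (xs @ [a]) ys) \<Longrightarrow>
    wcomp (wtens (wpiece (Vertex (xs @ [a]) ys)) (wid [a])) (wtens (wid xs) (wpiece (Cup a)))
      = wpiece (Vertex xs (ys @ [a]))"
  "valid_piece (Vertex (a # xs) ys) \<Longrightarrow>
    wcomp (wtens (wid [a]) (wpiece (Vertex (a # xs) ys))) (wtens (wpiece (Cup a)) (wid xs))
      = wpiece (Vertex xs (a # ys))"
  by (transfer, rule isotopic.turn_right, assumption) (transfer, rule isotopic.turn_left, assumption)

abbreviation pc :: "piece \<Rightarrow> spider" where "pc p \<equiv> of_web (wpiece p)"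

lemma pc_Hom: "valid_piece p \<Longrightarrow> piece_bot p = s \<Longrightarrow> piece_top p = t \<Longrightarrow> pc p \<in> Hom s t"
  by (intro Hom_web) auto

lemma pc_snake:
  "(pc (Cap a) \<otimes>\<^sub>w ident [a]) \<circ>\<^sub>w (ident [a] \<otimes>\<^sub>w pc (Cup a)) = ident [a]"
  "(ident [a] \<otimes>\<^sub>w pc (Cap a)) \<circ>\<^sub>w (pc (Cup a) \<otimes>\<^sub>w ident [a]) = ident [a]"
  by (simp_all add: ident_def of_web_tens of_web_comp web_snake)

lemma pc_turn:
  "valid_piece (Vertex (xs @ [a]) ys) \<Longrightarrow>
    (pc (Vertex (xs @ [a]) ys) \<otimes>\<^sub>w ident [a]) \<circ>\<^sub>w (ident xs \<otimes>\<^sub>w pc (Cup a)) = pc (Vertex xs (ys @ [a]))"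
  "valid_piece (Vertex (a # xs) ys) \<Longrightarrow>
    (ident [a] \<otimes>\<^sub>w pc (Vertex (a # xs) ys)) \<circ>\<^sub>w (pc (Cup a) \<otimes>\<^sub>w ident xs) = pc (Vertex xs (a # ys))"
proof -
  assume v: "valid_piece (Vertex (xs @ [a]) ys)"
  show "(pc (Vertex (xs @ [a]) ys) \<otimes>\<^sub>w ident [a]) \<circ>\<^sub>w (ident xs \<otimes>\<^sub>w pc (Cup a)) = pc (Vertex xs (ys @ [a]))"
    using web_turn(1)[OF v] v by (simp add: ident_def of_web_tens of_web_comp del: valid_piece.simps(3))
next
  assume v: "valid_piece (Vertex (a # xs) ys)"
  show "(ident [a] \<otimes>\<^sub>w pc (Vertex (a # xs) ys)) \<circ>\<^sub>w (pc (Cup a) \<otimes>\<^sub>w ident xs) = pc (Vertex xs (a # ys))"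
    using web_turn(2)[OF v] v by (simp add: ident_def of_web_tens of_web_comp del: valid_piece.simps(3))
qed

named_theorems wtyping

lemma Hom_tens' [wtyping]:
  "f \<in> Hom a b \<Longrightarrow> g \<in> Hom a' b' \<Longrightarrow> s = a @ a' \<Longrightarrow> t = b @ b' \<Longrightarrow> f \<otimes>\<^sub>w g \<in> Hom s t"
  by (simp add: Hom_tens)

lemma Hom_ident' [wtyping]: "s = u \<Longrightarrow> t = u \<Longrightarrow> ident u \<in> Hom s t"
  by (simp add: Hom_ident)

lemma Hom_cast: "f \<in> Hom a b \<Longrightarrow> s = a \<Longrightarrow> t = b \<Longrightarrow> f \<in> Hom s t"
  by simp

lemmas [wtyping] = Hom_comp

lemma Hom_cup_cap [wtyping]:
  "s = [] \<Longrightarrow> t = [a, a] \<Longrightarrow> pc (Cup a) \<in> Hom s t" "s = [a, a] \<Longrightarrow> t = [] \<Longrightarrow> pc (Cap a) \<in> Hom s t"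
  by (auto intro!: pc_Hom)

lemma sp_slide:
  "f \<in> Hom p q \<Longrightarrow> g \<in> Hom b c \<Longrightarrow> h \<in> Hom a b \<Longrightarrow> (ident q \<otimes>\<^sub>w g) \<circ>\<^sub>w (f \<otimes>\<^sub>w h) = f \<otimes>\<^sub>w (g \<circ>\<^sub>w h)"
  "f \<in> Hom p q \<Longrightarrow> g \<in> Hom b c \<Longrightarrow> h \<in> Hom a b \<Longrightarrow> (f \<otimes>\<^sub>w g) \<circ>\<^sub>w (ident p \<otimes>\<^sub>w h) = f \<otimes>\<^sub>w (g \<circ>\<^sub>w h)"
  "f \<in> Hom p q \<Longrightarrow> g \<in> Hom b c \<Longrightarrow> h \<in> Hom a b \<Longrightarrow> (g \<otimes>\<^sub>w ident q) \<circ>\<^sub>w (h \<otimes>\<^sub>w f) = (g \<circ>\<^sub>w h) \<otimes>\<^sub>w f"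
  "f \<in> Hom p q \<Longrightarrow> g \<in> Hom b c \<Longrightarrow> h \<in> Hom a b \<Longrightarrow> (g \<otimes>\<^sub>w f) \<circ>\<^sub>w (h \<otimes>\<^sub>w ident p) = (g \<circ>\<^sub>w h) \<otimes>\<^sub>w f"
  by (subst sp_interchange, (assumption | rule Hom_ident)+, simp add: ident_comp)+

lemma sp_tens_LR: "f \<in> Hom p q \<Longrightarrow> g \<in> Hom r s \<Longrightarrow> (f \<otimes>\<^sub>w ident s) \<circ>\<^sub>w (ident p \<otimes>\<^sub>w g) = f \<otimes>\<^sub>w g"
  and sp_tens_RL: "f \<in> Hom p q \<Longrightarrow> g \<in> Hom r s \<Longrightarrow> (ident q \<otimes>\<^sub>w g) \<circ>\<^sub>w (f \<otimes>\<^sub>w ident r) = f \<otimes>\<^sub>w g"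
  using sp_slide(2)[of f p q "ident s" s s g r] sp_slide(1)[of f p q g r s "ident r" r]
  by (simp_all add: Hom_ident ident_comp)

lemma sp_comp_tens_ident: "f \<in> Hom b c \<Longrightarrow> g \<in> Hom a b \<Longrightarrow> (f \<otimes>\<^sub>w ident s) \<circ>\<^sub>w (g \<otimes>\<^sub>w ident s) = (f \<circ>\<^sub>w g) \<otimes>\<^sub>w ident s"
  and sp_ident_tens_comp: "f \<in> Hom b c \<Longrightarrow> g \<in> Hom a b \<Longrightarrow> (ident s \<otimes>\<^sub>w f) \<circ>\<^sub>w (ident s \<otimes>\<^sub>w g) = ident s \<otimes>\<^sub>w (f \<circ>\<^sub>w g)"
  by (rule sp_slide(3,1)[OF Hom_ident]; assumption)+

lemma sp_comp_ext: "f \<circ>\<^sub>w g = h \<Longrightarrow> f \<circ>\<^sub>w (g \<circ>\<^sub>w w) = h \<circ>\<^sub>w w"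
  by (simp flip: sp_comp_assoc)

lemma ident_merge: "ident s \<otimes>\<^sub>w (ident t \<otimes>\<^sub>w f) = ident (s @ t) \<otimes>\<^sub>w f"
  by (simp add: ident_tens flip: sp_tens_assoc)

text \<open>Isotopy is stated for legs turned upwards. A snake move reverses the turn, so legs can
  be turned downwards as well.\<close>

lemma pc_unturn_right:
  assumes "valid_piece (Vertex (xs @ [a]) ys)"
  shows "pc (Vertex (xs @ [a]) ys) = (ident ys \<otimes>\<^sub>w pc (Cap a)) \<circ>\<^sub>w (pc (Vertex xs (ys @ [a])) \<otimes>\<^sub>w ident [a])"
proof -
  let ?V = "pc (Vertex (xs @ [a]) ys)" and ?i = "ident [a]"
  have V: "?V \<in> Hom (xs @ [a]) ys" using assms by (auto intro!: pc_Hom)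
  note [wtyping] = Hom_cast[OF V]
  have 1: "(ident ys \<otimes>\<^sub>w pc (Cap a)) \<circ>\<^sub>w (?V \<otimes>\<^sub>w ident [a, a]) = ?V \<circ>\<^sub>w (ident (xs @ [a]) \<otimes>\<^sub>w pc (Cap a))"
    using sp_tens_RL[OF V Hom_cup_cap(2)[OF HOL.refl HOL.refl]] sp_tens_LR[OF V Hom_cup_cap(2)[OF HOL.refl HOL.refl]] by simp
  have 2: "(ident (xs @ [a]) \<otimes>\<^sub>w pc (Cap a)) \<circ>\<^sub>w (ident xs \<otimes>\<^sub>w (pc (Cup a) \<otimes>\<^sub>w ?i)) = ident (xs @ [a])"
  proof -
    have "(ident xs \<otimes>\<^sub>w (?i \<otimes>\<^sub>w pc (Cap a))) \<circ>\<^sub>w (ident xs \<otimes>\<^sub>w (pc (Cup a) \<otimes>\<^sub>w ?i)) = ident xs \<otimes>\<^sub>w ?i"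
      by (subst sp_ident_tens_comp, (rule wtyping HOL.refl | simp)+) (simp add: pc_snake)
    then show ?thesis by (simp add: ident_merge ident_tens)
  qed
  have "pc (Vertex xs (ys @ [a])) \<otimes>\<^sub>w ?i = (?V \<otimes>\<^sub>w ident [a, a]) \<circ>\<^sub>w (ident xs \<otimes>\<^sub>w (pc (Cup a) \<otimes>\<^sub>w ?i))"
    unfolding pc_turn(1)[OF assms, symmetric]
    by (subst sp_comp_tens_ident[symmetric], (rule wtyping HOL.refl | simp)+) (simp add: sp_tens_assoc ident_tens)
  then show ?thesis using 1[THEN sp_comp_ext] 2 ident_comp(2)[OF V] by (simp add: sp_comp_assoc)
qed

lemma pc_unturn_left:
  assumes "valid_piece (Vertex (a # xs) ys)"
  shows "pc (Vertex (a # xs) ys) = (pc (Cap a) \<otimes>\<^sub>w ident ys) \<circ>\<^sub>w (ident [a] \<otimes>\<^sub>w pc (Vertex xs (a # ys)))"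
proof -
  let ?V = "pc (Vertex (a # xs) ys)" and ?i = "ident [a]"
  have V: "?V \<in> Hom (a # xs) ys" using assms by (auto intro!: pc_Hom)
  note [wtyping] = Hom_cast[OF V]
  have 1: "(pc (Cap a) \<otimes>\<^sub>w ident ys) \<circ>\<^sub>w (ident [a, a] \<otimes>\<^sub>w ?V) = ?V \<circ>\<^sub>w (pc (Cap a) \<otimes>\<^sub>w ident (a # xs))"
    using sp_tens_RL[OF Hom_cup_cap(2)[OF HOL.refl HOL.refl] V] sp_tens_LR[OF Hom_cup_cap(2)[OF HOL.refl HOL.refl] V] by simp
  have 2: "(pc (Cap a) \<otimes>\<^sub>w ident (a # xs)) \<circ>\<^sub>w (?i \<otimes>\<^sub>w (pc (Cup a) \<otimes>\<^sub>w ident xs)) = ident (a # xs)"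
  proof -
    have "((pc (Cap a) \<otimes>\<^sub>w ?i) \<otimes>\<^sub>w ident xs) \<circ>\<^sub>w ((?i \<otimes>\<^sub>w pc (Cup a)) \<otimes>\<^sub>w ident xs) = ?i \<otimes>\<^sub>w ident xs"
      by (subst sp_comp_tens_ident, (rule wtyping HOL.refl | simp)+) (simp add: pc_snake)
    then show ?thesis by (simp add: sp_tens_assoc ident_tens)
  qed
  have "?i \<otimes>\<^sub>w pc (Vertex xs (a # ys)) = (ident [a, a] \<otimes>\<^sub>w ?V) \<circ>\<^sub>w (?i \<otimes>\<^sub>w (pc (Cup a) \<otimes>\<^sub>w ident xs))"
    unfolding pc_turn(2)[OF assms, symmetric]
    by (subst sp_ident_tens_comp[symmetric], (rule wtyping HOL.refl | simp)+) (simp add: ident_merge)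
  then show ?thesis using 1[THEN sp_comp_ext] 2 ident_comp(2)[OF V] by (simp add: sp_comp_assoc)
qed

lemma null_relations:
  "of_web (loop_web T1) = qd *\<^sub>w ident []"
  "of_web lollipop_web = 0"
  "of_web bigon_web = (- ((qint 2)\<^sup>2)) *\<^sub>w ident [T2]"
  "of_web triangle_web = 0"
  "of_web I_web - of_web J_web = of_web U_web - of_web V_web"
proof -
  have rel: "f \<in> null_comb" if "f \<in> local_relations" for f using that by (rule null_comb.relation)
  show "of_web (loop_web T1) = qd *\<^sub>w ident []" unfolding ident_def qd_def
    by transfer (auto simp: equiv_mod_def local_relations_def intro!: rel)
  show "of_web lollipop_web = 0"
    by transfer (auto simp: equiv_mod_def local_relations_def intro!: rel)
  show "of_web bigon_web = (- ((qint 2)\<^sup>2)) *\<^sub>w ident [T2]" unfolding ident_def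
    by transfer (auto simp: equiv_mod_def local_relations_def intro!: rel)
  show "of_web triangle_web = 0"
    by transfer (auto simp: equiv_mod_def local_relations_def intro!: rel)
  have "of_web I_web + - of_web J_web + - (of_web U_web + - of_web V_web) = 0"
    by transfer (auto simp: equiv_mod_def local_relations_def intro!: rel)
  then have "(of_web I_web - of_web J_web) - (of_web U_web - of_web V_web) = 0" by (simp add: algebra_simps)
  then show "of_web I_web - of_web J_web = of_web U_web - of_web V_web" by (simp only: right_minus_eq)
qed

abbreviation cupw where "cupw \<equiv> pc (Cup T1)"
abbreviation capw where "capw \<equiv> pc (Cap T1)"
abbreviation Yw where "Yw \<equiv> pc (Vertex [T1, T1] [T2])"
abbreviation Lw where "Lw \<equiv> pc (Vertex [T2] [T1, T1])"
abbreviation i1 where "i1 \<equiv> ident [T1]"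

lemma YL_Hom [wtyping]: "s = [T1, T1] \<Longrightarrow> t = [T2] \<Longrightarrow> Yw \<in> Hom s t" "s = [T2] \<Longrightarrow> t = [T1, T1] \<Longrightarrow> Lw \<in> Hom s t"
  by (auto intro!: pc_Hom)

lemma vertex_webs:
  "pc (Vertex [T1] [T2, T1]) = (Yw \<otimes>\<^sub>w i1) \<circ>\<^sub>w (i1 \<otimes>\<^sub>w cupw)"
  "pc (Vertex [T1] [T1, T2]) = (i1 \<otimes>\<^sub>w Yw) \<circ>\<^sub>w (cupw \<otimes>\<^sub>w i1)"
  "pc (Vertex [T2, T1] [T1]) = (i1 \<otimes>\<^sub>w capw) \<circ>\<^sub>w (Lw \<otimes>\<^sub>w i1)"
  using pc_turn(1)[of "[T1]" T1 "[T2]"] pc_turn(2)[of T1 "[T1]" "[T2]"] pc_unturn_right[of "[T2]" T1 "[T1]"]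
  by simp_all

lemma web_relations:
  "capw \<circ>\<^sub>w cupw = qd *\<^sub>w ident []"
  "capw \<circ>\<^sub>w Lw = 0"
  "Yw \<circ>\<^sub>w Lw = (- ((qint 2)\<^sup>2)) *\<^sub>w ident [T2]"
  "U = cupw \<circ>\<^sub>w capw"
  "X = Lw \<circ>\<^sub>w Yw - U"
proof -
  show "capw \<circ>\<^sub>w cupw = qd *\<^sub>w ident []" using null_relations(1) by (simp add: loop_web_def of_web_comp)
  show "capw \<circ>\<^sub>w Lw = 0" using null_relations(2) by (simp add: lollipop_web_def of_web_comp)
  show "Yw \<circ>\<^sub>w Lw = (- ((qint 2)\<^sup>2)) *\<^sub>w ident [T2]" using null_relations(3) by (simp add: bigon_web_def of_web_comp)
  show U: "U = cupw \<circ>\<^sub>w capw" by (simp add: U_def U_web_def of_web_comp)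
  have "of_web I_web = Lw \<circ>\<^sub>w Yw" by (simp add: I_web_def of_web_comp)
  then show "X = Lw \<circ>\<^sub>w Yw - U" using null_relations(5) by (simp add: X_def U_def algebra_simps)
qed

text \<open>Its two vertices are a turned merge and a turned split, so \<open>J\<close> is a quarter
  turn of \<open>I\<close>. As \<open>U\<close> turns into \<open>V\<close>, the relation I - U = J
  - V becomes rotation invariance of \<open>X\<close>.\<close>

lemma J_rotation:
  "of_web J_web = (ident [T1, T1] \<otimes>\<^sub>w capw) \<circ>\<^sub>w (i1 \<otimes>\<^sub>w (Lw \<circ>\<^sub>w Yw) \<otimes>\<^sub>w i1) \<circ>\<^sub>w (cupw \<otimes>\<^sub>w ident [T1, T1])"
proof -
  have "of_web J_web = (i1 \<otimes>\<^sub>w pc (Vertex [T2, T1] [T1])) \<circ>\<^sub>w (pc (Vertex [T1] [T1, T2]) \<otimes>\<^sub>w i1)"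
    by (simp add: J_web_def ident_def of_web_tens of_web_comp)
  also have "i1 \<otimes>\<^sub>w pc (Vertex [T2, T1] [T1]) = (i1 \<otimes>\<^sub>w (i1 \<otimes>\<^sub>w capw)) \<circ>\<^sub>w (i1 \<otimes>\<^sub>w (Lw \<otimes>\<^sub>w i1))"
    unfolding vertex_webs by (subst sp_ident_tens_comp, (rule wtyping HOL.refl | simp)+)
  also have "pc (Vertex [T1] [T1, T2]) \<otimes>\<^sub>w i1 = ((i1 \<otimes>\<^sub>w Yw) \<otimes>\<^sub>w i1) \<circ>\<^sub>w ((cupw \<otimes>\<^sub>w i1) \<otimes>\<^sub>w i1)"
    unfolding vertex_webs by (subst sp_comp_tens_ident, (rule wtyping HOL.refl | simp)+)
  finally have J: "of_web J_web = ((i1 \<otimes>\<^sub>w (i1 \<otimes>\<^sub>w capw)) \<circ>\<^sub>w (i1 \<otimes>\<^sub>w (Lw \<otimes>\<^sub>w i1))) \<circ>\<^sub>w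
    ((i1 \<otimes>\<^sub>w Yw) \<otimes>\<^sub>w i1) \<circ>\<^sub>w ((cupw \<otimes>\<^sub>w i1) \<otimes>\<^sub>w i1)" .
  have "i1 \<otimes>\<^sub>w (Lw \<circ>\<^sub>w Yw) \<otimes>\<^sub>w i1 = (i1 \<otimes>\<^sub>w (Lw \<otimes>\<^sub>w i1)) \<circ>\<^sub>w (i1 \<otimes>\<^sub>w (Yw \<otimes>\<^sub>w i1))"
    by (subst sp_ident_tens_comp, (rule wtyping HOL.refl | simp)+)
      (subst sp_comp_tens_ident, (rule wtyping HOL.refl | simp)+)
  then show ?thesis using J by (simp add: sp_comp_assoc sp_tens_assoc ident_merge ident_tens)
qed

text \<open>The two lower corners of the triangle are merges turned by cups. The cap at the middle
  cancels against these, leaving one cup between the two merges.\<close>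

lemma triangle_unfolded: "(Yw \<otimes>\<^sub>w Yw) \<circ>\<^sub>w (i1 \<otimes>\<^sub>w (cupw \<otimes>\<^sub>w i1)) \<circ>\<^sub>w Lw = 0"
proof -
  have 1: "of_web triangle_web = (ident [T2] \<otimes>\<^sub>w (capw \<otimes>\<^sub>w ident [T2])) \<circ>\<^sub>w
      (pc (Vertex [T1] [T2, T1]) \<otimes>\<^sub>w pc (Vertex [T1] [T1, T2])) \<circ>\<^sub>w Lw"
    by (simp add: triangle_web_def ident_def of_web_tens of_web_comp)
  have 2: "pc (Vertex [T1] [T2, T1]) \<otimes>\<^sub>w pc (Vertex [T1] [T1, T2]) =
     ((Yw \<otimes>\<^sub>w i1) \<otimes>\<^sub>w (i1 \<otimes>\<^sub>w Yw)) \<circ>\<^sub>w ((i1 \<otimes>\<^sub>w cupw) \<otimes>\<^sub>w (cupw \<otimes>\<^sub>w i1))"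
    unfolding vertex_webs by (subst sp_interchange, (rule wtyping HOL.refl | simp)+)
  have 3: "(ident [T2] \<otimes>\<^sub>w (capw \<otimes>\<^sub>w ident [T2])) \<circ>\<^sub>w ((Yw \<otimes>\<^sub>w i1) \<otimes>\<^sub>w (i1 \<otimes>\<^sub>w Yw)) =
      (Yw \<otimes>\<^sub>w Yw) \<circ>\<^sub>w (ident [T1, T1] \<otimes>\<^sub>w (capw \<otimes>\<^sub>w ident [T1, T1]))"
  proof -
    have "(ident [T2] \<otimes>\<^sub>w (capw \<otimes>\<^sub>w ident [T2])) \<circ>\<^sub>w (Yw \<otimes>\<^sub>w (ident [T1, T1] \<otimes>\<^sub>w Yw)) =
       Yw \<otimes>\<^sub>w ((capw \<otimes>\<^sub>w ident [T2]) \<circ>\<^sub>w (ident [T1, T1] \<otimes>\<^sub>w Yw))"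
      by (rule sp_slide(1), (rule wtyping HOL.refl | simp)+)
    also have "(capw \<otimes>\<^sub>w ident [T2]) \<circ>\<^sub>w (ident [T1, T1] \<otimes>\<^sub>w Yw) = Yw \<circ>\<^sub>w (capw \<otimes>\<^sub>w ident [T1, T1])"
      using sp_tens_LR[of capw "[T1, T1]" "[]" Yw "[T1, T1]" "[T2]"] sp_tens_RL[of capw "[T1, T1]" "[]" Yw "[T1, T1]" "[T2]"]
      by (simp add: YL_Hom Hom_cup_cap)
    also have "Yw \<otimes>\<^sub>w (Yw \<circ>\<^sub>w (capw \<otimes>\<^sub>w ident [T1, T1])) = (Yw \<otimes>\<^sub>w Yw) \<circ>\<^sub>w (ident [T1, T1] \<otimes>\<^sub>w (capw \<otimes>\<^sub>w ident [T1, T1]))"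
      by (rule sp_slide(2)[symmetric], (rule wtyping HOL.refl | simp)+)
    finally show ?thesis by (simp add: sp_tens_assoc ident_merge ident_tens)
  qed
  have 4: "(ident [T1, T1] \<otimes>\<^sub>w (capw \<otimes>\<^sub>w ident [T1, T1])) \<circ>\<^sub>w ((i1 \<otimes>\<^sub>w cupw) \<otimes>\<^sub>w (cupw \<otimes>\<^sub>w i1)) = i1 \<otimes>\<^sub>w (cupw \<otimes>\<^sub>w i1)"
  proof -
    have a: "(i1 \<otimes>\<^sub>w (capw \<otimes>\<^sub>w i1)) \<circ>\<^sub>w (cupw \<otimes>\<^sub>w cupw) = cupw"
    proof -
      have "cupw \<otimes>\<^sub>w cupw = (cupw \<otimes>\<^sub>w ident [T1, T1]) \<circ>\<^sub>w (ident [] \<otimes>\<^sub>w cupw)"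
        by (rule sp_tens_LR[symmetric], (rule wtyping HOL.refl | simp)+)
      then have "(i1 \<otimes>\<^sub>w (capw \<otimes>\<^sub>w i1)) \<circ>\<^sub>w (cupw \<otimes>\<^sub>w cupw) = (((i1 \<otimes>\<^sub>w capw) \<otimes>\<^sub>w i1) \<circ>\<^sub>w ((cupw \<otimes>\<^sub>w i1) \<otimes>\<^sub>w i1)) \<circ>\<^sub>w cupw"
        by (simp add: sp_comp_assoc sp_tens_assoc ident_tens)
      also have "((i1 \<otimes>\<^sub>w capw) \<otimes>\<^sub>w i1) \<circ>\<^sub>w ((cupw \<otimes>\<^sub>w i1) \<otimes>\<^sub>w i1) = ident [T1, T1]"
        by (subst sp_comp_tens_ident, (rule wtyping HOL.refl | simp)+) (simp add: pc_snake ident_tens)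
      also have "ident [T1, T1] \<circ>\<^sub>w cupw = cupw" by (rule ident_comp(1), (rule wtyping HOL.refl | simp)+)
      finally show ?thesis .
    qed
    have "(i1 \<otimes>\<^sub>w ((i1 \<otimes>\<^sub>w (capw \<otimes>\<^sub>w i1)) \<otimes>\<^sub>w i1)) \<circ>\<^sub>w (i1 \<otimes>\<^sub>w ((cupw \<otimes>\<^sub>w cupw) \<otimes>\<^sub>w i1)) = i1 \<otimes>\<^sub>w (cupw \<otimes>\<^sub>w i1)"
      by (subst sp_ident_tens_comp, (rule wtyping HOL.refl | simp)+)
        (subst sp_comp_tens_ident, (rule wtyping HOL.refl | simp)+, simp add: a)
    then show ?thesis by (simp add: sp_tens_assoc ident_merge ident_tens)
  qed
  have "0 = ((ident [T2] \<otimes>\<^sub>w (capw \<otimes>\<^sub>w ident [T2])) \<circ>\<^sub>w ((Yw \<otimes>\<^sub>w i1) \<otimes>\<^sub>w (i1 \<otimes>\<^sub>w Yw))) \<circ>\<^sub>w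
      ((i1 \<otimes>\<^sub>w cupw) \<otimes>\<^sub>w (cupw \<otimes>\<^sub>w i1)) \<circ>\<^sub>w Lw"
    using null_relations(4) unfolding 1 2 by (simp only: sp_comp_assoc)
  also have "\<dots> = (Yw \<otimes>\<^sub>w Yw) \<circ>\<^sub>w ((ident [T1, T1] \<otimes>\<^sub>w (capw \<otimes>\<^sub>w ident [T1, T1])) \<circ>\<^sub>w ((i1 \<otimes>\<^sub>w cupw) \<otimes>\<^sub>w (cupw \<otimes>\<^sub>w i1))) \<circ>\<^sub>w Lw"
    unfolding 3 by (simp only: sp_comp_assoc)
  finally show ?thesis unfolding 4 ..
qed

section \<open>The web category restricted to single strands\<close>

definition hom1 :: "nat \<Rightarrow> nat \<Rightarrow> spider set" where
  "hom1 m n = Hom (replicate m T1) (replicate n T1)"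

definition idn1 :: "nat \<Rightarrow> spider" where
  "idn1 n = ident (replicate n T1)"

lemma idn1_simps: "idn1 0 = ident []" "idn1 (Suc 0) = ident [T1]" "idn1 2 = ident [T1, T1]"
  by (simp_all add: idn1_def numeral_2_eq_2)

interpretation sp: monoidal_cat hom1 sp_scale sp_comp sp_tens idn1
proof -
  show "monoidal_cat hom1 sp_scale sp_comp sp_tens idn1"
  proof unfold_locales
    fix f g m n m' n'
    assume "f \<in> hom1 m n" "g \<in> hom1 m' n'"
    then show "f \<otimes>\<^sub>w g \<in> hom1 (m + m') (n + n')" using Hom_tens[of f "replicate m T1" "replicate n T1" g "replicate m' T1" "replicate n' T1"]
      by (simp add: hom1_def replicate_add)
  qed (auto simp: hom1_def idn1_def sp_bilinear sp_comp_assoc sp_tens_assoc Hom_linear Hom_comp Hom_ident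
    ident_comp ident_tens replicate_add sp_interchange spider.scale_right_distrib spider.scale_left_distrib)
qed

lemma hom1_gens: "cupw \<in> hom1 0 2" "capw \<in> hom1 2 0" "X \<in> hom1 2 2"
proof -
  show c: "cupw \<in> hom1 0 2" "capw \<in> hom1 2 0" unfolding hom1_def by (auto simp: numeral_2_eq_2 intro!: pc_Hom)
  have "Lw \<circ>\<^sub>w Yw \<in> hom1 2 2" unfolding hom1_def by (rule wtyping HOL.refl | simp add: numeral_2_eq_2)+
  moreover have "U \<in> hom1 2 2" unfolding web_relations by (rule sp.hom_comp[OF c])
  ultimately show "X \<in> hom1 2 2"
    using sp.hom_add[of "Lw \<circ>\<^sub>w Yw" 2 2 "- U"] sp.hom_scl[of U 2 2 "-1"] by (simp add: web_relations(5))
qed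

text \<open>Each relation with double strands is extended by merges and splits at its ends until
  only single strands are visible. For rotation, the quarter turn of I - U is J - V.\<close>

lemma web_cat_spider: "web_cat hom1 sp_scale sp_comp sp_tens idn1 cupw capw X"
proof
  have H: "X + cupw \<circ>\<^sub>w capw = Lw \<circ>\<^sub>w Yw" by (simp add: web_relations(5)) (simp add: web_relations(4))
  note g = hom1_gens
  show "cupw \<in> hom1 0 2" "capw \<in> hom1 2 0" "X \<in> hom1 2 2" by (fact g)+
  show "capw \<circ>\<^sub>w cupw = qd *\<^sub>w idn1 0" by (simp add: web_relations idn1_simps)
  show s: "(capw \<otimes>\<^sub>w idn1 (Suc 0)) \<circ>\<^sub>w idn1 (Suc 0) \<otimes>\<^sub>w cupw = idn1 (Suc 0)"
    "idn1 (Suc 0) \<otimes>\<^sub>w capw \<circ>\<^sub>w cupw \<otimes>\<^sub>w idn1 (Suc 0) = idn1 (Suc 0)"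
    by (simp_all add: pc_snake idn1_simps)
  show "capw \<circ>\<^sub>w (X + cupw \<circ>\<^sub>w capw) = 0"
    unfolding H using web_relations(2)[THEN sp_comp_ext] by simp
  have Y: "Yw \<circ>\<^sub>w (Lw \<circ>\<^sub>w Yw) = (- ((qint 2)\<^sup>2)) *\<^sub>w Yw"
    using web_relations(3)[THEN sp_comp_ext] ident_comp(1)[OF YL_Hom(1)[OF HOL.refl HOL.refl]]
    by (simp only: sp_bilinear)
  show "(X + cupw \<circ>\<^sub>w capw) \<circ>\<^sub>w (X + cupw \<circ>\<^sub>w capw) = (- (qint 2)\<^sup>2) *\<^sub>w (X + cupw \<circ>\<^sub>w capw)"
    unfolding H by (simp only: sp_comp_assoc Y sp_bilinear)
  have LY: "(Lw \<circ>\<^sub>w Yw) \<otimes>\<^sub>w (Lw \<circ>\<^sub>w Yw) = (Lw \<otimes>\<^sub>w Lw) \<circ>\<^sub>w (Yw \<otimes>\<^sub>w Yw)"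
    by (rule sp_interchange[symmetric], (rule wtyping HOL.refl | simp)+)
  show "(X + cupw \<circ>\<^sub>w capw) \<otimes>\<^sub>w (X + cupw \<circ>\<^sub>w capw) \<circ>\<^sub>w
    idn1 (Suc 0) \<otimes>\<^sub>w cupw \<otimes>\<^sub>w idn1 (Suc 0) \<circ>\<^sub>w (X + cupw \<circ>\<^sub>w capw) = 0"
    unfolding H LY idn1_simps using triangle_unfolded[THEN arg_cong, of "\<lambda>f. (Lw \<otimes>\<^sub>w Lw) \<circ>\<^sub>w f \<circ>\<^sub>w Yw"]
    by (simp add: sp_comp_assoc)
  \<comment> \<open>The quarter turn of \<open>U\<close> is a pair of vertical strands.\<close>
  have rU: "(idn1 2 \<otimes>\<^sub>w capw) \<circ>\<^sub>w (idn1 (Suc 0) \<otimes>\<^sub>w U \<otimes>\<^sub>w idn1 (Suc 0)) \<circ>\<^sub>w (cupw \<otimes>\<^sub>w idn1 2) = idn1 2"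
  proof -
    have a: "idn1 (Suc 0) \<otimes>\<^sub>w U \<otimes>\<^sub>w idn1 (Suc 0) =
      (idn1 (Suc 0) \<otimes>\<^sub>w cupw \<otimes>\<^sub>w idn1 (Suc 0)) \<circ>\<^sub>w (idn1 (Suc 0) \<otimes>\<^sub>w capw \<otimes>\<^sub>w idn1 (Suc 0))"
      unfolding web_relations by (rule sp.whisker_comp[symmetric, OF g(1,2)])
    have h: "idn1 (Suc 0) \<otimes>\<^sub>w capw \<in> hom1 3 (Suc 0)" "cupw \<otimes>\<^sub>w idn1 (Suc 0) \<in> hom1 (Suc 0) 3"
      using sp.hom_tens[OF sp.hom_idn g(2), of "Suc 0"] sp.hom_tens[OF g(1) sp.hom_idn, of "Suc 0"]
      by (simp_all add: numeral_3_eq_3 numeral_2_eq_2)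
    have b: "(idn1 2 \<otimes>\<^sub>w capw) \<circ>\<^sub>w (idn1 (Suc 0) \<otimes>\<^sub>w cupw \<otimes>\<^sub>w idn1 (Suc 0)) = idn1 2"
      using sp.idn_tens_comp[OF h, of "Suc 0"] s(2) by (simp add: numeral_2_eq_2)
    have c: "(idn1 (Suc 0) \<otimes>\<^sub>w capw \<otimes>\<^sub>w idn1 (Suc 0)) \<circ>\<^sub>w (cupw \<otimes>\<^sub>w idn1 2) = idn1 2"
      using sp.comp_tens_idn[OF h, of "Suc 0"] s(2) by (simp add: numeral_2_eq_2 sp_tens_assoc)
    show ?thesis unfolding a using b[THEN sp_comp_ext] c sp.idn_comp_left[OF sp.hom_idn] by (simp add: sp_comp_assoc)
  qed
  have "(idn1 2 \<otimes>\<^sub>w capw) \<circ>\<^sub>w (idn1 (Suc 0) \<otimes>\<^sub>w X \<otimes>\<^sub>w idn1 (Suc 0)) \<circ>\<^sub>w (cupw \<otimes>\<^sub>w idn1 2)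
    = of_web J_web - idn1 2"
    unfolding web_relations(5) J_rotation using rU by (simp add: sp.diff_simps idn1_simps)
  then show "idn1 2 \<otimes>\<^sub>w capw \<circ>\<^sub>w idn1 (Suc 0) \<otimes>\<^sub>w X \<otimes>\<^sub>w idn1 (Suc 0) \<circ>\<^sub>w cupw \<otimes>\<^sub>w idn1 2 = X"
    by (simp add: X_def V_web_def idn1_simps ident_def)
qed

interpretation sp: strand_cat hom1 sp_scale sp_comp sp_tens idn1 cupw capw X
  by (rule web_cat.is_strand_cat[OF web_cat_spider])

interpretation opp: strand_cat "\<lambda>m n. hom1 n m" sp_scale "\<lambda>f g. g \<circ>\<^sub>w f" sp_tens idn1 capw cupw X
  by (rule sp.opposite)

section \<open>Replacing double strands by pairs of single ones\<close>

primrec wt :: "word \<Rightarrow> nat" where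
  "wt [] = 0"
| "wt (a # t) = (if a = T1 then Suc (wt t) else Suc (Suc (wt t)))"

primrec inc :: "word \<Rightarrow> spider" where
  "inc [] = ident []"
| "inc (a # t) = (if a = T1 then i1 else Lw) \<otimes>\<^sub>w inc t"

primrec prj :: "word \<Rightarrow> spider" where
  "prj [] = ident []"
| "prj (a # t) = (if a = T1 then i1 else Yw) \<otimes>\<^sub>w prj t"

definition kappa :: "word \<Rightarrow> K" where
  "kappa t = (- ((qint 2)\<^sup>2)) ^ count_list t T2"

lemma kappa_nonzero: "kappa t \<noteq> 0"
  using qint_nonzero[of 2] by (simp add: kappa_def)

lemma inc_Hom: "inc t \<in> Hom t (replicate (wt t) T1)"
proof (induction t)
  case (Cons a t)
  note [wtyping] = Hom_cast[OF Cons]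
  show ?case by (cases a; simp; (rule wtyping HOL.refl | simp)+)
qed (simp add: Hom_ident)

lemma prj_Hom: "prj t \<in> Hom (replicate (wt t) T1) t"
proof (induction t)
  case (Cons a t)
  note [wtyping] = Hom_cast[OF Cons]
  show ?case by (cases a; simp; (rule wtyping HOL.refl | simp)+)
qed (simp add: Hom_ident)

lemma wt_append: "wt (s @ t) = wt s + wt t"
  by (induction s) auto

lemma inc_append: "inc (s @ t) = inc s \<otimes>\<^sub>w inc t"
  by (induction s) (auto simp: sp_tens_assoc)

lemma prj_append: "prj (s @ t) = prj s \<otimes>\<^sub>w prj t"
  by (induction s) (auto simp: sp_tens_assoc)

lemma wt_replicate: "wt (replicate n T1) = n"
  by (induction n) auto

lemma inc_prj_replicate: "inc (replicate n T1) = idn1 n" "prj (replicate n T1) = idn1 n"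
  by (induction n; simp add: idn1_def ident_tens)+

lemma prj_inc: "prj t \<circ>\<^sub>w inc t = kappa t *\<^sub>w ident t"
proof (induction t)
  case Nil then show ?case by (simp add: kappa_def ident_comp[OF Hom_ident])
next
  case (Cons a t)
  show ?case
  proof (cases a)
    case T1
    have "prj (a # t) \<circ>\<^sub>w inc (a # t) = (i1 \<circ>\<^sub>w i1) \<otimes>\<^sub>w (prj t \<circ>\<^sub>w inc t)"
      using T1 sp_interchange[OF Hom_ident Hom_ident prj_Hom inc_Hom] by simp
    then show ?thesis using T1 Cons by (simp add: ident_comp[OF Hom_ident] sp_bilinear ident_tens kappa_def)
  next
    case T2
    have "prj (a # t) \<circ>\<^sub>w inc (a # t) = (Yw \<circ>\<^sub>w Lw) \<otimes>\<^sub>w (prj t \<circ>\<^sub>w inc t)"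
      using T2 sp_interchange[OF YL_Hom(1)[OF HOL.refl HOL.refl] YL_Hom(2)[OF HOL.refl HOL.refl] prj_Hom inc_Hom] by simp
    then show ?thesis using T2 unfolding web_relations(3) Cons
      by (simp only: sp_bilinear ident_tens kappa_def spider.scale_scale) (simp add: mult.commute)
  qed
qed

lemma H_G: "sp.G 2 2 (Lw \<circ>\<^sub>w Yw)"
proof -
  have "sp.G 2 2 (X + cupw \<circ>\<^sub>w capw)" by (intro sp.G.add sp.G.X sp.G.comp[OF sp.G.cup sp.G.cap])
  moreover have "X + cupw \<circ>\<^sub>w capw = Lw \<circ>\<^sub>w Yw" by (simp add: web_relations(5)) (simp add: web_relations(4))
  ultimately show ?thesis by simp
qed

text \<open>The test is made after all double strands at both ends have been split into pairs. It
  passes to composites because the detour \<open>prj t\<close> after \<open>inc t\<close> in between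
  is a nonzero scalar.\<close>

definition single_gen :: "word \<Rightarrow> word \<Rightarrow> spider \<Rightarrow> bool" where
  "single_gen s t f \<longleftrightarrow> f \<in> Hom s t \<and> sp.G (wt s) (wt t) (inc t \<circ>\<^sub>w f \<circ>\<^sub>w prj s)"

lemma single_gen_ident: "single_gen t t (ident t)"
proof -
  have "sp.G (wt t) (wt t) (inc t \<circ>\<^sub>w prj t)"
  proof (induction t)
    case Nil
    then show ?case using sp.G.idn[of 0] by (simp add: idn1_simps ident_comp[OF Hom_ident])
  next
    case (Cons a t)
    show ?case
    proof (cases a)
      case T1
      have "inc (a # t) \<circ>\<^sub>w prj (a # t) = idn1 (Suc 0) \<otimes>\<^sub>w (inc t \<circ>\<^sub>w prj t)"
        using T1 sp_interchange[OF Hom_ident Hom_ident inc_Hom prj_Hom] by (simp add: ident_comp[OF Hom_ident] idn1_simps)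
      then show ?thesis using T1 sp.G.tens[OF sp.G.idn[of "Suc 0"] Cons] by simp
    next
      case T2
      have "inc (a # t) \<circ>\<^sub>w prj (a # t) = (Lw \<circ>\<^sub>w Yw) \<otimes>\<^sub>w (inc t \<circ>\<^sub>w prj t)"
        using T2 sp_interchange[OF YL_Hom(2)[OF HOL.refl HOL.refl] YL_Hom(1)[OF HOL.refl HOL.refl] inc_Hom prj_Hom] by simp
      then show ?thesis using T2 sp.G.tens[OF H_G Cons] by simp
    qed
  qed
  then show ?thesis using ident_comp(1)[OF prj_Hom] by (simp add: single_gen_def Hom_ident)
qed

lemma single_gen_comp:
  assumes f: "single_gen t u f" and g: "single_gen s t g"
  shows "single_gen s u (f \<circ>\<^sub>w g)"
proof -
  have h: "f \<in> Hom t u" "g \<in> Hom s t" using f g by (simp_all add: single_gen_def)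
  have "(inc u \<circ>\<^sub>w f \<circ>\<^sub>w prj t) \<circ>\<^sub>w (inc t \<circ>\<^sub>w g \<circ>\<^sub>w prj s) = inc u \<circ>\<^sub>w f \<circ>\<^sub>w (prj t \<circ>\<^sub>w inc t) \<circ>\<^sub>w g \<circ>\<^sub>w prj s"
    by (simp add: sp_comp_assoc)
  also have "\<dots> = kappa t *\<^sub>w (inc u \<circ>\<^sub>w (f \<circ>\<^sub>w g) \<circ>\<^sub>w prj s)"
    using ident_comp(1)[OF h(2), THEN sp_comp_ext] unfolding prj_inc by (simp add: sp_bilinear sp_comp_assoc)
  finally have "inc u \<circ>\<^sub>w (f \<circ>\<^sub>w g) \<circ>\<^sub>w prj s =
      inverse (kappa t) *\<^sub>w ((inc u \<circ>\<^sub>w f \<circ>\<^sub>w prj t) \<circ>\<^sub>w (inc t \<circ>\<^sub>w g \<circ>\<^sub>w prj s))"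
    using kappa_nonzero by simp
  moreover have "sp.G (wt s) (wt u) ((inc u \<circ>\<^sub>w f \<circ>\<^sub>w prj t) \<circ>\<^sub>w (inc t \<circ>\<^sub>w g \<circ>\<^sub>w prj s))"
    using f g unfolding single_gen_def by (blast intro: sp.G.comp)
  ultimately show ?thesis unfolding single_gen_def using Hom_comp[OF h] sp.G.scl by metis
qed

lemma single_gen_tens:
  assumes f: "single_gen s t f" and g: "single_gen s' t' g"
  shows "single_gen (s @ s') (t @ t') (f \<otimes>\<^sub>w g)"
proof -
  have h: "f \<in> Hom s t" "g \<in> Hom s' t'" using f g by (simp_all add: single_gen_def)
  have "inc (t @ t') \<circ>\<^sub>w (f \<otimes>\<^sub>w g) \<circ>\<^sub>w prj (s @ s') = (inc t \<circ>\<^sub>w f \<circ>\<^sub>w prj s) \<otimes>\<^sub>w (inc t' \<circ>\<^sub>w g \<circ>\<^sub>w prj s')"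
    unfolding inc_append prj_append sp_interchange[OF h(1) prj_Hom h(2) prj_Hom]
    by (rule sp_interchange[OF inc_Hom Hom_comp[OF h(1) prj_Hom] inc_Hom Hom_comp[OF h(2) prj_Hom]])
  then show ?thesis using f g Hom_tens[OF h] sp.G.tens unfolding single_gen_def wt_append by metis
qed

lemma single_gen_lin:
  "single_gen s t f \<Longrightarrow> single_gen s t (c *\<^sub>w f)"
  "single_gen s t f \<Longrightarrow> single_gen s t g \<Longrightarrow> single_gen s t (f + g)"
  by (auto simp: single_gen_def sp_bilinear intro: Hom_linear sp.G.scl sp.G.add)

lemma single_gen_T1: "single_gen [] [T1, T1] cupw" "single_gen [T1, T1] [] capw"
  "single_gen [T1, T1] [T2] Yw" "single_gen [T2] [T1, T1] Lw"
proof -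
  have i: "inc [T1, T1] = ident [T1, T1]" "prj [T1, T1] = ident [T1, T1]" "inc [T2] = Lw" "prj [T2] = Yw"
    by (simp_all add: ident_tens)
  have h: "cupw \<in> Hom [] [T1, T1]" "capw \<in> Hom [T1, T1] []" "Yw \<in> Hom [T1, T1] [T2]" "Lw \<in> Hom [T2] [T1, T1]"
    by (rule wtyping HOL.refl | simp)+
  have w: "wt [T1, T1] = 2" "wt [T2] = 2" by simp_all
  show "single_gen [] [T1, T1] cupw" "single_gen [T1, T1] [] capw"
  "single_gen [T1, T1] [T2] Yw" "single_gen [T2] [T1, T1] Lw"
    unfolding single_gen_def i w using h sp.G.cup sp.G.cap H_G by (simp_all add: ident_comp[OF h(1)] ident_comp[OF h(2)] ident_comp[OF h(3)] ident_comp[OF h(4)] ident_comp[OF Hom_comp[OF h(4,3)]])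
qed

lemma single_gen_turn:
  assumes "valid_piece (Vertex (xs @ [a]) ys)" "single_gen (xs @ [a]) ys (pc (Vertex (xs @ [a]) ys))" "single_gen [] [a, a] (pc (Cup a))"
  shows "single_gen xs (ys @ [a]) (pc (Vertex xs (ys @ [a])))"
  unfolding pc_turn(1)[OF assms(1), symmetric]
  using single_gen_comp[OF single_gen_tens[OF assms(2) single_gen_ident[of "[a]"]], of xs "ident xs \<otimes>\<^sub>w pc (Cup a)"]
    single_gen_tens[OF single_gen_ident[of xs] assms(3)] by simp

lemma single_gen_turn':
  assumes "valid_piece (Vertex (a # xs) ys)" "single_gen (a # xs) ys (pc (Vertex (a # xs) ys))" "single_gen [] [a, a] (pc (Cup a))"
  shows "single_gen xs (a # ys) (pc (Vertex xs (a # ys)))"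
  unfolding pc_turn(2)[OF assms(1), symmetric]
  using single_gen_comp[OF single_gen_tens[OF single_gen_ident[of "[a]"] assms(2)], of xs "pc (Cup a) \<otimes>\<^sub>w ident xs"]
    single_gen_tens[OF assms(3) single_gen_ident[of xs]] by simp

lemma single_gen_unturn:
  assumes "valid_piece (Vertex (xs @ [a]) ys)" "single_gen xs (ys @ [a]) (pc (Vertex xs (ys @ [a])))" "single_gen [a, a] [] (pc (Cap a))"
  shows "single_gen (xs @ [a]) ys (pc (Vertex (xs @ [a]) ys))"
  unfolding pc_unturn_right[OF assms(1)]
  using single_gen_comp[OF _ single_gen_tens[OF assms(2) single_gen_ident[of "[a]"]], of ys "ident ys \<otimes>\<^sub>w pc (Cap a)"]
    single_gen_tens[OF single_gen_ident[of ys] assms(3)] by simp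

lemma single_gen_unturn':
  assumes "valid_piece (Vertex (a # xs) ys)" "single_gen xs (a # ys) (pc (Vertex xs (a # ys)))" "single_gen [a, a] [] (pc (Cap a))"
  shows "single_gen (a # xs) ys (pc (Vertex (a # xs) ys))"
  unfolding pc_unturn_left[OF assms(1)]
  using single_gen_comp[OF _ single_gen_tens[OF single_gen_ident[of "[a]"] assms(2)], of ys "pc (Cap a) \<otimes>\<^sub>w ident ys"]
    single_gen_tens[OF assms(3) single_gen_ident[of ys]] by simp

lemma single_gen_up:
  "single_gen [] [T1, T1, T2] (pc (Vertex [] [T1, T1, T2]))"
  "single_gen [] [T1, T2, T1] (pc (Vertex [] [T1, T2, T1]))"
  "single_gen [] [T2, T1, T1] (pc (Vertex [] [T2, T1, T1]))"
proof -
  note c = single_gen_T1(1)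
  have 1: "single_gen [T1] [T1, T2] (pc (Vertex [T1] [T1, T2]))"
    using single_gen_turn'[OF _ single_gen_T1(3) c] by simp
  have 2: "single_gen [T1] [T2, T1] (pc (Vertex [T1] [T2, T1]))"
    using single_gen_turn[of "[T1]" T1 "[T2]"] single_gen_T1(3) c by simp
  show "single_gen [] [T1, T1, T2] (pc (Vertex [] [T1, T1, T2]))"
    using single_gen_turn'[OF _ 1 c] by simp
  show "single_gen [] [T1, T2, T1] (pc (Vertex [] [T1, T2, T1]))"
    using single_gen_turn[of "[]" T1 "[T1, T2]"] 1 c by simp
  show "single_gen [] [T2, T1, T1] (pc (Vertex [] [T2, T1, T1]))"
    using single_gen_turn[of "[]" T1 "[T2, T1]"] 2 c by simp
qed

text \<open>Up to the bigon factor, a double cup is the vertex with three upward legs with its two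
  single legs merged.\<close>

lemma single_gen_Cup_T2: "single_gen [] [T2, T2] (pc (Cup T2))"
proof -
  let ?i = "ident [T2]" and ?c = "- ((qint 2)\<^sup>2)"
  have "pc (Vertex [] [T1, T1, T2]) = (Lw \<otimes>\<^sub>w ?i) \<circ>\<^sub>w pc (Cup T2)"
    using pc_turn(1)[of "[]" T2 "[T1, T1]"] by simp
  then have "(Yw \<otimes>\<^sub>w ?i) \<circ>\<^sub>w pc (Vertex [] [T1, T1, T2]) = ((Yw \<circ>\<^sub>w Lw) \<otimes>\<^sub>w ?i) \<circ>\<^sub>w pc (Cup T2)"
    using sp_comp_tens_ident[OF YL_Hom(1)[OF HOL.refl HOL.refl] YL_Hom(2)[OF HOL.refl HOL.refl], THEN sp_comp_ext] by simp
  also have "\<dots> = ?c *\<^sub>w pc (Cup T2)"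
    unfolding web_relations(3) using ident_comp(1)[OF Hom_cup_cap(1)[OF HOL.refl HOL.refl, of T2]]
    by (simp only: sp_bilinear ident_tens append_Cons append_Nil)
  finally have "pc (Cup T2) = inverse ?c *\<^sub>w ((Yw \<otimes>\<^sub>w ?i) \<circ>\<^sub>w pc (Vertex [] [T1, T1, T2]))"
    using qint_nonzero[of 2] by (simp only: spider.scale_scale) simp
  moreover have "single_gen [] [T2, T2] ((Yw \<otimes>\<^sub>w ?i) \<circ>\<^sub>w pc (Vertex [] [T1, T1, T2]))"
    using single_gen_comp[OF single_gen_tens[OF single_gen_T1(3) single_gen_ident[of "[T2]"]]] single_gen_up(1) by simp
  ultimately show ?thesis using single_gen_lin(1) by metis
qed

lemma single_gen_Cap_T2: "single_gen [T2, T2] [] (pc (Cap T2))"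
proof -
  let ?i = "ident [T2]" and ?c = "- ((qint 2)\<^sup>2)" and ?V = "pc (Vertex [T1, T1, T2] [])"
  have 1: "single_gen [T1, T2] [T1] (pc (Vertex [T1, T2] [T1]))"
    using single_gen_unturn'[OF _ single_gen_T1(4) single_gen_T1(2)] by simp
  have 2: "single_gen [T1, T1, T2] [] ?V"
    using single_gen_unturn'[OF _ 1 single_gen_T1(2)] by simp
  have "?V = pc (Cap T2) \<circ>\<^sub>w (Yw \<otimes>\<^sub>w ?i)"
    using pc_unturn_right[of "[T1, T1]" T2 "[]"] by simp
  then have "?V \<circ>\<^sub>w (Lw \<otimes>\<^sub>w ?i) = pc (Cap T2) \<circ>\<^sub>w ((Yw \<circ>\<^sub>w Lw) \<otimes>\<^sub>w ?i)"
    using sp_comp_tens_ident[OF YL_Hom(1)[OF HOL.refl HOL.refl] YL_Hom(2)[OF HOL.refl HOL.refl]] by (simp add: sp_comp_assoc)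
  also have "\<dots> = ?c *\<^sub>w pc (Cap T2)"
    unfolding web_relations(3) using ident_comp(2)[OF Hom_cup_cap(2)[OF HOL.refl HOL.refl, of T2]]
    by (simp only: sp_bilinear ident_tens append_Cons append_Nil)
  finally have "pc (Cap T2) = inverse ?c *\<^sub>w (?V \<circ>\<^sub>w (Lw \<otimes>\<^sub>w ?i))"
    using qint_nonzero[of 2] by (simp only: spider.scale_scale) simp
  moreover have "single_gen [T2, T2] [] (?V \<circ>\<^sub>w (Lw \<otimes>\<^sub>w ?i))"
    using single_gen_comp[OF 2, of "[T2, T2]" "Lw \<otimes>\<^sub>w ?i"] single_gen_tens[OF single_gen_T1(4) single_gen_ident[of "[T2]"]] by simp
  ultimately show ?thesis using single_gen_lin(1) by metis
qed

lemma single_gen_cup_cap: "single_gen [] [a, a] (pc (Cup a))" "single_gen [a, a] [] (pc (Cap a))"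
  by (cases a; simp add: single_gen_T1 single_gen_Cup_T2 single_gen_Cap_T2)+

lemma mset_T1_T1_T2:
  "mset ys = {#T1, T1, T2#} \<longleftrightarrow> ys = [T1, T1, T2] \<or> ys = [T1, T2, T1] \<or> ys = [T2, T1, T1]"
proof
  assume m: "mset ys = {#T1, T1, T2#}"
  then have "length ys = 3" by (metis size_mset size_add_mset size_empty numeral_3_eq_3)
  then obtain a b c where ys: "ys = [a, b, c]" by (auto simp: numeral_3_eq_3 length_Suc_conv)
  show "ys = [T1, T1, T2] \<or> ys = [T1, T2, T1] \<or> ys = [T2, T1, T1]"
    using m unfolding ys by (cases a; cases b; cases c) (auto simp: add_eq_conv_ex)
qed auto

text \<open>The lower legs are bent up one after another, which leaves the three vertices whose legs
  all point upwards.\<close>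

lemma single_gen_Vertex: "valid_piece (Vertex xs ys) \<Longrightarrow> single_gen xs ys (pc (Vertex xs ys))"
proof (induction xs arbitrary: ys rule: rev_induct)
  case Nil
  then show ?case using single_gen_up by (auto simp: mset_T1_T1_T2)
next
  case (snoc a xs)
  then show ?case by (intro single_gen_unturn single_gen_cup_cap) (auto simp: ac_simps)
qed

lemma single_gen_piece: "valid_piece p \<Longrightarrow> single_gen (piece_bot p) (piece_top p) (pc p)"
  using single_gen_cup_cap single_gen_Vertex by (cases p) auto

lemma Abs_diagram_Cons:
  assumes "layers s ((l, p, r) # ls) t"
  shows "Abs_diagram (s, (l, p, r) # ls, t) =
    dcomp (Abs_diagram (l @ piece_top p @ r, ls, t)) (dtens (did l) (dtens (dpiece p) (did r)))"
proof -
  have v: "valid_piece p" "s = l @ piece_bot p @ r" "layers (l @ piece_top p @ r) ls t" using assms by auto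
  show ?thesis
    using assms v
    by (auto simp: Rep_diagram_inject[symmetric] dcomp.rep_eq dtens.rep_eq did.rep_eq dpiece.rep_eq Abs_diagram_inverse)
qed

lemma single_gen_layers: "layers s ls t \<Longrightarrow> single_gen s t (of_web (abs_web (Abs_diagram (s, ls, t))))"
proof (induction s ls t rule: layers.induct)
  case (1 s t)
  then have "abs_web (Abs_diagram (s, [], t)) = wid t"
    by (simp add: wid.abs_eq[symmetric] wid_def did_def)
  then show ?case using single_gen_ident[of t] 1 by (simp add: ident_def)
next
  case (2 s l p r ls t)
  let ?u = "l @ piece_top p @ r" and ?d = "Abs_diagram (l @ piece_top p @ r, ls, t)"
  have v: "valid_piece p" "s = l @ piece_bot p @ r" "layers ?u ls t" using 2 by auto
  have d: "dbot ?d = ?u" using v by (simp add: dbot.rep_eq Abs_diagram_inverse)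
  have "abs_web (Abs_diagram (s, (l, p, r) # ls, t)) = wcomp (abs_web ?d) (wtens (wid l) (wtens (wpiece p) (wid r)))"
    unfolding Abs_diagram_Cons[OF 2(2)] by (simp add: wcomp.abs_eq wtens.abs_eq wid.abs_eq wpiece.abs_eq)
  moreover have "wbot (abs_web ?d) = ?u" using d by (simp add: wbot.abs_eq)
  ultimately have "of_web (abs_web (Abs_diagram (s, (l, p, r) # ls, t))) =
      of_web (abs_web ?d) \<circ>\<^sub>w (ident l \<otimes>\<^sub>w (pc p \<otimes>\<^sub>w ident r))"
    using v by (simp add: of_web_comp of_web_tens ident_def)
  moreover have "single_gen s ?u (ident l \<otimes>\<^sub>w (pc p \<otimes>\<^sub>w ident r))"
    using single_gen_tens[OF single_gen_ident[of l] single_gen_tens[OF single_gen_piece[OF v(1)] single_gen_ident[of r]]] v by simp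
  ultimately show ?case using single_gen_comp 2(1)[OF v(3)] by metis
qed

lemma Hom_single_gen: "f \<in> Hom s t \<Longrightarrow> single_gen s t f"
proof (induction rule: Hom_induct)
  case zero
  show ?case by (simp add: single_gen_def Hom_linear sp.G.zero)
next
  case (web x)
  have "\<exists>d. x = abs_web d" by (induction x rule: web.abs_induct) auto
  then obtain d where d: "x = abs_web d" ..
  obtain s' ls t' where r: "Rep_diagram d = (s', ls, t')" by (cases "Rep_diagram d")
  then have l: "layers s' ls t'" using Rep_diagram[of d] by simp
  have "d = Abs_diagram (s', ls, t')" using r by (metis Rep_diagram_inverse)
  moreover have "s' = s" "t' = t" using web r by (auto simp: d wbot.abs_eq wtop.abs_eq dbot.rep_eq dtop.rep_eq)
  ultimately show ?case using single_gen_layers[OF l] d by simp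
qed (simp_all add: single_gen_lin)

lemma Hom_G: "f \<in> Hom (replicate n T1) t \<Longrightarrow> sp.G n (wt t) (inc t \<circ>\<^sub>w f)"
  "f \<in> Hom t (replicate n T1) \<Longrightarrow> sp.G (wt t) n (f \<circ>\<^sub>w prj t)"
proof -
  assume f: "f \<in> Hom (replicate n T1) t"
  show "sp.G n (wt t) (inc t \<circ>\<^sub>w f)"
    using Hom_single_gen[OF f] ident_comp(2)[OF f] by (simp add: single_gen_def wt_replicate inc_prj_replicate idn1_def)
next
  assume f: "f \<in> Hom t (replicate n T1)"
  have "f \<circ>\<^sub>w prj t \<in> Hom (replicate (wt t) T1) (replicate n T1)" by (rule Hom_comp[OF f prj_Hom])
  then show "sp.G (wt t) n (f \<circ>\<^sub>w prj t)"
    using Hom_single_gen[OF f] ident_comp(1) by (simp add: single_gen_def wt_replicate inc_prj_replicate idn1_def)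
qed

lemma G_opposite: "sp.G m n f \<Longrightarrow> opp.G n m f"
  by (induction rule: sp.G.induct) (auto intro: opp.G.intros)

section \<open>A representation on labelled words\<close>

text \<open>The weight bases of the 4- and the 5-dimensional representation, by decreasing weight.\<close>

datatype lab = A1 | A2 | A3 | A4 | B1 | B2 | B3 | B4 | B5

text \<open>The label of opposite weight, with which a cup or a cap pairs a given label.\<close>

fun bar :: "lab \<Rightarrow> lab" where
  "bar A1 = A4" | "bar A2 = A3" | "bar A3 = A2" | "bar A4 = A1"
| "bar B1 = B5" | "bar B2 = B4" | "bar B3 = B3" | "bar B4 = B2" | "bar B5 = B1"

fun cupc :: "lab \<Rightarrow> K" where
  "cupc A1 = - (v ^ 2)" | "cupc A2 = - v" | "cupc A3 = inverse v" | "cupc A4 = inverse v ^ 2"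
| "cupc B1 = - (qint 2 * v ^ 4)" | "cupc B2 = qint 2 * v ^ 2" | "cupc B3 = 1" | "cupc B4 = qint 2"
| "cupc B5 = - (qint 2 * inverse v ^ 2)"

text \<open>Forced by the straightening of a cap against a cup.\<close>

definition capc :: "lab \<Rightarrow> K" where
  "capc l = inverse (cupc (bar l))"

text \<open>The weight of the pair \<open>i\<close>, \<open>j\<close> determines the vector whose
  split contains it, because the weight spaces of the 5-dimensional representation are
  one-dimensional. The default label only ever meets the coefficient 0 in
  \<open>outc\<close>.\<close>

fun outl :: "lab \<Rightarrow> lab \<Rightarrow> lab" where
  "outl A1 A2 = B1" | "outl A2 A1 = B1" | "outl A1 A3 = B2" | "outl A3 A1 = B2"
| "outl A2 A4 = B4" | "outl A4 A2 = B4" | "outl A3 A4 = B5" | "outl A4 A3 = B5"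
| "outl A1 A4 = B3" | "outl A2 A3 = B3" | "outl A3 A2 = B3" | "outl A4 A1 = B3"
| "outl x y = A1"

fun outc :: "lab \<Rightarrow> lab \<Rightarrow> K" where
  "outc A1 A2 = 1" | "outc A2 A1 = - inverse v" | "outc A1 A3 = 1" | "outc A3 A1 = - inverse v"
| "outc A2 A4 = 1" | "outc A4 A2 = - inverse v" | "outc A3 A4 = 1" | "outc A4 A3 = - inverse v"
| "outc A1 A4 = 1" | "outc A2 A3 = - v" | "outc A3 A2 = inverse v" | "outc A4 A1 = - 1"
| "outc x y = 0"

primrec sumL :: "strand \<Rightarrow> (lab \<Rightarrow> K) \<Rightarrow> K" where
  "sumL T1 g = g A1 + g A2 + g A3 + g A4"
| "sumL T2 g = g B1 + g B2 + g B3 + g B4 + g B5"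

primrec inl :: "strand \<Rightarrow> lab \<Rightarrow> bool" where
  "inl T1 l \<longleftrightarrow> l = A1 \<or> l = A2 \<or> l = A3 \<or> l = A4"
| "inl T2 l \<longleftrightarrow> l = B1 \<or> l = B2 \<or> l = B3 \<or> l = B4 \<or> l = B5"

text \<open>The vertex with all three legs pointing up, the double leg last: a double cup followed
  by a split of its left leg, which carries the label \<open>bar k\<close>.\<close>

definition T3 :: "lab \<Rightarrow> lab \<Rightarrow> lab \<Rightarrow> K" where
  "T3 i j k = (if outl i j = bar k then outc i j * cupc (bar k) else 0)"

text \<open>The pivotal element in the weight basis: the factor that arises when a leg of a vertex
  passes from the left end to the right end. Summed over a representation it gives the value of the
  loop.\<close>

definition twist :: "lab \<Rightarrow> K" where
  "twist l = capc l * cupc l"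

text \<open>The other two orders of the legs are rotated to the order of \<open>T3\<close>, and each
  leg that moves from the front to the end contributes its twist.\<close>

definition T :: "word \<Rightarrow> lab list \<Rightarrow> K" where
  "T w x = (if w = [T1, T1, T2] then T3 (x ! 0) (x ! 1) (x ! 2)
    else if w = [T2, T1, T1] then T3 (x ! 1) (x ! 2) (x ! 0) * twist (x ! 0)
    else T3 (x ! 2) (x ! 0) (x ! 1) * twist (x ! 1) * twist (x ! 0))"

text \<open>The lower legs of a vertex are bent up at its right, which reverses their order and
  replaces their labels by the opposite ones; the product collects the caps that bend them down
  again.\<close>

primrec entry :: "piece \<Rightarrow> lab list \<Rightarrow> lab list \<Rightarrow> K" where
  "entry (Cup a) x y = (if y ! 1 = bar (y ! 0) then cupc (y ! 0) else 0)"
| "entry (Cap a) x y = (if x ! 1 = bar (x ! 0) then capc (x ! 0) else 0)"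
| "entry (Vertex xs ys) x y = T (ys @ rev xs) (y @ rev (map bar x)) * prod_list (map (capc \<circ> bar) x)"

primrec sumw :: "word \<Rightarrow> (lab list \<Rightarrow> K) \<Rightarrow> K" where
  "sumw [] g = g []"
| "sumw (a # w) g = sumL a (\<lambda>l. sumw w (\<lambda>x. g (l # x)))"

abbreviation st :: "word \<Rightarrow> lab list \<Rightarrow> bool" where
  "st \<equiv> list_all2 inl"

section \<open>Sums over labels and labelled words\<close>

lemma bar_bar [simp]: "bar (bar l) = l"
  by (cases l) auto

lemma inl_bar: "inl a l \<Longrightarrow> inl a (bar l)"
  by (cases a; cases l) auto

lemma cupc_nonzero [simp]: "cupc l \<noteq> 0"
  using qint_nonzero[of 2] by (cases l) auto

lemma sumL_cong: "(\<And>l. inl a l \<Longrightarrow> g l = h l) \<Longrightarrow> sumL a g = sumL a h"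
  by (cases a) auto

lemma sumL_lin: "sumL a (\<lambda>l. g l + h l) = sumL a g + sumL a h" "sumL a (\<lambda>l. c * g l) = c * sumL a g"
  "sumL a (\<lambda>l. 0) = 0"
  by (cases a; simp add: algebra_simps)+

lemma sumL_swap: "sumL a (\<lambda>l. sumL b (\<lambda>l'. g l l')) = sumL b (\<lambda>l'. sumL a (\<lambda>l. g l l'))"
  by (cases a; cases b) (simp_all add: algebra_simps)

lemma sumL_delta: "inl a c \<Longrightarrow> sumL a (\<lambda>l. if l = c then g l else 0) = g c"
  by (cases a; cases c) simp_all

lemma sumw_cong: "(\<And>x. st w x \<Longrightarrow> g x = h x) \<Longrightarrow> sumw w g = sumw w h"
proof (induction w arbitrary: g h)
  case (Cons a w)
  show ?case unfolding sumw.simps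
    by (rule sumL_cong, rule Cons.IH) (simp add: Cons.prems)
qed simp

lemma sumw_lin: "sumw w (\<lambda>x. g x + h x) = sumw w g + sumw w h" "sumw w (\<lambda>x. c * g x) = c * sumw w g"
  "sumw w (\<lambda>x. 0) = 0"
proof -
  show "sumw w (\<lambda>x. g x + h x) = sumw w g + sumw w h"
    by (induction w arbitrary: g h) (simp_all add: sumL_lin(1))
  show "sumw w (\<lambda>x. c * g x) = c * sumw w g"
    by (induction w arbitrary: g) (simp_all add: sumL_lin(2))
  show "sumw w (\<lambda>x. 0) = 0"
    by (induction w) (simp_all add: sumL_lin(3))
qed

lemma sumw_sumL: "sumw w (\<lambda>x. sumL a (\<lambda>l. g x l)) = sumL a (\<lambda>l. sumw w (\<lambda>x. g x l))"
proof (induction w arbitrary: g)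
  case (Cons b w)
  have "sumw (b # w) (\<lambda>x. sumL a (\<lambda>l. g x l)) = sumL b (\<lambda>l'. sumL a (\<lambda>l. sumw w (\<lambda>x. g (l' # x) l)))"
    by (simp add: Cons.IH)
  also have "\<dots> = sumL a (\<lambda>l. sumL b (\<lambda>l'. sumw w (\<lambda>x. g (l' # x) l)))" by (rule sumL_swap)
  finally show ?case by simp
qed simp

lemma sumw_append: "sumw (s @ t) g = sumw s (\<lambda>x. sumw t (\<lambda>y. g (x @ y)))"
  by (induction s arbitrary: g) auto

lemma sumw_delta: "st w z \<Longrightarrow> sumw w (\<lambda>x. if x = z then g x else 0) = g z"
proof (induction w arbitrary: z g)
  case (Cons a w)
  then obtain c y where z: "z = c # y" "inl a c" "st w y" by (auto simp: list_all2_Cons1)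
  have "sumw (a # w) (\<lambda>x. if x = z then g x else 0) =
    sumL a (\<lambda>l. if l = c then sumw w (\<lambda>x. if x = y then g (l # x) else 0) else 0)"
    unfolding z by (auto simp: sumw_lin intro!: sumL_cong)
  also have "\<dots> = g z" using Cons.IH[OF z(3), of "\<lambda>x. g (c # x)"] z by (simp add: sumL_delta)
  finally show ?case .
qed simp

text \<open>A layer turns a coefficient function on the labels below it into one on the labels above
  it; vertical strands keep their labels.\<close>

fun opl :: "layer \<Rightarrow> (lab list \<Rightarrow> K) \<Rightarrow> lab list \<Rightarrow> K" where
  "opl (l, p, r) f y = sumw (piece_bot p) (\<lambda>x.
     entry p x (take (length (piece_top p)) (drop (length l) y)) *
       f (take (length l) y @ x @ drop (length l + length (piece_top p)) y))"

primrec F :: "layer list \<Rightarrow> (lab list \<Rightarrow> K) \<Rightarrow> lab list \<Rightarrow> K" where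
  "F [] f = f"
| "F (L # ls) f = F ls (opl L f)"

lemma F_append: "F (ls @ ls') f = F ls' (F ls f)"
  by (induction ls arbitrary: f) auto

lemma opl_split:
  "length x = length l \<Longrightarrow> length y = length (piece_top p) \<Longrightarrow>
    opl (l, p, r) f (x @ y @ z) = sumw (piece_bot p) (\<lambda>u. entry p u y * f (x @ u @ z))"
  by simp

lemma st_append: "st (s @ t) z \<Longrightarrow> \<exists>x y. z = x @ y \<and> st s x \<and> st t y"
  by (auto simp: list_all2_append1)

lemma st_appendI: "st s x \<Longrightarrow> st t y \<Longrightarrow> st (s @ t) (x @ y)"
  by (rule list_all2_appendI)

lemma st_length: "st s x \<Longrightarrow> length x = length s"
  by (simp add: list_all2_lengthD)

lemma st3:
  assumes "st (l @ t @ r) w"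
  obtains x y z where "w = x @ y @ z" "st l x" "st t y" "st r z"
  using st_append[OF assms] st_append by blast

text \<open>Coefficient functions are defined on all lists of labels, but a diagram sees only the
  lists that fit its bottom boundary.\<close>

lemma F_cong:
  "layers s ls t \<Longrightarrow> (\<And>x. st s x \<Longrightarrow> f x = g x) \<Longrightarrow> st t y \<Longrightarrow> F ls f y = F ls g y"
proof (induction s ls t arbitrary: f g rule: layers.induct)
  case (2 s l p r ls t)
  have *: "opl (l, p, r) f w = opl (l, p, r) g w" if stw: "st (l @ piece_top p @ r) w" for w
  proof -
    obtain x y z where w: "w = x @ y @ z" "st l x" "st (piece_top p) y" "st r z" using stw by (rule st3)
    have eq: "f (x @ u @ z) = g (x @ u @ z)" if "st (piece_bot p) u" for u
      by (rule 2(3)) (use 2(2) w that in \<open>auto intro!: st_appendI\<close>)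
    show ?thesis unfolding w(1) opl_split[OF st_length[OF w(2)] st_length[OF w(3)]]
      by (rule sumw_cong) (simp only: eq)
  qed
  have "layers (l @ piece_top p @ r) ls t" using 2(2) by simp
  from "2.IH"[OF this * 2(4)] show ?case by (simp only: F.simps)
qed simp

lemma F_pad:
  "layers s ls t \<Longrightarrow> st a x \<Longrightarrow> st b z \<Longrightarrow> st t y \<Longrightarrow>
    F (map (pad a b) ls) f (x @ y @ z) = F ls (\<lambda>u. f (x @ u @ z)) y"
proof (induction s ls t arbitrary: f rule: layers.induct)
  case (2 s l p r ls t)
  have l: "layers (l @ piece_top p @ r) ls t" using 2 by simp
  have "F (map (pad a b) ((l, p, r) # ls)) f (x @ y @ z) = F ls (\<lambda>u. opl (a @ l, p, r @ b) f (x @ u @ z)) y"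
    using 2 l by (simp del: opl.simps)
  also have "\<dots> = F ls (opl (l, p, r) (\<lambda>u. f (x @ u @ z))) y"
  proof (rule F_cong[OF l])
    fix w assume "st (l @ piece_top p @ r) w"
    then obtain x' y' z' where w: "w = x' @ y' @ z'" "st l x'" "st (piece_top p) y'" "st r z'" by (rule st3)
    show "opl (a @ l, p, r @ b) f (x @ w @ z) = opl (l, p, r) (\<lambda>u. f (x @ u @ z)) w"
      using w 2(3) opl_split[of "x @ x'" "a @ l" y' p "r @ b" f "z' @ z"] opl_split[of x' l y' p r "\<lambda>u. f (x @ u @ z)" z']
      by (simp add: st_length del: opl.simps)
  qed (rule 2)
  finally show ?case by (simp del: opl.simps)
qed simp

text \<open>Linearity in the form of a sum over words serves two purposes: it expands the action of
  a diagram in matrix entries, and it lets the action of one layer pass through that of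
  another.\<close>

lemma opl_lin: "opl L (\<lambda>x. sumw w (\<lambda>z. c z * g z x)) y = sumw w (\<lambda>z. c z * opl L (g z) y)"
proof (cases L)
  case (fields l p r)
  have swap: "sumw s (\<lambda>x. sumw w (\<lambda>z. h x z)) = sumw w (\<lambda>z. sumw s (\<lambda>x. h x z))" for s h
    by (induction w arbitrary: h) (simp_all add: sumw_sumL)
  show ?thesis
    unfolding fields opl.simps sumw_lin(2)[symmetric] by (subst swap) (simp add: mult_ac)
qed

lemma F_lin: "F ls (\<lambda>x. sumw w (\<lambda>z. c z * g z x)) y = sumw w (\<lambda>z. c z * F ls (g z) y)"
proof (induction ls arbitrary: g y)
  case (Cons L ls)
  have "opl L (\<lambda>x. sumw w (\<lambda>z. c z * g z x)) = (\<lambda>y. sumw w (\<lambda>z. c z * opl L (g z) y))"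
    by (rule ext) (rule opl_lin)
  then show ?case unfolding F.simps by (simp only: Cons.IH)
qed simp

text \<open>The two actions are linear and concern different arguments of \<open>f\<close>. This is
  what makes the heights of juxtaposed pieces immaterial.\<close>

lemma F_commute: "F ls (\<lambda>x'. F ls' (f x') y) x = F ls' (\<lambda>y'. F ls (\<lambda>x'. f x' y') x) y"
proof (induction ls' arbitrary: f)
  case (Cons L ls')
  have *: "F ls (\<lambda>x'. opl L (f x') y') x = opl L (\<lambda>y'. F ls (\<lambda>x'. f x' y') x) y'" for y'
  proof (cases L)
    case (fields l p r)
    show ?thesis unfolding fields opl.simps
      by (rule F_lin)
  qed
  have "(\<lambda>y'. F ls (\<lambda>x'. opl L (f x') y') x) = opl L (\<lambda>y'. F ls (\<lambda>x'. f x' y') x)"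
    by (rule ext) (rule *)
  then show ?case unfolding F.simps using Cons.IH[of "\<lambda>x'. opl L (f x')"] by (simp only:)
qed simp

lift_definition Fd :: "diagram \<Rightarrow> (lab list \<Rightarrow> K) \<Rightarrow> lab list \<Rightarrow> K" is "\<lambda>(s, ls, t). F ls" .

lemma Fd_did: "Fd (did s) f = f"
  by (simp add: Fd.rep_eq did.rep_eq)

lemma Fd_comp: "dbot d = dtop e \<Longrightarrow> Fd (dcomp d e) f = Fd d (Fd e f)"
  by (cases "Rep_diagram d"; cases "Rep_diagram e") (simp add: Fd.rep_eq dcomp.rep_eq dbot.rep_eq dtop.rep_eq F_append)

lemma Fd_cong:
  assumes "\<And>x. st (dbot d) x \<Longrightarrow> f x = g x" "st (dtop d) y"
  shows "Fd d f y = Fd d g y"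
proof -
  obtain s ls t where d: "Rep_diagram d = (s, ls, t)" by (cases "Rep_diagram d")
  have l: "layers s ls t" "Fd d = F ls" "dbot d = s" "dtop d = t"
    using Rep_diagram[of d] by (simp_all add: d Fd.rep_eq dbot.rep_eq dtop.rep_eq)
  show ?thesis unfolding l(2) by (rule F_cong[OF l(1)]) (use assms l in auto)
qed

lemma Fd_F: "\<exists>ls. Fd d = F ls"
  by (cases "Rep_diagram d") (auto simp: Fd.rep_eq)

lemma Fd_lin: "Fd d (\<lambda>x. sumw w (\<lambda>z. c z * g z x)) y = sumw w (\<lambda>z. c z * Fd d (g z) y)"
proof -
  obtain ls where l: "Fd d = F ls" using Fd_F by blast
  show ?thesis unfolding l by (rule F_lin)
qed

lemma Fd_commute: "Fd d (\<lambda>x'. Fd e (f x') y) x = Fd e (\<lambda>y'. Fd d (\<lambda>x'. f x' y') x) y"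
proof -
  obtain ls ls' where l: "Fd d = F ls" "Fd e = F ls'" using Fd_F by blast
  show ?thesis unfolding l by (rule F_commute)
qed

lemma Fd_tens:
  assumes "st (dtop d) x" "st (dtop e) y"
  shows "Fd (dtens d e) f (x @ y) = Fd d (\<lambda>x'. Fd e (\<lambda>y'. f (x' @ y')) y) x"
proof -
  obtain s ls t where d: "Rep_diagram d = (s, ls, t)" by (cases "Rep_diagram d")
  obtain s' ls' t' where e: "Rep_diagram e = (s', ls', t')" by (cases "Rep_diagram e")
  have l: "layers s ls t" "layers s' ls' t'" "st t x" "st t' y"
    using Rep_diagram[of d] Rep_diagram[of e] assms by (simp_all add: d e dtop.rep_eq)
  have "F (map (pad s []) ls' @ map (pad [] t') ls) f (x @ y) = F ls (\<lambda>u. F (map (pad s []) ls') f (u @ y)) x"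
    using F_pad[OF l(1), of "[]" "[]" t' y x] l by (simp add: F_append)
  also have "\<dots> = F ls (\<lambda>x'. F ls' (\<lambda>y'. f (x' @ y')) y) x"
    by (rule F_cong[OF l(1) _ l(3)]) (use F_pad[OF l(2) _ _ l(4), of s _ "[]" "[]"] in simp)
  finally show ?thesis by (simp add: Fd.rep_eq dtens.rep_eq d e)
qed

section \<open>Evaluation of single pieces, and turning of vertices\<close>

definition psum :: "piece \<Rightarrow> lab list \<Rightarrow> (lab list \<Rightarrow> K) \<Rightarrow> K" where
  "psum p y f = sumw (piece_bot p) (\<lambda>x. entry p x y * f x)"

text \<open>As a congruence rule it keeps the simplifier out of the function argument until the
  outer piece has been evaluated.\<close>

lemma psum_weak_cong: "y = y' \<Longrightarrow> psum p y f = psum p y' f"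
  by simp

lemma opl_psum: "opl (l, p, r) f y = psum p (take (length (piece_top p)) (drop (length l) y))
    (\<lambda>x. f (take (length l) y @ x @ drop (length l + length (piece_top p)) y))"
  by (simp add: psum_def)

lemma capc_cupc [simp]: "capc (bar l) * cupc l = 1" "cupc l * capc (bar l) = 1" "cupc (bar l) * capc l = 1" "capc l * cupc (bar l) = 1"
  by (simp_all add: capc_def)

lemma capc_cancel':
  "cupc l * capc (bar l) = 1" "cupc l * (capc (bar l) * z) = z"
  by (simp_all flip: mult.assoc)

lemmas capc_cancel = capc_cancel'[of B1, unfolded bar.simps] capc_cancel'[of B2, unfolded bar.simps]
  capc_cancel'[of B3, unfolded bar.simps] capc_cancel'[of B4, unfolded bar.simps] capc_cancel'[of B5, unfolded bar.simps]

lemma cupc_twist: "cupc (bar l) * twist l = cupc l"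
  by (simp add: twist_def capc_def)

lemma psum_Cap: "psum (Cap a) [] f = sumL a (\<lambda>i. capc i * f [i, bar i])"
  by (cases a) (simp_all add: psum_def)

lemma psum_Cup: "psum (Cup a) [i, j] f = (if j = bar i then cupc i * f [] else 0)"
  by (simp add: psum_def)

lemma psum_L: "inl T1 i \<Longrightarrow> inl T1 j \<Longrightarrow> psum (Vertex [T2] [T1, T1]) [i, j] f = outc i j * f [outl i j]"
  by (cases i; cases j) (simp_all add: psum_def T_def T3_def capc_cancel mult.assoc del: cupc.simps)

lemma psum_Y: "psum (Vertex [T1, T1] [T2]) [k] f = sumL T1 (\<lambda>i. sumL T1 (\<lambda>j.
    if outl (bar j) (bar i) = bar k then outc (bar j) (bar i) * cupc k * capc (bar i) * capc (bar j) * f [i, j] else 0))"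
  unfolding cupc_twist[of k, symmetric] by (simp add: psum_def T_def T3_def)

lemma psum_C: "psum (Vertex [T1] [T2, T1]) [k, j] f = sumL T1 (\<lambda>i.
    if outl j (bar i) = bar k then outc j (bar i) * cupc k * capc (bar i) * f [i] else 0)"
  unfolding cupc_twist[of k, symmetric] by (simp add: psum_def T_def T3_def)

lemma psum_A: "psum (Vertex [T1] [T1, T2]) [j, k] f = sumL T1 (\<lambda>i.
    if outl (bar i) j = bar k then outc (bar i) j * cupc k * twist j * capc (bar i) * f [i] else 0)"
  unfolding cupc_twist[of k, symmetric] by (simp add: psum_def T_def T3_def)

lemma psum_B: "inl T1 y \<Longrightarrow> psum (Vertex [T2, T1] [T1]) [y] f = sumL T1 (\<lambda>j. outc y (bar j) * capc (bar j) * f [outl y (bar j), j])"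
  by (cases y) (simp_all add: psum_def T_def T3_def capc_cancel mult.assoc del: cupc.simps)

lemmas psum_rules = psum_Cap psum_Cup psum_L psum_Y psum_C psum_A psum_B

text \<open>Up to sign the twist is multiplicative in the weight, and the labels at a nonzero vertex
  have total weight zero. The negative signs of the two single labels cancel.\<close>

lemma twist_product:
  "inl T1 i \<Longrightarrow> inl T1 j \<Longrightarrow> inl T2 k \<Longrightarrow> outl i j = bar k \<Longrightarrow> twist i * twist j * twist k = 1"
  using qint_nonzero[of 2] by (cases i; cases j; cases k) (simp_all add: twist_def capc_def field_simps eval_nat_numeral)

text \<open>Three rotations return a vertex to its original position, so consistency amounts to the
  product of its three twists being 1.\<close>

lemma T_cyclic:
  assumes m: "mset (a # w) = {#T1, T1, T2#}" and s: "st (a # w) (c # u)"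
  shows "T (a # w) (c # u) = T (w @ [a]) (u @ [c]) * twist c"
proof -
  have key: "T3 i j k = T3 i j k * twist k * twist j * twist i" if "inl T1 i" "inl T1 j" "inl T2 k" for i j k
    using twist_product[OF that] by (simp add: T3_def mult_ac)
  show ?thesis
    using m[unfolded mset_T1_T1_T2] s key by (auto simp: T_def list_all2_Cons1 simp del: inl.simps)
qed

lemma entry_turn:
  "length x = length xs \<Longrightarrow> length y = length ys \<Longrightarrow>
    entry (Vertex (xs @ [a]) ys) (x @ [bar c]) y * cupc (bar c) = entry (Vertex xs (ys @ [a])) x (y @ [c])"
  by (simp add: mult_ac)

text \<open>In \<open>entry\<close> all lower legs are bent up on the right, so the leftmost one
  comes last. Turning it up on the left moves it round the whole vertex, hence the appeal to cyclic
  invariance.\<close>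

lemma entry_turn':
  assumes "valid_piece (Vertex (a # xs) ys)" "st xs x" "st ys y" "inl a c"
  shows "entry (Vertex (a # xs) ys) (bar c # x) y * cupc c = entry (Vertex xs (a # ys)) x (c # y)"
proof -
  have "st xs (map bar x)" using assms(2) by (auto simp: list_all2_map2 inl_bar elim: list_all2_mono)
  then have "st (rev xs) (rev (map bar x))" by (simp only: list_all2_rev)
  from st_appendI[OF assms(3) this] have "st (a # (ys @ rev xs)) (c # (y @ rev (map bar x)))"
    using assms(4) by simp
  moreover have "mset (a # (ys @ rev xs)) = {#T1, T1, T2#}" using assms(1) by (simp add: ac_simps)
  ultimately show ?thesis using T_cyclic[of a "ys @ rev xs" c "y @ rev (map bar x)"]
    by (simp add: twist_def mult_ac)
qed

lemma sumL_bar_delta: "inl a c \<Longrightarrow> sumL a (\<lambda>b. if c = bar b then g b else 0) = g (bar c)"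
  "inl a c \<Longrightarrow> sumL a (\<lambda>b. if b = bar c then g b else 0) = g (bar c)"
  by (cases a; cases c; simp)+

lemma Fd_turn_right:
  assumes v: "valid_piece (Vertex (xs @ [a]) ys)" and y: "st (ys @ [a]) y"
  shows "Fd (dcomp (dtens (dpiece (Vertex (xs @ [a]) ys)) (did [a])) (dtens (did xs) (dpiece (Cup a)))) f y
    = Fd (dpiece (Vertex xs (ys @ [a]))) f y"
proof -
  let ?V = "Vertex (xs @ [a]) ys" and ?V' = "Vertex xs (ys @ [a])"
  have v': "valid_piece ?V'" using v by (simp add: ac_simps)
  obtain y' c where yc: "y = y' @ [c]" "st ys y'" "inl a c"
    using st_append[OF y] by (auto simp: list_all2_Cons1)
  have "Fd (dcomp (dtens (dpiece ?V) (did [a])) (dtens (did xs) (dpiece (Cup a)))) f y =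
      opl ([], ?V, [a]) (opl (xs, Cup a, []) f) (y' @ [c])"
    using v yc by (simp add: Fd.rep_eq dcomp.rep_eq dtens.rep_eq dpiece.rep_eq did.rep_eq del: opl.simps valid_piece.simps(3))
  also have "\<dots> = sumw xs (\<lambda>x. sumL a (\<lambda>b. entry ?V (x @ [b]) y' * opl (xs, Cup a, []) f (x @ [b, c] @ [])))"
    using opl_split[of "[]" "[]" y' ?V "[a]" _ "[c]"] yc by (simp add: st_length sumw_append del: opl.simps entry.simps)
  also have "\<dots> = sumw xs (\<lambda>x. entry ?V' x (y' @ [c]) * f x)"
  proof (rule sumw_cong)
    fix x assume x: "st xs x"
    have "sumL a (\<lambda>b. entry ?V (x @ [b]) y' * opl (xs, Cup a, []) f (x @ [b, c] @ [])) =
      sumL a (\<lambda>b. if c = bar b then entry ?V (x @ [b]) y' * (cupc b * f x) else 0)"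
      using opl_split[of x xs "[_, c]" "Cup a" "[]" f "[]"] x
      by (intro sumL_cong) (simp add: st_length del: opl.simps entry.simps(3))
    also have "\<dots> = entry ?V (x @ [bar c]) y' * cupc (bar c) * f x"
      using yc by (simp add: sumL_bar_delta del: entry.simps)
    also have "\<dots> = entry ?V' x (y' @ [c]) * f x"
      using entry_turn[of x xs y' ys a c] x yc by (simp only: st_length)
    finally show "sumL a (\<lambda>b. entry ?V (x @ [b]) y' * opl (xs, Cup a, []) f (x @ [b, c] @ [])) = entry ?V' x (y' @ [c]) * f x" .
  qed
  also have "\<dots> = Fd (dpiece ?V') f y"
    using v' yc by (simp add: Fd.rep_eq dpiece.rep_eq st_length del: valid_piece.simps entry.simps)
  finally show ?thesis .
qed

lemma Fd_turn_left:
  assumes v: "valid_piece (Vertex (a # xs) ys)" and y: "st (a # ys) y"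
  shows "Fd (dcomp (dtens (did [a]) (dpiece (Vertex (a # xs) ys))) (dtens (dpiece (Cup a)) (did xs))) f y
    = Fd (dpiece (Vertex xs (a # ys))) f y"
proof -
  let ?V = "Vertex (a # xs) ys" and ?V' = "Vertex xs (a # ys)"
  have v': "valid_piece ?V'" using v by (simp add: ac_simps)
  obtain y' c where yc: "y = c # y'" "st ys y'" "inl a c"
    using y by (auto simp: list_all2_Cons1)
  have "Fd (dcomp (dtens (did [a]) (dpiece ?V)) (dtens (dpiece (Cup a)) (did xs))) f y =
      opl ([a], ?V, []) (opl ([], Cup a, xs) f) ([c] @ y' @ [])"
    using v yc by (simp add: Fd.rep_eq dcomp.rep_eq dtens.rep_eq dpiece.rep_eq did.rep_eq del: opl.simps valid_piece.simps(3))
  also have "\<dots> = sumL a (\<lambda>b. sumw xs (\<lambda>x. entry ?V (b # x) y' * opl ([], Cup a, xs) f ([] @ [c, b] @ x)))"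
    using opl_split[of "[c]" "[a]" y' ?V "[]" _ "[]"] yc by (simp add: st_length del: opl.simps entry.simps)
  also have "\<dots> = sumw xs (\<lambda>x. sumL a (\<lambda>b. entry ?V (b # x) y' * opl ([], Cup a, xs) f ([] @ [c, b] @ x)))"
    by (rule sumw_sumL[symmetric])
  also have "\<dots> = sumw xs (\<lambda>x. entry ?V' x (c # y') * f x)"
  proof (rule sumw_cong)
    fix x assume x: "st xs x"
    have "sumL a (\<lambda>b. entry ?V (b # x) y' * opl ([], Cup a, xs) f ([] @ [c, b] @ x)) =
      sumL a (\<lambda>b. if b = bar c then entry ?V (b # x) y' * (cupc c * f x) else 0)"
      using opl_split[of "[]" "[]" "[c, _]" "Cup a" xs f x]
      by (intro sumL_cong) (simp del: opl.simps entry.simps(3))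
    also have "\<dots> = entry ?V (bar c # x) y' * cupc c * f x"
      using yc by (simp add: sumL_bar_delta del: entry.simps)
    also have "\<dots> = entry ?V' x (c # y') * f x"
      using entry_turn'[OF v x yc(2,3)] by (simp only:)
    finally show "sumL a (\<lambda>b. entry ?V (b # x) y' * opl ([], Cup a, xs) f ([] @ [c, b] @ x)) = entry ?V' x (c # y') * f x" .
  qed
  also have "\<dots> = Fd (dpiece ?V') f y"
    using v' yc by (simp add: Fd.rep_eq dpiece.rep_eq st_length del: valid_piece.simps entry.simps)
  finally show ?thesis .
qed

lemma Fd_snake:
  assumes c: "inl a c"
  shows "Fd (dcomp (dtens (dpiece (Cap a)) (did [a])) (dtens (did [a]) (dpiece (Cup a)))) f [c] = f [c]"
    and "Fd (dcomp (dtens (did [a]) (dpiece (Cap a))) (dtens (dpiece (Cup a)) (did [a]))) f [c] = f [c]"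
proof -
  have "Fd (dcomp (dtens (dpiece (Cap a)) (did [a])) (dtens (did [a]) (dpiece (Cup a)))) f [c] =
      sumL a (\<lambda>i. capc i * (if c = i then cupc (bar i) * f [i] else 0))"
    by (simp add: Fd.rep_eq dcomp.rep_eq dtens.rep_eq dpiece.rep_eq did.rep_eq opl_psum psum_Cap psum_Cup
        del: opl.simps cong: psum_weak_cong if_cong)
  also have "\<dots> = sumL a (\<lambda>i. if i = c then f [i] else 0)"
    by (intro sumL_cong) (auto simp flip: mult.assoc)
  finally show "Fd (dcomp (dtens (dpiece (Cap a)) (did [a])) (dtens (did [a]) (dpiece (Cup a)))) f [c] = f [c]"
    using sumL_delta[OF c] by (simp only:)
  have "Fd (dcomp (dtens (did [a]) (dpiece (Cap a))) (dtens (dpiece (Cup a)) (did [a]))) f [c] =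
      sumL a (\<lambda>i. capc i * (if i = bar c then cupc c * f [bar i] else 0))"
    by (simp add: Fd.rep_eq dcomp.rep_eq dtens.rep_eq dpiece.rep_eq did.rep_eq opl_psum psum_Cap psum_Cup
        del: opl.simps cong: psum_weak_cong if_cong)
  also have "\<dots> = sumL a (\<lambda>i. if i = bar c then f [bar i] else 0)"
    by (intro sumL_cong) (auto simp flip: mult.assoc)
  finally show "Fd (dcomp (dtens (did [a]) (dpiece (Cap a))) (dtens (dpiece (Cup a)) (did [a]))) f [c] = f [c]"
    using sumL_delta[OF inl_bar[OF c], of "\<lambda>i. f [bar i]"] by (simp only: bar_bar)
qed

section \<open>Isotopy invariance and matrix entries of webs\<close>

lemma Fd_isotopic: "isotopic d e \<Longrightarrow> st (dtop d) y \<Longrightarrow> Fd d f y = Fd e f y"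
proof (induction arbitrary: f y rule: isotopic.induct)
  case (refl d) then show ?case by simp
next
  case (sym d e)
  then show ?case using isotopic_boundary[OF sym(1)] by simp
next
  case (trans d e f')
  then show ?case using isotopic_boundary[OF trans(1)] by metis
next
  case (comp d d' e e')
  note b = isotopic_boundary[OF comp(1)] isotopic_boundary[OF comp(2)]
  have "Fd d' (Fd e f) y = Fd d' (Fd e' f) y"
    by (rule Fd_cong) (use comp b in auto)
  moreover have "Fd d (Fd e f) y = Fd d' (Fd e f) y" using comp.IH(1)[of y "Fd e f"] comp.prems by simp
  ultimately show ?case using comp(3) b by (simp add: Fd_comp)
next
  case (tens d d' e e')
  note b = isotopic_boundary[OF tens(1)] isotopic_boundary[OF tens(2)]
  obtain y1 y2 where y: "y = y1 @ y2" "st (dtop d) y1" "st (dtop e) y2" using st_append[of "dtop d" "dtop e" y] tens.prems by auto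
  have "Fd (dtens d e) f y = Fd d' (\<lambda>x'. Fd e (\<lambda>y'. f (x' @ y')) y2) y1"
    unfolding y(1) Fd_tens[OF y(2,3)] by (rule tens.IH(1)[OF y(2)])
  also have "\<dots> = Fd d' (\<lambda>x'. Fd e' (\<lambda>y'. f (x' @ y')) y2) y1"
    by (simp only: tens.IH(2)[OF y(3)])
  also have "\<dots> = Fd (dtens d' e') f y" using y b by (simp add: Fd_tens)
  finally show ?case .
next
  case (interchange d e)
  obtain y1 y2 where y: "y = y1 @ y2" "st (dtop d) y1" "st (dtop e) y2" using st_append[of "dtop d" "dtop e" y] interchange by auto
  have "Fd (dcomp (dtens (did (dtop d)) e) (dtens d (did (dbot e)))) f y =
    Fd e (\<lambda>y'. Fd (dtens d (did (dbot e))) f (y1 @ y')) y2"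
    using Fd_tens[of "did (dtop d)" y1 e y2] y by (simp add: Fd_comp Fd_did)
  also have "\<dots> = Fd e (\<lambda>y'. Fd d (\<lambda>x'. f (x' @ y')) y1) y2"
    by (rule Fd_cong) (use y Fd_tens[of d y1 "did (dbot e)"] in \<open>auto simp: Fd_did\<close>)
  also have "\<dots> = Fd d (\<lambda>x'. Fd e (\<lambda>y'. f (x' @ y')) y2) y1" by (rule Fd_commute[symmetric])
  also have "\<dots> = Fd (dtens d e) f y" using y by (simp add: Fd_tens)
  finally show ?case by simp
next
  case (snake_right a)
  then show ?case by (auto simp: list_all2_Cons1 Fd_snake Fd_did)
next
  case (snake_left a)
  then show ?case by (auto simp: list_all2_Cons1 Fd_snake Fd_did)
next
  case (turn_right xs a ys)
  then show ?case by (intro Fd_turn_right) auto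
next
  case (turn_left a xs ys)
  then show ?case by (intro Fd_turn_left) auto
qed

text \<open>Entries at labels that do not fit the boundary are set to 0, since isotopy invariance of
  \<open>Fd\<close> is available for fitting labels only.\<close>

lift_definition Fw :: "web \<Rightarrow> lab list \<Rightarrow> lab list \<Rightarrow> K" is
  "\<lambda>d x y. if st (dbot d) x \<and> st (dtop d) y then Fd d (\<lambda>z. if z = x then 1 else 0) y else 0"
  using isotopic_boundary Fd_isotopic by (fastforce simp: fun_eq_iff)

lemma Fd_matrix:
  assumes "st (dtop d) y"
  shows "Fd d f y = sumw (dbot d) (\<lambda>z. f z * Fd d (\<lambda>x. if x = z then 1 else 0) y)"
proof -
  have "f x = sumw (dbot d) (\<lambda>z. f z * (if x = z then 1 else 0))" if "st (dbot d) x" for x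
    using sumw_delta[OF that, of f] by (simp add: if_distrib eq_commute cong: if_cong)
  then have "Fd d f y = Fd d (\<lambda>x. sumw (dbot d) (\<lambda>z. f z * (if x = z then 1 else 0))) y"
    by (intro Fd_cong assms)
  then show ?thesis by (simp only: Fd_lin)
qed

lemma Fw_zero: "\<not> st (wbot w) x \<or> \<not> st (wtop w) y \<Longrightarrow> Fw w x y = 0"
  by transfer auto

lemma Fw_comp: "wbot w = wtop u \<Longrightarrow> Fw (wcomp w u) x y = sumw (wbot w) (\<lambda>z. Fw w z y * Fw u x z)"
proof (transfer, goal_cases)
  case (1 d e x y)
  show ?case
  proof (cases "st (dbot e) x \<and> st (dtop d) y")
    case True
    let ?g = "Fd e (\<lambda>z. if z = x then 1 else 0)"
    have "Fd d ?g y = sumw (dbot d) (\<lambda>z. ?g z * Fd d (\<lambda>x. if x = z then 1 else 0) y)"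
      using True by (intro Fd_matrix) simp
    then show ?thesis using True 1 by (auto simp: Fd_comp mult.commute intro!: sumw_cong)
  next
    case False
    then show ?thesis using 1 by (auto simp: sumw_lin)
  qed
qed

lemma Fd_scale: "Fd d (\<lambda>x. c * g x) y = c * Fd d g y"
  using Fd_lin[of d "[]" "\<lambda>_. c" "\<lambda>_. g"] by simp

lemma Fw_tens:
  "length x = length (wbot w) \<Longrightarrow> length y = length (wtop w) \<Longrightarrow>
    Fw (wtens w u) (x @ x') (y @ y') = Fw w x y * Fw u x' y'"
proof (transfer, goal_cases)
  case (1 x d y e x' y')
  have st: "st (dbot (dtens d e)) (x @ x') \<longleftrightarrow> st (dbot d) x \<and> st (dbot e) x'"
    "st (dtop (dtens d e)) (y @ y') \<longleftrightarrow> st (dtop d) y \<and> st (dtop e) y'"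
    using 1 by (auto simp: list_all2_append)
  show ?case
  proof (cases "(st (dbot d) x \<and> st (dbot e) x') \<and> st (dtop d) y \<and> st (dtop e) y'")
    case True
    let ?\<delta> = "\<lambda>x z. if z = x then 1 else (0 :: K)"
    have "Fd (dtens d e) (?\<delta> (x @ x')) (y @ y') = Fd d (\<lambda>a. Fd e (\<lambda>b. ?\<delta> (x @ x') (a @ b)) y') y"
      using True by (simp add: Fd_tens)
    also have "\<dots> = Fd d (\<lambda>a. Fd e (\<lambda>b. ?\<delta> x a * ?\<delta> x' b) y') y"
    proof (rule Fd_cong)
      fix a assume "st (dbot d) a"
      then have "(\<lambda>b. ?\<delta> (x @ x') (a @ b)) = (\<lambda>b. ?\<delta> x a * ?\<delta> x' b)"
        using 1 by (auto simp: fun_eq_iff st_length)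
      then show "Fd e (\<lambda>b. ?\<delta> (x @ x') (a @ b)) y' = Fd e (\<lambda>b. ?\<delta> x a * ?\<delta> x' b) y'" by (simp only:)
    qed (use True in simp)
    also have "\<dots> = Fd d (\<lambda>a. Fd e (?\<delta> x') y' * ?\<delta> x a) y"
      by (rule arg_cong[where f = "\<lambda>g. Fd d g y"], rule HOL.ext) (rule HOL.trans[OF Fd_scale mult.commute])
    also have "\<dots> = Fd d (?\<delta> x) y * Fd e (?\<delta> x') y'"
      unfolding Fd_scale by (rule mult.commute)
    finally show ?thesis using True st by simp
  next
    case False
    then show ?thesis using st by auto
  qed
qed

text \<open>Linear combinations may mix boundaries; fixing \<open>s\<close> and \<open>t\<close>
  picks out one component.\<close>

definition val :: "word \<Rightarrow> word \<Rightarrow> lab list \<Rightarrow> lab list \<Rightarrow> web \<Rightarrow> K" where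
  "val s t x y w = (if wbot w = s \<and> wtop w = t then Fw w x y else 0)"

section \<open>Matrix entries of linear combinations and the tensor ideal\<close>

definition ext :: "(web \<Rightarrow> K) \<Rightarrow> lincomb \<Rightarrow> K" where
  "ext \<phi> f = (\<Sum>w\<in>keys f. coeff_of f w * \<phi> w)"

lemma ext_superset: "finite A \<Longrightarrow> keys f \<subseteq> A \<Longrightarrow> ext \<phi> f = (\<Sum>w\<in>A. coeff_of f w * \<phi> w)"
  unfolding ext_def by (intro sum.mono_neutral_left) (auto simp: in_keys_iff)

lemma ext_add: "ext \<phi> (f + g) = ext \<phi> f + ext \<phi> g"
proof -
  have "keys (f + g) \<subseteq> keys f \<union> keys g" by (rule keys_add)
  then show ?thesis
    by (simp add: ext_superset[of "keys f \<union> keys g"] lookup_add distrib_right sum.distrib)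
qed

lemma ext_scale: "ext \<phi> (lscale c f) = c * ext \<phi> f"
proof -
  have "keys (lscale c f) \<subseteq> keys f" by (auto simp: in_keys_iff)
  then show ?thesis by (simp add: ext_superset[of "keys f"] sum_distrib_left mult.assoc)
qed

lemma ext_lin: "ext \<phi> (lin w) = \<phi> w"
  by (simp add: ext_def)

lemma ext_0: "ext \<phi> 0 = 0"
  by (simp add: ext_def)

lemma ext_diff: "ext \<phi> (f - g) = ext \<phi> f - ext \<phi> g"
  using ext_add[of \<phi> "f - g" g] by simp

lemmas ext_simps = ext_add ext_scale ext_lin ext_0 ext_diff

lemma ext_sumw: "ext (\<lambda>u. sumw w (\<lambda>z. c z * \<phi> z u)) f = sumw w (\<lambda>z. c z * ext (\<phi> z) f)"
proof (induction f rule: lincomb_induct)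
  case (2 f g)
  then show ?case by (simp only: ext_add distrib_left sumw_lin(1))
next
  case (3 a f)
  have "sumw w (\<lambda>z. c z * ext (\<phi> z) (lscale a f)) = a * sumw w (\<lambda>z. c z * ext (\<phi> z) f)"
    by (simp only: ext_scale sumw_lin(2)[symmetric] mult_ac)
  then show ?case by (simp only: ext_scale 3)
qed (simp_all add: ext_simps sumw_lin)

definition vanish :: "lincomb \<Rightarrow> bool" where
  "vanish f \<longleftrightarrow> (\<forall>s t x y. ext (val s t x y) f = 0)"

lemma lcomp_simps:
  "lcomp (f + f') g = lcomp f g + lcomp f' g" "lcomp f (g + g') = lcomp f g + lcomp f g'"
  "lcomp (lscale c f) g = lscale c (lcomp f g)" "lcomp f (lscale c g) = lscale c (lcomp f g)"
  "lcomp 0 g = 0" "lcomp f 0 = 0"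
  "lcomp (lin x) (lin y) = (if wbot x = wtop y then lin (wcomp x y) else 0)"
  by (simp_all add: lcomp_def bilin_add_left bilin_add_right bilin_scale_left bilin_scale_right bilin_lin)
    (simp_all add: bilin_def)

lemma ltens_simps:
  "ltens (f + f') g = ltens f g + ltens f' g" "ltens f (g + g') = ltens f g + ltens f g'"
  "ltens (lscale c f) g = lscale c (ltens f g)" "ltens f (lscale c g) = lscale c (ltens f g)"
  "ltens 0 g = 0" "ltens f 0 = 0"
  "ltens (lin x) (lin y) = lin (wtens x y)"
  by (simp_all add: ltens_def bilin_add_left bilin_add_right bilin_scale_left bilin_scale_right bilin_lin)
    (simp_all add: bilin_def)

lemma ext_comp_left:
  "ext (val s t x y) (lcomp (lin w) f) =
    (if wtop w = t then sumw (wbot w) (\<lambda>z. Fw w z y * ext (val s (wbot w) x z) f) else 0)"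
proof -
  have "ext (val s t x y) (lcomp (lin w) f) =
    ext (\<lambda>u. if wbot w = wtop u then val s t x y (wcomp w u) else 0) f"
    by (induction f rule: lincomb_induct) (simp_all add: lcomp_simps ext_simps)
  also have "(\<lambda>u. if wbot w = wtop u then val s t x y (wcomp w u) else 0) =
    (\<lambda>u. sumw (wbot w) (\<lambda>z. (if wtop w = t then Fw w z y else 0) * val s (wbot w) x z u))"
    by (auto simp: fun_eq_iff val_def Fw_comp sumw_lin)
  finally show ?thesis unfolding ext_sumw by (simp add: sumw_lin)
qed

lemma ext_comp_right:
  "ext (val s t x y) (lcomp f (lin w)) =
    (if wbot w = s then sumw (wtop w) (\<lambda>z. Fw w x z * ext (val (wtop w) t z y) f) else 0)"
proof -
  have "ext (val s t x y) (lcomp f (lin w)) =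
    ext (\<lambda>u. if wbot u = wtop w then val s t x y (wcomp u w) else 0) f"
    by (induction f rule: lincomb_induct) (simp_all add: lcomp_simps ext_simps)
  also have "(\<lambda>u. if wbot u = wtop w then val s t x y (wcomp u w) else 0) =
    (\<lambda>u. sumw (wtop w) (\<lambda>z. (if wbot w = s then Fw w x z else 0) * val (wtop w) t z y u))"
    by (auto simp: fun_eq_iff val_def Fw_comp sumw_lin mult.commute)
  finally show ?thesis unfolding ext_sumw by (simp add: sumw_lin)
qed

lemma ext_scaled: "ext (\<lambda>u. c * \<phi> u) f = c * ext \<phi> f"
  using ext_sumw[of "[]" "\<lambda>_. c" "\<lambda>_. \<phi>"] by simp

lemma vanish_tens:
  assumes "vanish f"
  shows "vanish (ltens (lin w) f)" "vanish (ltens f (lin w))"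
proof -
  have split: "s = u @ u' \<longleftrightarrow> take (length u) s = u \<and> u' = drop (length u) s" for s u u' :: word
    by (metis append_eq_conv_conj)
  have split': "s = u' @ u \<longleftrightarrow> drop (length s - length u) s = u \<and> u' = take (length s - length u) s" for s u u' :: word
    by (auto simp: append_eq_conv_conj) (metis append_take_drop_id)
  show "vanish (ltens (lin w) f)" unfolding vanish_def
  proof (intro allI)
    fix s t :: word and x y :: "lab list"
    \<comment> \<open>The webs in \<open>f\<close> may have any boundary, so words and labels are
      cut at the length of the fixed factor \<open>w\<close>.\<close>
    let ?a = "length (wbot w)" and ?b = "length (wtop w)"
    let ?c = "if take ?a s = wbot w \<and> take ?b t = wtop w then Fw w (take ?a x) (take ?b y) else 0"
    have *: "val s t x y (wtens w u) = ?c * val (drop ?a s) (drop ?b t) (drop ?a x) (drop ?b y) u" for u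
    proof (cases "?a \<le> length x \<and> ?b \<le> length y")
      case True
      then have "Fw (wtens w u) x y = Fw w (take ?a x) (take ?b y) * Fw u (drop ?a x) (drop ?b y)"
        using Fw_tens[of "take ?a x" w "take ?b y" u "drop ?a x" "drop ?b y"] by simp
      then show ?thesis by (auto simp: val_def eq_commute[of _ s] eq_commute[of _ t] split[of s] split[of t])
    next
      case False
      then have "Fw (wtens w u) x y = 0" by (intro Fw_zero) (auto dest: st_length)
      moreover have "Fw w (take ?a x) (take ?b y) = 0" using False by (intro Fw_zero) (auto dest: st_length)
      ultimately show ?thesis by (simp add: val_def)
    qed
    have "ext (val s t x y) (ltens (lin w) f) = ext (\<lambda>u. val s t x y (wtens w u)) f"
      by (induction f rule: lincomb_induct) (simp_all add: ltens_simps ext_simps)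
    then show "ext (val s t x y) (ltens (lin w) f) = 0"
      unfolding * ext_scaled using assms by (simp add: vanish_def)
  qed
  show "vanish (ltens f (lin w))" unfolding vanish_def
  proof (intro allI)
    fix s t :: word and x y :: "lab list"
    let ?a = "length s - length (wbot w)" and ?b = "length t - length (wtop w)"
    let ?c = "if drop ?a s = wbot w \<and> drop ?b t = wtop w then Fw w (drop ?a x) (drop ?b y) else 0"
    have *: "val s t x y (wtens u w) = ?c * val (take ?a s) (take ?b t) (take ?a x) (take ?b y) u" for u
    proof (cases "wbot u @ wbot w = s \<and> wtop u @ wtop w = t")
      case True
      then have ab: "?a = length (wbot u)" "?b = length (wtop u)" by auto
      have "Fw (wtens u w) x y = Fw u (take ?a x) (take ?b y) * Fw w (drop ?a x) (drop ?b y)"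
      proof (cases "?a \<le> length x \<and> ?b \<le> length y")
        case True
        then show ?thesis
          using Fw_tens[of "take ?a x" u "take ?b y" w "drop ?a x" "drop ?b y"] ab by simp
      next
        case False
        then have "Fw (wtens u w) x y = 0" using ab by (intro Fw_zero) (auto dest: st_length)
        moreover have "Fw u (take ?a x) (take ?b y) = 0" using False ab by (intro Fw_zero) (auto dest: st_length)
        ultimately show ?thesis by simp
      qed
      then show ?thesis using True by (auto simp: val_def)
    next
      case False
      then show ?thesis by (auto simp: val_def eq_commute[of _ s] eq_commute[of _ t] split'[of s] split'[of t])
    qed
    have "ext (val s t x y) (ltens f (lin w)) = ext (\<lambda>u. val s t x y (wtens u w)) f"
      by (induction f rule: lincomb_induct) (simp_all add: ltens_simps ext_simps)
    then show "ext (val s t x y) (ltens f (lin w)) = 0"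
      unfolding * ext_scaled using assms by (simp add: vanish_def)
  qed
qed

lemma vanish_lin: "vanish 0" "vanish f \<Longrightarrow> vanish g \<Longrightarrow> vanish (f + g)" "vanish f \<Longrightarrow> vanish (lscale c f)"
  by (simp_all add: vanish_def ext_simps)

lemma vanish_comp: "vanish f \<Longrightarrow> vanish (lcomp (lin w) f)" "vanish f \<Longrightarrow> vanish (lcomp f (lin w))"
  by (simp_all add: vanish_def ext_comp_left ext_comp_right sumw_lin)

lemma null_vanish:
  assumes rel: "\<And>f. f \<in> local_relations \<Longrightarrow> vanish f"
  shows "f \<in> null_comb \<Longrightarrow> vanish f"
proof (induction rule: null_comb.induct)
  case (comp_left f g)
  show ?case by (induction g rule: lincomb_induct) (simp_all add: lcomp_simps vanish_lin vanish_comp comp_left)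
next
  case (comp_right f g)
  show ?case by (induction g rule: lincomb_induct) (simp_all add: lcomp_simps vanish_lin vanish_comp comp_right)
next
  case (tens_left f g)
  show ?case by (induction g rule: lincomb_induct) (simp_all add: ltens_simps vanish_lin vanish_tens tens_left)
next
  case (tens_right f g)
  show ?case by (induction g rule: lincomb_induct) (simp_all add: ltens_simps vanish_lin vanish_tens tens_right)
qed (auto intro: rel vanish_lin)

text \<open>An atom with the single rule \<open>v * vi = 1\<close>, so that the checks below are
  polynomial computations without inverses.\<close>

definition vi :: K where
  "vi = inverse v"

lemma v_vi: "v * vi = 1"
  by (simp add: vi_def v_nonzero)

lemma qint_2_vi: "qint 2 = v + vi"
  by (simp add: vi_def qint_2)

lemma capc_T1: "capc A1 = v ^ 2" "capc A2 = v" "capc A3 = - vi" "capc A4 = - (vi ^ 2)"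
  by (simp_all add: capc_def vi_def power_inverse)

lemmas table = cupc.simps[folded vi_def] outc.simps[folded vi_def] capc_T1 qint_2_vi

lemmas layer_rules = Fd.rep_eq dcomp.rep_eq dtens.rep_eq dpiece.rep_eq did.rep_eq opl_psum psum_rules

lemma v_vi_cancel: "v * vi = 1" "v * (vi * z) = z" "vi * v = 1" "vi * (v * z) = z"
  using v_vi by (simp_all add: mult.commute flip: mult.assoc)

section \<open>The local relations on basis labels, as finite computations with Laurent
  polynomials\<close>

lemma Fd_loop1: "Fd (dcomp (dpiece (Cap T1)) (dpiece (Cup T1))) f [] = - (qint 6 * qint 2 / qint 3) * f []"
proof -
  have "Fd (dcomp (dpiece (Cap T1)) (dpiece (Cup T1))) f [] = qd * f []"
    unfolding qd_v
    by (simp del: opl.simps cupc.simps outc.simps add: layer_rules table flip: vi_def cong: psum_weak_cong if_cong; insert v_vi; algebra)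
  then show ?thesis by (simp add: qd_def)
qed

lemma Fd_loop2: "Fd (dcomp (dpiece (Cap T2)) (dpiece (Cup T2))) f [] = qint 6 * qint 5 / (qint 3 * qint 2) * f []"
proof -
  have "Fd (dcomp (dpiece (Cap T2)) (dpiece (Cup T2))) f [] = sumL T2 (\<lambda>i. capc i * cupc i) * f []"
    by (simp add: layer_rules algebra_simps del: opl.simps cupc.simps outc.simps cong: psum_weak_cong if_cong)
  also have "sumL T2 (\<lambda>i. capc i * cupc i) = v ^ 6 + v ^ 2 + 1 + vi ^ 2 + vi ^ 6"
    using qint_nonzero[of 2] by (simp add: capc_def vi_def field_simps)
  also have "\<dots> = qint 6 * qint 5 / (qint 3 * qint 2)"
  proof -
    \<comment> \<open>The quotient of quantum integers is cleared of its denominator first, which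
      leaves an identity modulo \<open>v * vi = 1\<close>.\<close>
    have "(v ^ 6 - vi ^ 6) * (v ^ 5 - vi ^ 5) = (v ^ 6 + v ^ 2 + 1 + vi ^ 2 + vi ^ 6) * ((v ^ 3 - vi ^ 3) * (v ^ 2 - vi ^ 2))"
      using v_vi by algebra
    then have "qint 6 * qint 5 = (v ^ 6 + v ^ 2 + 1 + vi ^ 2 + vi ^ 6) * (qint 3 * qint 2)"
      by (simp add: qint_def v_def vi_def)
    then show ?thesis using qint_nonzero[of 2] qint_nonzero[of 3] by (simp add: eq_divide_eq)
  qed
  finally show ?thesis .
qed

lemma Fd_lollipop: "Fd (dcomp (dpiece (Cap T1)) (dpiece (Vertex [T2] [T1, T1]))) f [] = 0"
  by (simp del: opl.simps cupc.simps outc.simps add: layer_rules table twist_def cong: psum_weak_cong if_cong; ((insert v_vi; algebra; fail) | (simp add: algebra_simps eval_nat_numeral v_vi_cancel; fail)))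

lemma Fd_bigon:
  "inl T2 k \<Longrightarrow> Fd (dcomp (dpiece (Vertex [T1, T1] [T2])) (dpiece (Vertex [T2] [T1, T1]))) f [k] = - (qint 2 ^ 2) * f [k]"
  by (cases k; simp del: opl.simps cupc.simps outc.simps add: layer_rules table twist_def cong: psum_weak_cong if_cong; ((insert v_vi; algebra; fail) | (simp add: algebra_simps eval_nat_numeral v_vi_cancel; fail)))

lemma Fd_triangle:
  "inl T2 k \<Longrightarrow> inl T2 l \<Longrightarrow> Fd (dcomp (dtens (did [T2]) (dtens (dpiece (Cap T1)) (did [T2])))
       (dcomp (dtens (dpiece (Vertex [T1] [T2, T1])) (dpiece (Vertex [T1] [T1, T2])))
         (dpiece (Vertex [T2] [T1, T1])))) f [k, l] = 0"
  by (cases k; cases l; simp del: opl.simps cupc.simps outc.simps add: layer_rules table twist_def cong: psum_weak_cong if_cong; ((insert v_vi; algebra; fail) | (simp add: algebra_simps eval_nat_numeral v_vi_cancel; fail)))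

lemma Fd_IJ:
  "inl T1 i \<Longrightarrow> inl T1 j \<Longrightarrow>
    Fd (dcomp (dpiece (Vertex [T2] [T1, T1])) (dpiece (Vertex [T1, T1] [T2]))) f [i, j]
    - Fd (dcomp (dtens (did [T1]) (dpiece (Vertex [T2, T1] [T1]))) (dtens (dpiece (Vertex [T1] [T1, T2])) (did [T1]))) f [i, j]
    = Fd (dcomp (dpiece (Cup T1)) (dpiece (Cap T1))) f [i, j] - f [i, j]"
  by (cases i; cases j; simp del: opl.simps cupc.simps outc.simps add: layer_rules table twist_def cong: psum_weak_cong if_cong; ((insert v_vi; algebra; fail) | (simp add: algebra_simps eval_nat_numeral v_vi_cancel; fail)))

lemmas web_abs = wcomp.abs_eq wtens.abs_eq wpiece.abs_eq wid.abs_eq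

lemma Fw_abs: "st (dbot d) x \<Longrightarrow> st (dtop d) y \<Longrightarrow> Fw (abs_web d) x y = Fd d (\<lambda>z. if z = x then 1 else 0) y"
  by (simp add: Fw.abs_eq)

lemma vanish_lin_web:
  assumes "\<And>x y. st (wbot w) x \<Longrightarrow> st (wtop w) y \<Longrightarrow> Fw w x y = 0"
  shows "vanish (lin w)"
  unfolding vanish_def
proof (intro allI)
  fix s t x y
  show "ext (val s t x y) (lin w) = 0"
    using assms[of x y] Fw_zero[of w x y]
    by (cases "st (wbot w) x \<and> st (wtop w) y") (auto simp: ext_simps val_def)
qed

lemma vanish_diff:
  assumes "wbot w = wbot u" "wtop w = wtop u"
    and "\<And>x y. st (wbot u) x \<Longrightarrow> st (wtop u) y \<Longrightarrow> Fw w x y = c * Fw u x y"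
  shows "vanish (lin w - lscale c (lin u))"
  unfolding vanish_def
proof (intro allI)
  fix s t x y
  show "ext (val s t x y) (lin w - lscale c (lin u)) = 0"
    using assms Fw_zero[of w x y] Fw_zero[of u x y]
    by (cases "st (wbot u) x \<and> st (wtop u) y") (auto simp: ext_simps val_def)
qed

lemma vanish_IJ: "vanish (lin I_web - lin J_web - (lin U_web - lin V_web))"
  unfolding vanish_def
proof (intro allI)
  fix s t x y
  have b: "wbot I_web = [T1, T1]" "wbot J_web = [T1, T1]" "wbot U_web = [T1, T1]" "wbot V_web = [T1, T1]"
    "wtop I_web = [T1, T1]" "wtop J_web = [T1, T1]" "wtop U_web = [T1, T1]" "wtop V_web = [T1, T1]"
    by (simp_all add: I_web_def J_web_def U_web_def V_web_def)
  have "Fw I_web x y - Fw J_web x y - (Fw U_web x y - Fw V_web x y) = 0"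
  proof (cases "st [T1, T1] x \<and> st [T1, T1] y")
    case True
    then obtain i j where y: "y = [i, j]" "inl T1 i" "inl T1 j" by (auto simp: list_all2_Cons1 simp del: inl.simps)
    have st: "st [T1, T1] x" "st [T1, T1] [i, j]" using True y by auto
    show ?thesis
      using Fd_IJ[OF y(2,3), of "\<lambda>z. if z = x then 1 else 0"] st
      unfolding I_web_def J_web_def U_web_def V_web_def web_abs y(1)
      by (simp add: Fw_abs Fd_did del: list.rel_inject)
  next
    case False
    then have "Fw I_web x y = 0" "Fw J_web x y = 0" "Fw U_web x y = 0" "Fw V_web x y = 0"
      using Fw_zero b by (auto simp del: list.rel_inject)
    then show ?thesis by simp
  qed
  then show "ext (val s t x y) (lin I_web - lin J_web - (lin U_web - lin V_web)) = 0"
    by (cases "s = [T1, T1] \<and> t = [T1, T1]") (auto simp: ext_simps val_def b)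
qed

lemma local_vanish: "f \<in> local_relations \<Longrightarrow> vanish f"
proof -
  assume f: "f \<in> local_relations"
  have loop: "vanish (lin (loop_web a) - lscale c (lin (wid [])))"
    if "\<And>f. Fd (dcomp (dpiece (Cap a)) (dpiece (Cup a))) f [] = c * f []" for a c
  proof (rule vanish_diff)
    fix x y assume "st (wbot (wid [])) x" "st (wtop (wid [])) y"
    then have xy: "x = []" "y = []" by simp_all
    show "Fw (loop_web a) x y = c * Fw (wid []) x y"
      unfolding loop_web_def web_abs xy by (simp add: Fw_abs Fd_did that)
  qed (simp_all add: loop_web_def)
  note 1 = loop[OF Fd_loop1] and 2 = loop[OF Fd_loop2]
  have 3: "vanish (lin lollipop_web)"
    by (rule vanish_lin_web) (simp add: lollipop_web_def, simp add: web_abs Fw_abs Fd_lollipop)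
  have 4: "vanish (lin bigon_web - lscale (- (qint 2 ^ 2)) (lin (wid [T2])))"
  proof (rule vanish_diff)
    fix x y assume "st (wbot (wid [T2])) x" "st (wtop (wid [T2])) y"
    then have st: "st [T2] x" "st [T2] y" by (simp_all del: list.rel_inject)
    from st(2) obtain k where y: "y = [k]" "inl T2 k" by (auto simp: list_all2_Cons1 simp del: inl.simps)
    have "Fw (abs_web (dcomp (dpiece (Vertex [T1, T1] [T2])) (dpiece (Vertex [T2] [T1, T1])))) x y =
        Fd (dcomp (dpiece (Vertex [T1, T1] [T2])) (dpiece (Vertex [T2] [T1, T1]))) (\<lambda>z. if z = x then 1 else 0) y"
      by (rule Fw_abs) (use st in \<open>simp_all del: list.rel_inject\<close>)
    moreover have "Fw (abs_web (did [T2])) x y = (if y = x then 1 else 0)"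
      using Fw_abs[of "did [T2]" x y] st by (simp only: dbot_dtop_simps Fd_did)
    ultimately show "Fw bigon_web x y = - (qint 2 ^ 2) * Fw (wid [T2]) x y"
      unfolding bigon_web_def web_abs y(1) by (simp only: Fd_bigon[OF y(2)])
  qed (simp_all add: bigon_web_def)
  have 5: "vanish (lin triangle_web)"
  proof (rule vanish_lin_web)
    fix x y assume "st (wbot triangle_web) x" "st (wtop triangle_web) y"
    then have st: "st [T2] x" "st [T2, T2] y" by (simp_all add: triangle_web_def)
    from this(2) obtain k l where y: "y = [k, l]" "inl T2 k" "inl T2 l" by (auto simp: list_all2_Cons1 simp del: inl.simps)
    show "Fw triangle_web x y = 0"
      unfolding triangle_web_def web_abs using st(1) y Fd_triangle[OF y(2,3)]
      by (simp add: Fw_abs del: inl.simps)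
  qed
  show ?thesis using f unfolding local_relations_def insert_iff empty_iff
    by (elim disjE FalseE) (simp_all only: 1 2 3 4 5 vanish_IJ)
qed

section \<open>Matrix coefficients on spiders and the highest weight vector\<close>

lift_definition sval :: "word \<Rightarrow> word \<Rightarrow> lab list \<Rightarrow> lab list \<Rightarrow> spider \<Rightarrow> K" is "\<lambda>s t x y. ext (val s t x y)"
proof -
  fix s t x y f g assume "equiv_mod f g"
  then have "vanish (f - g)" unfolding equiv_mod_def by (rule null_vanish[rotated]) (rule local_vanish)
  then show "ext (val s t x y) f = ext (val s t x y) g" by (simp add: vanish_def ext_diff)
qed

lemma sval_web: "sval s t x y (of_web w) = val s t x y w"
  by transfer (simp add: ext_simps)

lemma sval_add: "sval s t x y (f + g) = sval s t x y f + sval s t x y g"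
  by transfer (simp add: ext_simps)

lemma sval_scale: "sval s t x y (c *\<^sub>w f) = c * sval s t x y f"
  by transfer (simp add: ext_simps)

lemma sval_0: "sval s t x y 0 = 0"
  by transfer (simp add: ext_simps)

lemma sval_diff: "sval s t x y (f - g) = sval s t x y f - sval s t x y g"
  using sval_add[of s t x y "f - g" g] by simp

lemma sval_no_label:
  assumes "\<not> st t y"
  shows "sval s t x y f = 0"
proof (induction f rule: spider_induct)
  case zero
  show ?case by (rule sval_0)
next
  case (add f g)
  then show ?case by (simp only: sval_add add_0)
next
  case (scale c f)
  then show ?case by (simp only: sval_scale mult_zero_right)
next
  case (web w)
  show ?case using assms Fw_zero[of w x y] by (auto simp: sval_web val_def)
qed

lemma sval_comp:
  assumes "g \<in> Hom u t" "h \<in> Hom s u"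
  shows "sval s t x y (g \<circ>\<^sub>w h) = sumw u (\<lambda>z. sval u t z y g * sval s u x z h)"
  using assms(1)
proof (induction rule: Hom_induct)
  case zero
  show ?case by (simp only: sp_zero sval_0 mult_zero_left sumw_lin(3))
next
  case (add f g)
  show ?case by (simp only: sp_bilinear sval_add distrib_right sumw_lin(1) add.IH)
next
  case (scale c f)
  show ?case by (simp only: sp_bilinear sval_scale mult.assoc sumw_lin(2) scale.IH)
next
  case (web w)
  note w = web
  show ?case using assms(2)
  proof (induction rule: Hom_induct)
    case zero
    show ?case by (simp only: sp_zero sval_0 mult_zero_right sumw_lin(3))
  next
    case (add f g)
    show ?case by (simp only: sp_bilinear sval_add distrib_left sumw_lin(1) add.IH)
  next
    case (scale c f)
    show ?case by (simp only: sp_bilinear sval_scale mult.left_commute[of _ c] sumw_lin(2) scale.IH)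
  next
    case (web w')
    then show ?case using w by (simp add: of_web_comp sval_web val_def Fw_comp)
  qed
qed

lemma sval_tens:
  assumes "f \<in> Hom s t" "g \<in> Hom s' t'" "length x = length s" "length y = length t"
  shows "sval (s @ s') (t @ t') (x @ x') (y @ y') (f \<otimes>\<^sub>w g) = sval s t x y f * sval s' t' x' y' g"
  using assms(1)
proof (induction rule: Hom_induct)
  case zero
  show ?case by (simp only: sp_zero sval_0 mult_zero_left)
next
  case (add f g)
  show ?case by (simp only: sp_bilinear sval_add distrib_right add.IH)
next
  case (scale c f)
  show ?case by (simp only: sp_bilinear sval_scale mult.assoc scale.IH)
next
  case (web w)
  note w = web
  show ?case using assms(2)
  proof (induction rule: Hom_induct)
    case zero
    show ?case by (simp only: sp_zero sval_0 mult_zero_right)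
  next
    case (add f g)
    show ?case by (simp only: sp_bilinear sval_add distrib_left add.IH)
  next
    case (scale c f)
    show ?case by (simp only: sp_bilinear sval_scale mult.left_commute[of _ c] scale.IH)
  next
    case (web w')
    have "length x = length (wbot w)" "length y = length (wtop w)" using w assms(3,4) by simp_all
    then have "Fw (wtens w w') (x @ x') (y @ y') = Fw w x y * Fw w' x' y'" by (rule Fw_tens)
    then show ?case using w web by (simp add: of_web_tens sval_web val_def)
  qed
qed

text \<open>On a word of single strands the label list consisting of \<open>A1\<close> alone is the
  highest weight vector of the tensor power, so this says that \<open>f\<close> kills that
  vector.\<close>

definition dead :: "word \<Rightarrow> word \<Rightarrow> spider \<Rightarrow> bool" where
  "dead s t f \<longleftrightarrow> (\<forall>y. sval s t (replicate (length s) A1) y f = 0)"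

lemma dead_lin: "dead s t 0" "dead s t f \<Longrightarrow> dead s t g \<Longrightarrow> dead s t (f + g)" "dead s t f \<Longrightarrow> dead s t g \<Longrightarrow> dead s t (f - g)"
  by (simp_all add: dead_def sval_0 sval_add sval_diff)

lemma dead_comp: "g \<in> Hom u t \<Longrightarrow> h \<in> Hom s u \<Longrightarrow> dead s u h \<Longrightarrow> dead s t (g \<circ>\<^sub>w h)"
  by (simp add: dead_def sval_comp sumw_lin)

lemma dead_tens:
  assumes "f \<in> Hom s t" "g \<in> Hom s' t'" "dead s t f \<or> dead s' t' g"
  shows "dead (s @ s') (t @ t') (f \<otimes>\<^sub>w g)"
  unfolding dead_def
proof
  fix y
  show "sval (s @ s') (t @ t') (replicate (length (s @ s')) A1) y (f \<otimes>\<^sub>w g) = 0"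
  proof (cases "st (t @ t') y")
    case True
    then obtain y1 y2 where y: "y = y1 @ y2" "st t y1" using st_append by blast
    have "sval (s @ s') (t @ t') (replicate (length s) A1 @ replicate (length s') A1) (y1 @ y2) (f \<otimes>\<^sub>w g) =
      sval s t (replicate (length s) A1) y1 f * sval s' t' (replicate (length s') A1) y2 g"
      by (rule sval_tens[OF assms(1,2)]) (simp_all add: st_length[OF y(2)])
    also have "\<dots> = 0" using assms(3) unfolding dead_def by (elim disjE) simp_all
    finally show ?thesis by (simp only: y(1) length_append replicate_add)
  qed (rule sval_no_label)
qed

lemma dead_cap: "dead [T1, T1] [] capw"
proof -
  have "sval [T1, T1] [] [A1, A1] y capw = 0" for y
  proof (cases "st [] y")
    case True
    then have y: "y = []" by simp
    have "Fd (dpiece (Cap T1)) (\<lambda>z. if z = [A1, A1] then 1 else 0) [] =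
      psum (Cap T1) [] (\<lambda>z. if z = [A1, A1] then 1 else 0)"
      by (simp add: Fd.rep_eq dpiece.rep_eq psum_def)
    also have "\<dots> = 0" by (simp add: psum_Cap)
    finally show ?thesis unfolding y sval_web val_def web_abs by (simp add: Fw.abs_eq)
  qed (rule sval_no_label)
  then show ?thesis by (simp add: dead_def)
qed

text \<open>Twice the highest weight of the 4-dimensional representation is not a weight of the
  5-dimensional one.\<close>

lemma dead_Y: "dead [T1, T1] [T2] Yw"
proof -
  have "sval [T1, T1] [T2] [A1, A1] y Yw = 0" for y
  proof (cases "st [T2] y")
    case True
    then obtain k where y: "y = [k]" "inl T2 k" by (auto simp: list_all2_Cons1)
    have "Fd (dpiece (Vertex [T1, T1] [T2])) (\<lambda>z. if z = [A1, A1] then 1 else 0) [k] =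
      psum (Vertex [T1, T1] [T2]) [k] (\<lambda>z. if z = [A1, A1] then 1 else 0)"
      by (simp add: Fd.rep_eq dpiece.rep_eq psum_def del: entry.simps)
    also have "\<dots> = 0" using y(2) unfolding psum_Y by auto
    finally show ?thesis unfolding y(1) sval_web val_def web_abs by (simp add: Fw.abs_eq)
  qed (rule sval_no_label)
  then show ?thesis by (simp add: dead_def)
qed

lemma Y_Hom: "Yw \<in> Hom [T1, T1] [T2]" "Lw \<in> Hom [T2] [T1, T1]"
  by (rule wtyping HOL.refl)+

lemma cup_cap_Hom: "cupw \<in> Hom [] [T1, T1]" "capw \<in> Hom [T1, T1] []"
  by (rule wtyping HOL.refl)+

lemma dead_X: "dead [T1, T1] [T1, T1] X"
  unfolding web_relations(5) web_relations(4)
  by (rule dead_lin(3)[OF dead_comp[OF Y_Hom(2,1) dead_Y] dead_comp[OF cup_cap_Hom dead_cap]])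

lemma replicate_split: "replicate (i + 2 + j) a = replicate i a @ [a, a] @ replicate j a"
  by (induction i) (simp_all add: numeral_2_eq_2)

lemma dead_at:
  assumes "g \<in> Hom [T1, T1] t" "dead [T1, T1] t g"
  shows "dead (replicate (i + 2 + j) T1) (replicate i T1 @ t @ replicate j T1) (idn1 i \<otimes>\<^sub>w g \<otimes>\<^sub>w idn1 j)"
  unfolding replicate_split idn1_def
  by (rule dead_tens[OF Hom_ident Hom_tens[OF assms(1) Hom_ident]
        disjI2[OF dead_tens[OF assms(1) Hom_ident disjI1[OF assms(2)]]]])

lemma X_Hom: "X \<in> Hom [T1, T1] [T1, T1]"
  using hom1_gens(3) by (simp add: hom1_def numeral_2_eq_2)

lemma Low_dead: "sp.Low n m f \<Longrightarrow> dead (replicate n T1) (replicate m T1) f"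
proof (induction rule: sp.Low.induct)
  case (cap w i j m n)
  have d: "dead (replicate n T1) (replicate (i + j) T1) (idn1 i \<otimes>\<^sub>w capw \<otimes>\<^sub>w idn1 j)"
    using dead_at[OF cup_cap_Hom(2) dead_cap, of i j] by (simp only: cap(2) replicate_add append_Nil)
  have h: "idn1 i \<otimes>\<^sub>w capw \<otimes>\<^sub>w idn1 j \<in> Hom (replicate n T1) (replicate (i + j) T1)"
    by (rule sp.at_hom[OF hom1_gens(2), unfolded hom1_def]) (rule cap(2), simp)
  show ?case by (rule dead_comp[OF cap(1)[unfolded hom1_def] h d])
next
  case (X w n m i j)
  have d: "dead (replicate n T1) (replicate n T1) (idn1 i \<otimes>\<^sub>w X \<otimes>\<^sub>w idn1 j)"
    using dead_at[OF X_Hom dead_X, of i j] by (simp only: X(2) replicate_split)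
  have h: "idn1 i \<otimes>\<^sub>w X \<otimes>\<^sub>w idn1 j \<in> Hom (replicate n T1) (replicate n T1)"
    by (rule sp.at_hom[OF hom1_gens(3), unfolded hom1_def]) (rule X(2))+
  show ?case by (rule dead_comp[OF X(1)[unfolded hom1_def] h d])
next
  case (zero n m)
  show ?case by (rule dead_lin(1))
next
  case (add n m f g)
  show ?case by (rule dead_lin(2)[OF add.IH])
qed

lemma sval_idn1: "sval (replicate n T1) (replicate n T1) (replicate n A1) (replicate n A1) (idn1 n) = 1"
proof -
  have st: "st (replicate n T1) (replicate n A1)" by (induction n) auto
  have "Fw (abs_web (did (replicate n T1))) (replicate n A1) (replicate n A1) = 1"
    using Fw_abs[of "did (replicate n T1)" "replicate n A1" "replicate n A1"] st
    by (simp only: dbot_dtop_simps Fd_did if_True simp_thms)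
  then show ?thesis
    by (simp only: idn1_def ident_def sval_web val_def wid.abs_eq wbot.abs_eq wtop.abs_eq dbot_dtop_simps simp_thms if_True)
qed

lemma jw_nonzero: "sp.jw n \<noteq> 0"
proof
  assume "sp.jw n = 0"
  then have "dead (replicate n T1) (replicate n T1) (0 - idn1 n)" using Low_dead[OF sp.jw_Low, of n] by (simp only:)
  then have "sval (replicate n T1) (replicate n T1) (replicate n A1) (replicate n A1) (0 - idn1 n) = 0"
    unfolding dead_def length_replicate by blast
  then show False unfolding sval_diff sval_0 sval_idn1 by simp
qed

section \<open>The clasp\<close>

text \<open>Subtracting a simple root never increases a + 2b or a + b and lowers one of the two,
  hence it lowers their sum.\<close>

lemma weight_less_bounds:
  "weight_less l m \<Longrightarrow> fst l + 2 * snd l \<le> fst m + 2 * snd m \<and> fst l + snd l \<le> fst m + snd m \<and>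
    2 * fst l + 3 * snd l < 2 * fst m + 3 * snd m"
  by (induction rule: weight_less.induct) auto

lemma wt_count: "wt t = count_list t T1 + 2 * count_list t T2"
proof (induction t)
  case (Cons a t)
  then show ?case by (cases a) auto
qed simp

lemma weight_replicate: "weight (replicate n T1) = (int n, 0)"
proof -
  have "count_list (replicate n T1) T1 = n" "count_list (replicate n T1) T2 = 0" by (induction n) auto
  then show ?thesis by (simp add: weight_def)
qed

text \<open>\<open>wt\<close> is the functional a + 2b. If it equals n and there are no double
  letters, then the weight is (n,0) itself, against the strict inequality for 2a + 3b.\<close>

lemma weight_less_wt:
  assumes "weight_less (weight t) (weight (replicate n T1))"
  shows "wt t \<le> n" "wt t = n \<Longrightarrow> T2 \<in> set t"
proof -
  note b = weight_less_bounds[OF assms, unfolded weight_replicate]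
  show "wt t \<le> n" using b by (simp add: wt_count weight_def)
  assume n: "wt t = n"
  show "T2 \<in> set t"
  proof (rule ccontr)
    assume "T2 \<notin> set t"
    then have "count_list t T2 = 0" by (simp add: count_list_0_iff)
    then show False using b n by (simp add: wt_count weight_def)
  qed
qed

text \<open>The recursion reads the same upside down, so the results in the opposite category
  concern the same elements.\<close>

lemma opp_jw: "opp.jw n = sp.jw n"
proof (induction n)
  case (Suc n)
  show ?case unfolding opp.jw.simps sp.jw.simps Suc.IH by (simp only: sp_comp_assoc)
qed simp

lemma sp_lay_comp:
  assumes "f \<in> Hom b c" "g \<in> Hom a b"
  shows "(ident s \<otimes>\<^sub>w f \<otimes>\<^sub>w ident t) \<circ>\<^sub>w (ident s \<otimes>\<^sub>w g \<otimes>\<^sub>w ident t) = ident s \<otimes>\<^sub>w (f \<circ>\<^sub>w g) \<otimes>\<^sub>w ident t"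
  by (simp only: sp_ident_tens_comp[OF Hom_tens[OF assms(1) Hom_ident] Hom_tens[OF assms(2) Hom_ident]]
      sp_comp_tens_ident[OF assms])

lemma H_sum: "Lw \<circ>\<^sub>w Yw = X + cupw \<circ>\<^sub>w capw"
  by (simp add: web_relations(5)) (simp add: web_relations(4))

lemma lay_H:
  "idn1 i \<otimes>\<^sub>w (Lw \<circ>\<^sub>w Yw) \<otimes>\<^sub>w idn1 j = idn1 i \<otimes>\<^sub>w X \<otimes>\<^sub>w idn1 j +
    (idn1 i \<otimes>\<^sub>w cupw \<otimes>\<^sub>w idn1 j) \<circ>\<^sub>w (idn1 i \<otimes>\<^sub>w capw \<otimes>\<^sub>w idn1 j)"
  unfolding idn1_def sp_lay_comp[OF cup_cap_Hom] H_sum by (simp only: sp_bilinear)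

lemma jw_H:
  assumes "i + 2 + j = n"
  shows "sp.jw n \<circ>\<^sub>w (idn1 i \<otimes>\<^sub>w (Lw \<circ>\<^sub>w Yw) \<otimes>\<^sub>w idn1 j) = 0"
    and "(idn1 i \<otimes>\<^sub>w (Lw \<circ>\<^sub>w Yw) \<otimes>\<^sub>w idn1 j) \<circ>\<^sub>w sp.jw n = 0"
proof -
  have 1: "sp.jw n \<circ>\<^sub>w (idn1 i \<otimes>\<^sub>w X \<otimes>\<^sub>w idn1 j) = 0" "sp.jw n \<circ>\<^sub>w (idn1 i \<otimes>\<^sub>w cupw \<otimes>\<^sub>w idn1 j) = 0"
    using sp.jw_X[OF assms] sp.jw_cup[OF assms] .
  have 2: "(idn1 i \<otimes>\<^sub>w X \<otimes>\<^sub>w idn1 j) \<circ>\<^sub>w sp.jw n = 0" "(idn1 i \<otimes>\<^sub>w capw \<otimes>\<^sub>w idn1 j) \<circ>\<^sub>w sp.jw n = 0"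
    using opp.jw_X[OF assms] opp.jw_cup[OF assms] unfolding opp_jw .
  show "sp.jw n \<circ>\<^sub>w (idn1 i \<otimes>\<^sub>w (Lw \<circ>\<^sub>w Yw) \<otimes>\<^sub>w idn1 j) = 0"
    unfolding lay_H sp_bilinear using 1 by (simp flip: sp_comp_assoc)
  show "(idn1 i \<otimes>\<^sub>w (Lw \<circ>\<^sub>w Yw) \<otimes>\<^sub>w idn1 j) \<circ>\<^sub>w sp.jw n = 0"
    unfolding lay_H sp_bilinear using 2 by (simp add: sp_comp_assoc)
qed

text \<open>By the bigon relation a merge is a multiple of itself composed with split and merge, and
  split after merge is X + U, whose layers are killed. The same holds for a split.\<close>

lemma jw_Y_L:
  assumes n: "i + 2 + j = n"
  shows "(idn1 i \<otimes>\<^sub>w Yw \<otimes>\<^sub>w idn1 j) \<circ>\<^sub>w sp.jw n = 0" "sp.jw n \<circ>\<^sub>w (idn1 i \<otimes>\<^sub>w Lw \<otimes>\<^sub>w idn1 j) = 0"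
proof -
  let ?c = "- ((qint 2)\<^sup>2)"
  have c: "?c \<noteq> 0" using qint_nonzero[of 2] by simp
  have H: "Lw \<circ>\<^sub>w Yw \<in> Hom [T1, T1] [T1, T1]" by (rule Hom_comp[OF Y_Hom(2,1)])
  have "Yw \<circ>\<^sub>w (Lw \<circ>\<^sub>w Yw) = ?c *\<^sub>w Yw"
    unfolding sp_comp_assoc[symmetric] web_relations(3) sp_bilinear ident_comp(1)[OF Y_Hom(1)] ..
  then have "?c *\<^sub>w (idn1 i \<otimes>\<^sub>w Yw \<otimes>\<^sub>w idn1 j) =
      (idn1 i \<otimes>\<^sub>w Yw \<otimes>\<^sub>w idn1 j) \<circ>\<^sub>w (idn1 i \<otimes>\<^sub>w (Lw \<circ>\<^sub>w Yw) \<otimes>\<^sub>w idn1 j)"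
    unfolding idn1_def sp_lay_comp[OF Y_Hom(1) H] by (simp only: sp_bilinear)
  then have "?c *\<^sub>w ((idn1 i \<otimes>\<^sub>w Yw \<otimes>\<^sub>w idn1 j) \<circ>\<^sub>w sp.jw n) = 0"
    unfolding sp_bilinear(3)[symmetric] by (simp only: sp_comp_assoc jw_H(2)[OF n] sp_zero)
  then show "(idn1 i \<otimes>\<^sub>w Yw \<otimes>\<^sub>w idn1 j) \<circ>\<^sub>w sp.jw n = 0"
    using c spider.scale_eq_0_iff by blast
  have "(Lw \<circ>\<^sub>w Yw) \<circ>\<^sub>w Lw = ?c *\<^sub>w Lw"
    unfolding sp_comp_assoc web_relations(3) sp_bilinear ident_comp(2)[OF Y_Hom(2)] ..
  then have "?c *\<^sub>w (idn1 i \<otimes>\<^sub>w Lw \<otimes>\<^sub>w idn1 j) =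
      (idn1 i \<otimes>\<^sub>w (Lw \<circ>\<^sub>w Yw) \<otimes>\<^sub>w idn1 j) \<circ>\<^sub>w (idn1 i \<otimes>\<^sub>w Lw \<otimes>\<^sub>w idn1 j)"
    unfolding idn1_def sp_lay_comp[OF H Y_Hom(2)] by (simp only: sp_bilinear)
  then have "?c *\<^sub>w (sp.jw n \<circ>\<^sub>w (idn1 i \<otimes>\<^sub>w Lw \<otimes>\<^sub>w idn1 j)) = 0"
    unfolding sp_bilinear(4)[symmetric] by (simp only: sp_comp_assoc[symmetric] jw_H(1)[OF n] sp_zero)
  then show "sp.jw n \<circ>\<^sub>w (idn1 i \<otimes>\<^sub>w Lw \<otimes>\<^sub>w idn1 j) = 0"
    using c spider.scale_eq_0_iff by blast
qed

lemma jw_prj_inc: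
  assumes "T2 \<in> set t"
  shows "prj t \<circ>\<^sub>w sp.jw (wt t) = 0" "sp.jw (wt t) \<circ>\<^sub>w inc t = 0"
proof -
  obtain ys zs where t: "t = ys @ T2 # zs" using split_list[OF assms] by blast
  have n: "wt ys + 2 + wt zs = wt t" by (simp add: t wt_append)
  have "prj t = (prj ys \<otimes>\<^sub>w ident [T2] \<otimes>\<^sub>w prj zs) \<circ>\<^sub>w (idn1 (wt ys) \<otimes>\<^sub>w Yw \<otimes>\<^sub>w idn1 (wt zs))"
    unfolding idn1_def
    by (simp add: t prj_append ident_comp(2)[OF prj_Hom] ident_comp(1)[OF Y_Hom(1)]
        sp_interchange[OF prj_Hom Hom_ident Hom_tens[OF Hom_ident prj_Hom] Hom_tens[OF Y_Hom(1) Hom_ident]]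
        sp_interchange[OF Hom_ident Y_Hom(1) prj_Hom Hom_ident])
  then show "prj t \<circ>\<^sub>w sp.jw (wt t) = 0" by (simp only: sp_comp_assoc jw_Y_L(1)[OF n] sp_zero)
  have "inc t = (idn1 (wt ys) \<otimes>\<^sub>w Lw \<otimes>\<^sub>w idn1 (wt zs)) \<circ>\<^sub>w (inc ys \<otimes>\<^sub>w ident [T2] \<otimes>\<^sub>w inc zs)"
    unfolding idn1_def
    by (simp add: t inc_append ident_comp(1)[OF inc_Hom] ident_comp(2)[OF Y_Hom(2)]
        sp_interchange[OF Hom_ident inc_Hom Hom_tens[OF Y_Hom(2) Hom_ident] Hom_tens[OF Hom_ident inc_Hom]]
        sp_interchange[OF Y_Hom(2) Hom_ident Hom_ident inc_Hom])
  then show "sp.jw (wt t) \<circ>\<^sub>w inc t = 0" by (simp only: sp_comp_assoc[symmetric] jw_Y_L(2)[OF n] sp_zero)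
qed

lemma Low_jw: "sp.Low n m f \<Longrightarrow> f \<circ>\<^sub>w sp.jw n = 0"
proof (induction rule: sp.Low.induct)
  case (cap w i j m n)
  then show ?case using opp.jw_cup[of i j n] by (simp add: sp_comp_assoc opp_jw)
next
  case (X w n m i j)
  then show ?case using opp.jw_X[of i j n] by (simp add: sp_comp_assoc opp_jw)
qed (simp_all add: sp_bilinear)

lemma jw_opp_Low: "opp.Low n m f \<Longrightarrow> sp.jw n \<circ>\<^sub>w f = 0"
proof (induction rule: opp.Low.induct)
  case (cap w i j m n)
  then show ?case using sp.jw_cup[of i j n] by (simp flip: sp_comp_assoc)
next
  case (X w n m i j)
  then show ?case using sp.jw_X[of i j n] by (simp flip: sp_comp_assoc)
qed (simp_all add: sp_bilinear)

lemma jw_Hom: "sp.jw n \<in> Hom (replicate n T1) (replicate n T1)"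
  using sp.jw_hom[of n] by (simp add: hom1_def)

text \<open>With \<open>t\<close> replaced by single strands, \<open>w\<close> has
  \<open>wt t\<close> outputs. If these are fewer than n, it lies in the ideal. If they are n, it is
  a scalar modulo the ideal, but then \<open>t\<close> has a double letter, and the corresponding
  merge in \<open>prj t\<close> is killed. Passing from \<open>t\<close> to single strands and back
  costs only the nonzero factor \<open>kappa t\<close>.\<close>

lemma jw_annihilates:
  assumes less: "weight_less (weight t) (weight (replicate n T1))"
  shows "w \<in> Hom (replicate n T1) t \<Longrightarrow> w \<circ>\<^sub>w sp.jw n = 0"
    and "w \<in> Hom t (replicate n T1) \<Longrightarrow> sp.jw n \<circ>\<^sub>w w = 0"
proof -
  note b = weight_less_wt[OF less]
  assume w: "w \<in> Hom (replicate n T1) t"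
  have "prj t \<circ>\<^sub>w ((inc t \<circ>\<^sub>w w) \<circ>\<^sub>w sp.jw n) = 0"
  proof (cases "wt t < n")
    case True
    then show ?thesis by (simp only: Low_jw[OF sp.G_Low[OF Hom_G(1)[OF w]]] sp_zero)
  next
    case False
    then have n: "wt t = n" using b(1) by simp
    obtain c where "sp.Low n n (inc t \<circ>\<^sub>w w - c *\<^sub>w idn1 n)"
      using sp.G_idn_Low[of n "inc t \<circ>\<^sub>w w"] Hom_G(1)[OF w] n by auto
    from Low_jw[OF this] have "(inc t \<circ>\<^sub>w w) \<circ>\<^sub>w sp.jw n = c *\<^sub>w sp.jw n"
      using sp_bilinear(1)[of "inc t \<circ>\<^sub>w w - c *\<^sub>w idn1 n" "c *\<^sub>w idn1 n" "sp.jw n"] sp.idn_comp_left[OF sp.jw_hom, of n]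
      by (simp add: sp_bilinear(3))
    then show ?thesis using jw_prj_inc(1)[OF b(2)[OF n]] n by (simp add: sp_bilinear)
  qed
  then have "kappa t *\<^sub>w (w \<circ>\<^sub>w sp.jw n) = 0"
    by (simp add: sp_bilinear prj_inc ident_comp(1)[OF w] flip: sp_comp_assoc)
  then show "w \<circ>\<^sub>w sp.jw n = 0" using kappa_nonzero by (simp add: spider.scale_eq_0_iff)
next
  note b = weight_less_wt[OF less]
  assume w: "w \<in> Hom t (replicate n T1)"
  have G: "opp.G n (wt t) (w \<circ>\<^sub>w prj t)" by (rule G_opposite[OF Hom_G(2)[OF w]])
  have "(sp.jw n \<circ>\<^sub>w (w \<circ>\<^sub>w prj t)) \<circ>\<^sub>w inc t = 0"
  proof (cases "wt t < n")
    case True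
    then show ?thesis by (simp only: jw_opp_Low[OF opp.G_Low[OF G]] sp_zero)
  next
    case False
    then have n: "wt t = n" using b(1) by simp
    obtain c where "opp.Low n n (w \<circ>\<^sub>w prj t - c *\<^sub>w idn1 n)"
      using opp.G_idn_Low[of n "w \<circ>\<^sub>w prj t"] G n by auto
    from jw_opp_Low[OF this] have "sp.jw n \<circ>\<^sub>w (w \<circ>\<^sub>w prj t) = c *\<^sub>w sp.jw n"
      using sp_bilinear(2)[of "sp.jw n" "w \<circ>\<^sub>w prj t - c *\<^sub>w idn1 n" "c *\<^sub>w idn1 n"] sp.idn_comp_right[OF sp.jw_hom, of n]
      by (simp add: sp_bilinear(4))
    then show ?thesis using jw_prj_inc(2)[OF b(2)[OF n]] n by (simp add: sp_bilinear)
  qed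
  then have "kappa t *\<^sub>w (sp.jw n \<circ>\<^sub>w w) = 0"
    by (simp add: sp_bilinear prj_inc ident_comp(2)[OF w] sp_comp_assoc)
  then show "sp.jw n \<circ>\<^sub>w w = 0" using kappa_nonzero by (simp add: spider.scale_eq_0_iff)
qed

lemma is_clasp_jw: "is_clasp (replicate n T1) (sp.jw n)"
  unfolding is_clasp_def using jw_Hom jw_nonzero sp.jw_idem jw_annihilates by blast

lemma weight_steps:
  "weight_less (int n, 0) (int (n + 2), 0)"
  "weight_less (weight (replicate i T1 @ [T2] @ replicate j T1)) (weight (replicate (i + 2 + j) T1))"
proof -
  let ?m = "int n + 2"
  \<comment> \<open>Removing two single letters subtracts the simple root (2,-1) twice and (-2,2)
    once; the second step leads to the nondominant weight (n + 2, -1).\<close>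
  have 1: "weight_less (?m - 2, 1) (?m, 0)" using weight_less.step1[of ?m 0] by simp
  have 2: "weight_less (?m, - 1) (?m - 2, 1)" using weight_less.step2[of "?m - 2" 1] by simp
  have 3: "weight_less (?m - 2, 0) (?m, - 1)" using weight_less.step1[of ?m "- 1"] by simp
  show "weight_less (int n, 0) (int (n + 2), 0)"
    using weight_less.trans[OF 3 weight_less.trans[OF 2 1]] by (simp add: add.commute)
  have c: "count_list (replicate k T1) T1 = k" "count_list (replicate k T1) T2 = 0" for k by (induction k) auto
  show "weight_less (weight (replicate i T1 @ [T2] @ replicate j T1)) (weight (replicate (i + 2 + j) T1))"
    using weight_less.step1[of "int (i + 2 + j)" 0] by (simp add: weight_def c algebra_simps)
qed

text \<open>The definition of a clasp speaks of morphisms from words of lower weight. A cup and a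
  split start at such words; a crossing does not, but it is split after merge minus
  \<open>U\<close>, and both terms factor through such words.\<close>

lemma clasp_opp_Low:
  assumes P: "is_clasp (replicate n T1) P"
  shows "opp.Low n m f \<Longrightarrow> P \<circ>\<^sub>w f = 0"
proof -
  have kill: "P \<circ>\<^sub>w w = 0" if "w \<in> Hom t (replicate n T1)" "weight_less (weight t) (weight (replicate n T1))" for w t
    using P that by (auto simp: is_clasp_def)
  have cup: "P \<circ>\<^sub>w (idn1 i \<otimes>\<^sub>w cupw \<otimes>\<^sub>w idn1 j) = 0" if n: "n = i + 2 + j" for i j
  proof (rule kill)
    show "idn1 i \<otimes>\<^sub>w cupw \<otimes>\<^sub>w idn1 j \<in> Hom (replicate (i + j) T1) (replicate n T1)"
      using sp.at_hom[OF hom1_gens(1), of "i + j" i j n] n by (simp add: hom1_def)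
    show "weight_less (weight (replicate (i + j) T1)) (weight (replicate n T1))"
      using weight_steps(1)[of "i + j"] unfolding weight_replicate n by (simp add: add_ac)
  qed
  have L: "P \<circ>\<^sub>w (idn1 i \<otimes>\<^sub>w Lw \<otimes>\<^sub>w idn1 j) = 0" if n: "n = i + 2 + j" for i j
  proof (rule kill)
    have "replicate n T1 = replicate i T1 @ [T1, T1] @ replicate j T1"
      unfolding n by (rule replicate_split)
    then show "idn1 i \<otimes>\<^sub>w Lw \<otimes>\<^sub>w idn1 j \<in> Hom (replicate i T1 @ [T2] @ replicate j T1) (replicate n T1)"
      unfolding idn1_def by (simp only:) (intro Hom_tens Hom_ident Y_Hom)
    show "weight_less (weight (replicate i T1 @ [T2] @ replicate j T1)) (weight (replicate n T1))"
      using weight_steps(2)[of i j] n by simp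
  qed
  have lay_X: "P \<circ>\<^sub>w (idn1 i \<otimes>\<^sub>w X \<otimes>\<^sub>w idn1 j) = 0" if n: "n = i + 2 + j" for i j
  proof -
    have "P \<circ>\<^sub>w (idn1 i \<otimes>\<^sub>w (Lw \<circ>\<^sub>w Yw) \<otimes>\<^sub>w idn1 j) = 0"
      unfolding idn1_def sp_lay_comp[OF Y_Hom(2,1), symmetric] using L[OF n]
      by (simp add: idn1_def flip: sp_comp_assoc)
    moreover have "P \<circ>\<^sub>w ((idn1 i \<otimes>\<^sub>w cupw \<otimes>\<^sub>w idn1 j) \<circ>\<^sub>w (idn1 i \<otimes>\<^sub>w capw \<otimes>\<^sub>w idn1 j)) = 0"
      using cup[OF n] by (simp flip: sp_comp_assoc)
    ultimately show ?thesis unfolding lay_H sp_bilinear by simp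
  qed
  have "opp.Low n' m f \<Longrightarrow> n' = n \<Longrightarrow> P \<circ>\<^sub>w f = 0" for n'
  proof (induction rule: opp.Low.induct)
    case (cap w i j m n')
    then show ?case using cup[of i j] by (simp flip: sp_comp_assoc)
  next
    case (X w n' m i j)
    then show ?case using lay_X[of i j] by (simp flip: sp_comp_assoc)
  qed (simp_all add: sp_bilinear)
  then show "opp.Low n m f \<Longrightarrow> P \<circ>\<^sub>w f = 0" by blast
qed

text \<open>\<open>P\<close> composed with \<open>sp.jw n\<close> is evaluated twice. The second
  factor is the identity modulo cups and crossings that \<open>P\<close> kills, so the result is
  \<open>P\<close>. The first factor is a scalar modulo the ideal that \<open>sp.jw n\<close> kills,
  so the result is a multiple of \<open>sp.jw n\<close>. A nonzero idempotent multiple of a nonzero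
  idempotent is that idempotent.\<close>

lemma clasp_unique:
  assumes P: "is_clasp (replicate n T1) P"
  shows "P = sp.jw n"
proof -
  have H: "P \<in> Hom (replicate n T1) (replicate n T1)" and idem: "P \<circ>\<^sub>w P = P" and P0: "P \<noteq> 0"
    using P by (auto simp: is_clasp_def)
  have "P \<circ>\<^sub>w (sp.jw n - idn1 n) = 0"
    using clasp_opp_Low[OF P opp.jw_Low[of n]] by (simp only: opp_jw)
  then have 1: "P \<circ>\<^sub>w sp.jw n = P"
    using sp_bilinear(2)[of P "sp.jw n - idn1 n" "idn1 n"] ident_comp(2)[OF H] by (simp add: idn1_def)
  have "sp.G n n P"
    using Hom_G(1)[OF H] ident_comp(1)[OF H] by (simp add: inc_prj_replicate wt_replicate idn1_def)
  then obtain c where "sp.Low n n (P - c *\<^sub>w idn1 n)" using sp.G_idn_Low by blast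
  from Low_jw[OF this] have "P \<circ>\<^sub>w sp.jw n = c *\<^sub>w sp.jw n"
    using sp_bilinear(1)[of "P - c *\<^sub>w idn1 n" "c *\<^sub>w idn1 n" "sp.jw n"] sp.idn_comp_left[OF sp.jw_hom, of n]
    by (simp add: sp_bilinear(3))
  then have c: "P = c *\<^sub>w sp.jw n" using 1 by simp
  then have "(c * c) *\<^sub>w sp.jw n = c *\<^sub>w sp.jw n" using idem by (simp add: sp_bilinear sp.jw_idem)
  then have "c * c = c" using jw_nonzero[of n] spider.scale_cancel_right by blast
  moreover have "c \<noteq> 0" using P0 c by auto
  ultimately show ?thesis using c by simp
qed

lemma single_clasp_jw: "single_clasp n = sp.jw n"
  unfolding single_clasp_def clasp_def using is_clasp_jw clasp_unique by (rule the_equality)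

theorem corollary4p3:
  fixes n :: nat and Q :: spider
  assumes "n \<ge> 1"
  defines "Q \<equiv> single_clasp (n - 1) \<otimes>\<^sub>w ident [T1]"
  shows "single_clasp n = Q + (if n = 1 then 0 else
           (qint (2 * n) * qint (n + 1) * qint (n - 1) / (qint (2 * n + 2) * qint n * qint n))
             *\<^sub>w (Q \<circ>\<^sub>w (ident (replicate (n - 2) T1) \<otimes>\<^sub>w U) \<circ>\<^sub>w Q)
         + (qint (n - 1) / (qint n * qint 2))
             *\<^sub>w (Q \<circ>\<^sub>w (ident (replicate (n - 2) T1) \<otimes>\<^sub>w X) \<circ>\<^sub>w Q))"
proof -
  obtain m where n: "n = Suc m" using assms(1) by (cases n) auto
  have e: "n - 1 = m" "n - 2 = m - 1" "n = 1 \<longleftrightarrow> m = 0" using n by auto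
  have J: "sp.jw n = sp.jw m \<otimes>\<^sub>w ident [T1] + (if m = 0 then 0 else
      al n *\<^sub>w ((sp.jw m \<otimes>\<^sub>w ident [T1]) \<circ>\<^sub>w (idn1 (m - 1) \<otimes>\<^sub>w (cupw \<circ>\<^sub>w capw)) \<circ>\<^sub>w (sp.jw m \<otimes>\<^sub>w ident [T1]))
      + be n *\<^sub>w ((sp.jw m \<otimes>\<^sub>w ident [T1]) \<circ>\<^sub>w (idn1 (m - 1) \<otimes>\<^sub>w X) \<circ>\<^sub>w (sp.jw m \<otimes>\<^sub>w ident [T1])))"
    unfolding n sp.jw.simps idn1_simps ..
  show ?thesis
    unfolding Q_def single_clasp_jw J al_def be_def idn1_def web_relations(4) e ..
qed

end
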